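(* Let $N:D_N\to L_2$ be a normal integral operator induced by a $K^0$-kernel $N(s,t)$, and suppose that the spectrum of $N$ is contained in a sector $\mathfrak S\subset\mathbb C$ of angle less than $\pi$ with vertex at $0$. Let $E(s,t;\cdot)$ be the spectral function for the kernel $N(s,t)$. Then for every function $\phi:\mathbb C\to\mathbb C$ of the form $\phi(z)=z\,v(z)$, where $v$ is a bounded Borel measurable function on $\mathbb C$, the operator $\phi(N)$ is also an integral operator with a $K^0$-kernel. Moreover, the $K^0$-kernel $\Phi(s,t)$ inducing $\phi(N)$ can be represented by the principal value integral with singularity at $z=0$: $$ \Phi(s,t)=\int_{\mathbb C}\phi(z)\,E(s,t;dz)=\lim_{\varepsilon\to 0}\int_{\omega_\varepsilon}\phi(z)\,E(s,t;dz)\qquad\text{for all } s,t\in\mathbb R_+, $$ where $\omega_\varepsilon=\{z\in\mathbb C:|z|>\varepsilon\}$, and where the integral converges to $\Phi$ in $C(\mathbb R_+^2,\mathbb C)$ as $\varepsilon\to 0$ along an arbitrary decreasing sequence of positive numbers; that is, for every sequence $\varepsilon_n>0$ decreasing to $0$, the functions $\Phi_{\varepsilon_n}(s,t)=\int_{\omega_{\varepsilon_n}}\phi(z)\,E(s,t;dz)$ converge to $\Phi(s,t)$ uniformly on $\mathbb R_+^2$.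
   Context: Notation: $\mathbb R_+=[0,\infty)$. $L_2$ is the Hilbert space of complex-valued measurable functions on $\mathbb R_+$ that are square integrable with respect to Lebesgue measure, with inner product $\langle f,g\rangle=\int_{\mathbb R_+}f(s)\overline{g(s)}\,ds$ and norm $\|f\|=\langle f,f\rangle^{1/2}$. Integral operators: a linear operator $T:D_T\to L_2$, with $D_T$ a dense linear manifold in $L_2$, is integral if there is a measurable, almost everywhere finite-valued function $K(s,t)$ on $\mathbb R_+^2$ (a kernel, which is said to induce $T$) such that for every $f\in D_T$, $(Tf)(s)=\int_{\mathbb R_+}K(s,t)f(t)\,dt$ for almost every $s\in\mathbb R_+$. A kernel is Carleman if $K(s,\cdot)\in L_2$ for almost every $s$; an integral operator induced by a Carleman kernel is a Carleman operator, and it is bi-Carleman if in addition $K(\cdot,t)\in L_2$ for almost every $t$. In the bi-Carleman case the kernel induces two Carleman functions from $\mathbb R_+$ to $L_2$, $k(s)=\overline{K(s,\cdot)}$ and $k^*(t)=K(\cdot,t)$, for all $s,t$ for which $K(s,\cdot)\in L_2$ and $K(\cdot,t)\in L_2$. For a locally compact space $X$ and a Banach space $B$, $C(X,B)$ is the Banach space of all continuous functions $f:X\to B$ vanishing at infinity (for every $\varepsilon>0$ there is a compact set in $X$ outside of which $\|f(x)\|_B<\varepsilon$), with norm $\sup_{x\in X}\|f(x)\|_B$. A kernel $K$ of a bi-Carleman operator is a $K^0$-kernel if $K\in C(\mathbb R_+^2,\mathbb C)$ and its Carleman functions satisfy $k,k^*\in C(\mathbb R_+,L_2)$. Normal operators: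 a normal operator $N:D_N\to L_2$ is a closed linear operator with domain $D_N=D_{N^*}$ dense in $L_2$ and $NN^*=N^*N$. $E(\cdot)$ denotes its resolution of the identity (projection-valued spectral measure on the Borel subsets of $\mathbb C$). For a Borel measurable function $f$ on $\mathbb C$, $f(N)$ is the normal operator defined by $\langle f(N)h,g\rangle=\int_{\mathbb C}f(z)\langle E(dz)h,g\rangle$ for $h,g\in D_{f(N)}$, with domain $D_{f(N)}=\{x\in L_2:\int_{\mathbb C}|f(z)|^2\langle E(dz)x,x\rangle<\infty\}$. Sector: a sector of angle less than $\pi$ with vertex at $0$ is a set $\{re^{i\theta}: r\ge 0,\ \theta_1\le\theta\le\theta_2\}$ with $\theta_2-\theta_1<\pi$. Spectral function: let $N$ be a normal integral operator with $K^0$-kernel $N(s,t)$ and Carleman function $\nu(s)=\overline{N(s,\cdot)}$. Let $\Omega_0$ be the set of all Borel sets $\omega\subset\mathbb C$ whose closures do not contain $0$. For $\omega\in\Omega_0$ with characteristic function $\chi_\omega$, put $v_\omega(z)=\chi_\omega(z)/z$ (equal to $0$ outside $\omega$). Then $v_\omega(N)$ is bounded, and the orthogonal projection $E(\omega)=Nv_\omega(N)$ is a bi-Carleman operator with Carleman functions $e(s;\omega)=(v_\omega(N))^*(\nu(s))$ and $e^*(t;\omega)=e(t;\omega)$, belonging to $C(\mathbb R_+,L_2)$; its $K^0$-kernel is $E(s,t;\omega)=\langle e(t;\omega),e(s;\omega)\rangle$, $(s,t)\in\mathbb R_+^2$. The spectral function for the kernel $N(s,t)$ is the set function $E(s,t;\cdot):\Omega_0\to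 C(\mathbb R_+^2,\mathbb C)$ whose value at each $\omega\in\Omega_0$ is the $K^0$-kernel $E(s,t;\omega)$ of $E(\omega)$. For fixed $s,t\in\mathbb R_+$ and $\varepsilon>0$, and for every Borel set $\sigma\subset\omega_\varepsilon=\{z:|z|>\varepsilon\}$, one has $E(s,t;\sigma)=\langle E(\sigma)(e(t;\omega_\varepsilon)),e(s;\omega_\varepsilon)\rangle$, so $E(s,t;\cdot)$ restricted to the Borel subsets of $\omega_\varepsilon$ is a complex measure, and $\int_{\omega_\varepsilon}\phi(z)\,E(s,t;dz)$ is the Lebesgue-Stieltjes integral with respect to it. *)

theory Defs
  imports "HOL-Analysis.Analysis"
begin

section \<open>The Hilbert space of square-integrable functions on the half-line\<close>

abbreviation half_line :: "real set" where
  "half_line \<equiv> {0..}"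

abbreviation half_leb :: "real measure" where
  "half_leb \<equiv> lebesgue_on half_line"

definition square_integrable :: "(real \<Rightarrow> complex) \<Rightarrow> bool" where
  "square_integrable f \<longleftrightarrow>
     f \<in> borel_measurable half_leb \<and> integrable half_leb (\<lambda>s. (norm (f s))\<^sup>2)"

definition l2_rel :: "(real \<Rightarrow> complex) \<Rightarrow> (real \<Rightarrow> complex) \<Rightarrow> bool" where
  "l2_rel f g \<longleftrightarrow> square_integrable f \<and> square_integrable g \<and> (AE s in half_leb. f s = g s)"

lemma square_integrable_zero: "square_integrable (\<lambda>_. 0)"
  by (simp add: square_integrable_def)

lemma square_integrable_scale:
  assumes "square_integrable f"
  shows "square_integrable (\<lambda>s. c * f s)"
  using assms by (auto simp: square_integrable_def norm_mult power_mult_distrib)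

lemma square_integrable_add:
  assumes "square_integrable f" "square_integrable g"
  shows "square_integrable (\<lambda>s. f s + g s)"
proof -
  have m: "f \<in> borel_measurable half_leb" "g \<in> borel_measurable half_leb"
    and i: "integrable half_leb (\<lambda>s. 2 * (norm (f s))\<^sup>2 + 2 * (norm (g s))\<^sup>2)"
    using assms by (auto simp: square_integrable_def)
  have "(norm (f s + g s))\<^sup>2 \<le> 2 * (norm (f s))\<^sup>2 + 2 * (norm (g s))\<^sup>2" for s
  proof -
    have "(norm (f s + g s))\<^sup>2 \<le> (norm (f s) + norm (g s))\<^sup>2"
      by (intro power_mono norm_triangle_ineq) auto
    also have "\<dots> \<le> 2 * (norm (f s))\<^sup>2 + 2 * (norm (g s))\<^sup>2"
      using sum_squares_bound[of "norm (f s)" "norm (g s)"]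
      by (simp add: power2_sum)
    finally show ?thesis .
  qed
  then have "integrable half_leb (\<lambda>s. (norm (f s + g s))\<^sup>2)"
    using m by (intro Bochner_Integration.integrable_bound[OF i]) auto
  with m show ?thesis by (simp add: square_integrable_def)
qed

lemma square_integrable_mult_cnj:
  assumes "square_integrable f" "square_integrable g"
  shows "integrable half_leb (\<lambda>s. f s * cnj (g s))"
proof -
  have m: "f \<in> borel_measurable half_leb" "g \<in> borel_measurable half_leb"
    and i: "integrable half_leb (\<lambda>s. (norm (f s))\<^sup>2 + (norm (g s))\<^sup>2)"
    using assms by (auto simp: square_integrable_def)
  have "norm (f s * cnj (g s)) \<le> norm ((norm (f s))\<^sup>2 + (norm (g s))\<^sup>2)" for s
  proof -
    have "0 \<le> norm (f s) * norm (g s)" by simp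
    then have "norm (f s) * norm (g s) \<le> (norm (f s))\<^sup>2 + (norm (g s))\<^sup>2"
      using sum_squares_bound[of "norm (f s)" "norm (g s)"] by linarith
    then show ?thesis by (simp add: norm_mult)
  qed
  moreover have "cnj \<in> borel_measurable borel"
    by (intro borel_measurable_continuous_onI continuous_intros)
  ultimately show ?thesis
    using m by (intro Bochner_Integration.integrable_bound[OF i]) (auto intro!: borel_measurable_times measurable_compose[of g])
qed

quotient_type l2 = "real \<Rightarrow> complex" / partial: l2_rel
proof (rule part_equivpI)
  show "\<exists>x. l2_rel x x"
    using square_integrable_zero by (auto simp: l2_rel_def)
  show "symp l2_rel"
    by (auto simp: symp_def l2_rel_def)
  show "transp l2_rel"
    unfolding transp_def l2_rel_def by (auto elim: eventually_elim2)
qed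

lift_definition scaleC :: "complex \<Rightarrow> l2 \<Rightarrow> l2" (infixr "*\<^sub>C" 75) is "\<lambda>c f s. c * f s"
  by (auto simp: l2_rel_def square_integrable_scale)

lift_definition cinner :: "l2 \<Rightarrow> l2 \<Rightarrow> complex" is
  "\<lambda>f g. \<integral>s. f s * cnj (g s) \<partial>half_leb"
proof -
  fix f f' g g' assume A: "l2_rel f f'" "l2_rel g g'"
  have m: "integrable half_leb (\<lambda>s. f s * cnj (g s))" "integrable half_leb (\<lambda>s. f' s * cnj (g' s))"
    using A by (auto simp: l2_rel_def intro: square_integrable_mult_cnj)
  have "AE s in half_leb. f s * cnj (g s) = f' s * cnj (g' s)"
    using A by (auto simp: l2_rel_def elim: eventually_elim2)
  then show "(\<integral>s. f s * cnj (g s) \<partial>half_leb) = (\<integral>s. f' s * cnj (g' s) \<partial>half_leb)"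
    using m by (intro integral_cong_AE) auto
qed

instantiation l2 :: real_inner
begin

lift_definition zero_l2 :: l2 is "\<lambda>_. 0"
  by (simp add: l2_rel_def square_integrable_zero)

lift_definition plus_l2 :: "l2 \<Rightarrow> l2 \<Rightarrow> l2" is "\<lambda>f g s. f s + g s"
  by (auto simp: l2_rel_def intro: square_integrable_add elim: eventually_elim2)

definition uminus_l2 :: "l2 \<Rightarrow> l2" where "uminus_l2 f = (-1) *\<^sub>C f"

definition minus_l2 :: "l2 \<Rightarrow> l2 \<Rightarrow> l2" where "minus_l2 f g = f + (- g)"

definition scaleR_l2 :: "real \<Rightarrow> l2 \<Rightarrow> l2" where "scaleR_l2 r f = complex_of_real r *\<^sub>C f"

definition inner_l2 :: "l2 \<Rightarrow> l2 \<Rightarrow> real" where "inner_l2 f g = Re (cinner f g)"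

definition norm_l2 :: "l2 \<Rightarrow> real" where "norm_l2 f = sqrt (Re (cinner f f))"

definition dist_l2 :: "l2 \<Rightarrow> l2 \<Rightarrow> real" where "dist_l2 f g = norm (f - g)"

definition sgn_l2 :: "l2 \<Rightarrow> l2" where "sgn_l2 f = inverse (norm f) *\<^sub>R f"

definition uniformity_l2 :: "(l2 \<times> l2) filter" where
  "uniformity_l2 = (INF e\<in>{0 <..}. principal {(f, g). dist f g < e})"

definition open_l2 :: "l2 set \<Rightarrow> bool" where
  "open_l2 U \<longleftrightarrow> (\<forall>f\<in>U. eventually (\<lambda>(f', g). f' = f \<longrightarrow> g \<in> U) uniformity)"

instance
proof
  fix f g h :: l2 and a b r :: real and U :: "l2 set"
  show "f + g + h = f + (g + h)"
    by transfer (auto simp: l2_rel_def add.assoc intro!: square_integrable_add)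
  show "f + g = g + f"
    by transfer (auto simp: l2_rel_def add.commute intro!: square_integrable_add)
  show "0 + f = f"
    by transfer (auto simp: l2_rel_def)
  show "- f + f = 0"
    unfolding uminus_l2_def
    by transfer (auto simp: l2_rel_def square_integrable_zero)
  show "f - g = f + - g"
    by (simp add: minus_l2_def)
  show "r *\<^sub>R (f + g) = r *\<^sub>R f + r *\<^sub>R g"
    unfolding scaleR_l2_def
    by transfer (auto simp: l2_rel_def distrib_left intro!: square_integrable_add square_integrable_scale
        dest: square_integrable_scale square_integrable_add)
  show "(a + b) *\<^sub>R f = a *\<^sub>R f + b *\<^sub>R f"
    unfolding scaleR_l2_def
    by transfer (auto simp: l2_rel_def distrib_right intro!: square_integrable_add square_integrable_scale)
  show "a *\<^sub>R b *\<^sub>R f = (a * b) *\<^sub>R f"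
    unfolding scaleR_l2_def
    by transfer (auto simp: l2_rel_def mult.assoc intro!: square_integrable_scale)
  show "1 *\<^sub>R f = f"
    unfolding scaleR_l2_def
    by transfer (auto simp: l2_rel_def)
  show "dist f g = norm (f - g)" by (simp add: dist_l2_def)
  show "sgn f = inverse (norm f) *\<^sub>R f" by (simp add: sgn_l2_def)
  show "uniformity = (INF e\<in>{0 <..}. principal {(f, g :: l2). dist f g < e})"
    by (simp add: uniformity_l2_def)
  show "open U \<longleftrightarrow> (\<forall>f\<in>U. eventually (\<lambda>(f', g). f' = f \<longrightarrow> g \<in> U) uniformity)"
    by (simp add: open_l2_def)
  show "inner f g = inner g f"
  proof -
    have "cinner f g = cnj (cinner g f)"
      by transfer (simp add: Bochner_Integration.integral_cnj[symmetric] mult.commute del: Bochner_Integration.integral_cnj)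
    then show ?thesis by (simp add: inner_l2_def)
  qed
  show "inner (f + g) h = inner f h + inner g h"
    unfolding inner_l2_def
    by transfer (auto simp: l2_rel_def distrib_right square_integrable_mult_cnj)
  show "inner (r *\<^sub>R f) g = r * inner f g"
    unfolding inner_l2_def scaleR_l2_def
    by transfer (simp add: mult.assoc)
  have *: "Re (\<integral>s. u s * cnj (u s) \<partial>half_leb) = (\<integral>s. (norm (u s))\<^sup>2 \<partial>half_leb)" for u
    by (simp add: complex_norm_square[symmetric] del: of_real_power)
  show "0 \<le> inner f f"
    unfolding inner_l2_def by transfer (simp add: *)
  show "inner f f = 0 \<longleftrightarrow> f = 0"
    unfolding inner_l2_def
  proof transfer
    fix u assume "l2_rel u u"
    then have u: "square_integrable u" by (simp add: l2_rel_def)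
    then have "(\<integral>s. (norm (u s))\<^sup>2 \<partial>half_leb) = 0 \<longleftrightarrow> (AE s in half_leb. (norm (u s))\<^sup>2 = 0)"
      by (intro integral_nonneg_eq_0_iff_AE) (auto simp: square_integrable_def)
    with u show "Re (\<integral>s. u s * cnj (u s) \<partial>half_leb) = 0 \<longleftrightarrow> l2_rel u (\<lambda>_. 0)"
      by (simp add: * l2_rel_def square_integrable_zero)
  qed
  show "norm f = sqrt (inner f f)"
    by (simp add: norm_l2_def inner_l2_def)
qed

end


section \<open>Unbounded operators as graphs\<close>

text \<open>An operator is identified with its graph; its domain is \<^term>\<open>Domain T\<close>, and
  \<^term>\<open>S O T\<close> is the graph of the composition that applies \<^term>\<open>S\<close> first.\<close>

type_synonym operator = "(l2 \<times> l2) set"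

definition linear_operator :: "operator \<Rightarrow> bool" where
  "linear_operator T \<longleftrightarrow>
     single_valued T \<and> (0, 0) \<in> T \<and>
     (\<forall>x y x' y'. (x, y) \<in> T \<longrightarrow> (x', y') \<in> T \<longrightarrow> (x + x', y + y') \<in> T) \<and>
     (\<forall>c x y. (x, y) \<in> T \<longrightarrow> (c *\<^sub>C x, c *\<^sub>C y) \<in> T)"

definition densely_defined :: "operator \<Rightarrow> bool" where
  "densely_defined T \<longleftrightarrow> closure (Domain T) = UNIV"

definition adjoint_op :: "operator \<Rightarrow> operator" where
  "adjoint_op T = {(g, h). \<forall>(x, y)\<in>T. cinner y g = cinner x h}"

definition normal_operator :: "operator \<Rightarrow> bool" where
  "normal_operator N \<longleftrightarrow>
     linear_operator N \<and> closed N \<and> densely_defined N \<and>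
     Domain N = Domain (adjoint_op N) \<and> adjoint_op N O N = N O adjoint_op N"

definition resolvent_set :: "operator \<Rightarrow> complex set" where
  "resolvent_set T = {z. \<exists>R. bounded_linear R \<and>
     {(y - z *\<^sub>C x, x) | x y. (x, y) \<in> T} = {(w, R w) | w. True}}"

definition spectrum :: "operator \<Rightarrow> complex set" where
  "spectrum T = - resolvent_set T"

definition sector :: "real \<Rightarrow> real \<Rightarrow> complex set" where
  "sector \<theta>1 \<theta>2 =
     {complex_of_real r * exp (\<i> * complex_of_real \<theta>) | r \<theta>. 0 \<le> r \<and> \<theta>1 \<le> \<theta> \<and> \<theta> \<le> \<theta>2}"


section \<open>Integration with respect to a complex measure\<close>

text \<open>A complex measure is a countably additive set function on the sigma-algebra
  \<^term>\<open>sets M\<close>; the values of the measure \<^term>\<open>M\<close> itself play no role here.\<close>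

definition complex_measure :: "'a measure \<Rightarrow> ('a set \<Rightarrow> complex) \<Rightarrow> bool" where
  "complex_measure M \<mu> \<longleftrightarrow>
     (\<forall>A. range A \<subseteq> sets M \<longrightarrow> disjoint_family A \<longrightarrow> (\<lambda>n. \<mu> (A n)) sums \<mu> (\<Union>n. A n))"

text \<open>The positive part of the Jordan decomposition of a finite signed measure. Negative values
  of \<^term>\<open>\<mu>\<close> are truncated to 0 by \<^const>\<open>ennreal\<close>, which does not change the
  supremum because the empty set is among the competitors.\<close>

definition pos_variation :: "'a measure \<Rightarrow> ('a set \<Rightarrow> real) \<Rightarrow> 'a measure" where
  "pos_variation M \<mu> =
     measure_of (space M) (sets M) (\<lambda>A. SUP B\<in>{B \<in> sets M. B \<subseteq> A}. ennreal (\<mu> B))"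

definition cm_integrable :: "'a measure \<Rightarrow> ('a set \<Rightarrow> complex) \<Rightarrow> ('a \<Rightarrow> complex) \<Rightarrow> bool" where
  "cm_integrable M \<mu> f \<longleftrightarrow> complex_measure M \<mu> \<and>
     integrable (pos_variation M (\<lambda>A. Re (\<mu> A))) f \<and>
     integrable (pos_variation M (\<lambda>A. - Re (\<mu> A))) f \<and>
     integrable (pos_variation M (\<lambda>A. Im (\<mu> A))) f \<and>
     integrable (pos_variation M (\<lambda>A. - Im (\<mu> A))) f"

definition cm_integral :: "'a measure \<Rightarrow> ('a set \<Rightarrow> complex) \<Rightarrow> ('a \<Rightarrow> complex) \<Rightarrow> complex" where
  "cm_integral M \<mu> f =
     (\<integral>z. f z \<partial>pos_variation M (\<lambda>A. Re (\<mu> A))) - (\<integral>z. f z \<partial>pos_variation M (\<lambda>A. - Re (\<mu> A)))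
     + \<i> * ((\<integral>z. f z \<partial>pos_variation M (\<lambda>A. Im (\<mu> A))) - (\<integral>z. f z \<partial>pos_variation M (\<lambda>A. - Im (\<mu> A))))"


section \<open>Spectral measures and functional calculus\<close>

definition orthogonal_projection :: "(l2 \<Rightarrow> l2) \<Rightarrow> bool" where
  "orthogonal_projection P \<longleftrightarrow> bounded_linear P \<and> (\<forall>c x. P (c *\<^sub>C x) = c *\<^sub>C P x) \<and>
     (\<forall>x. P (P x) = P x) \<and> (\<forall>x y. cinner (P x) y = cinner x (P y))"

definition projection_valued_measure :: "(complex set \<Rightarrow> l2 \<Rightarrow> l2) \<Rightarrow> bool" where
  "projection_valued_measure E \<longleftrightarrow>
     (\<forall>A\<in>sets borel. orthogonal_projection (E A)) \<and>
     (\<forall>x. E UNIV x = x) \<and>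
     (\<forall>A\<in>sets borel. \<forall>B\<in>sets borel. \<forall>x. E (A \<inter> B) x = E A (E B x)) \<and>
     (\<forall>A. range A \<subseteq> sets borel \<longrightarrow> disjoint_family A \<longrightarrow>
        (\<forall>x. (\<lambda>n. E (A n) x) sums E (\<Union>n. A n) x))"

definition spectral_measure :: "(complex set \<Rightarrow> l2 \<Rightarrow> l2) \<Rightarrow> l2 \<Rightarrow> complex measure" where
  "spectral_measure E x = measure_of UNIV (sets borel) (\<lambda>A. ennreal (Re (cinner (E A x) x)))"

definition calculus_domain :: "(complex set \<Rightarrow> l2 \<Rightarrow> l2) \<Rightarrow> (complex \<Rightarrow> complex) \<Rightarrow> l2 set" where
  "calculus_domain E f = {x. (\<integral>\<^sup>+z. ennreal ((norm (f z))\<^sup>2) \<partial>spectral_measure E x) < \<infinity>}"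

text \<open>The operator \<open>f(N)\<close>, where \<^term>\<open>E\<close> is the resolution of the identity of \<open>N\<close>.\<close>

definition calculus :: "(complex set \<Rightarrow> l2 \<Rightarrow> l2) \<Rightarrow> (complex \<Rightarrow> complex) \<Rightarrow> operator" where
  "calculus E f = {(h, y). h \<in> calculus_domain E f \<and>
     (\<forall>g\<in>calculus_domain E f. cinner y g = cm_integral borel (\<lambda>A. cinner (E A h) g) f)}"

definition resolution_of_identity :: "operator \<Rightarrow> (complex set \<Rightarrow> l2 \<Rightarrow> l2) \<Rightarrow> bool" where
  "resolution_of_identity N E \<longleftrightarrow> projection_valued_measure E \<and> N = calculus E (\<lambda>z. z)"


section \<open>Integral operators and their kernels\<close>

definition C0_on :: "'a::topological_space set \<Rightarrow> ('a \<Rightarrow> 'b::real_normed_vector) \<Rightarrow> bool" where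
  "C0_on X f \<longleftrightarrow> continuous_on X f \<and>
     (\<forall>\<epsilon>>0. \<exists>C. compact C \<and> C \<subseteq> X \<and> (\<forall>x\<in>X - C. norm (f x) < \<epsilon>))"

text \<open>\<^const>\<open>rep_l2\<close> chooses a representative of an element of \<^typ>\<open>l2\<close>; the choice is
  immaterial, as it only changes both sides of the equation below on null sets.\<close>

definition induces :: "(real \<Rightarrow> real \<Rightarrow> complex) \<Rightarrow> operator \<Rightarrow> bool" where
  "induces K T \<longleftrightarrow>
     (\<lambda>(s, t). K s t) \<in> borel_measurable (lebesgue_on (half_line \<times> half_line)) \<and>
     (\<forall>(f, g)\<in>T. AE s in half_leb.
        integrable half_leb (\<lambda>t. K s t * rep_l2 f t) \<and>
        rep_l2 g s = (\<integral>t. K s t * rep_l2 f t \<partial>half_leb))"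

definition integral_operator :: "operator \<Rightarrow> (real \<Rightarrow> real \<Rightarrow> complex) \<Rightarrow> bool" where
  "integral_operator T K \<longleftrightarrow> linear_operator T \<and> densely_defined T \<and> induces K T"

definition bi_Carleman :: "operator \<Rightarrow> (real \<Rightarrow> real \<Rightarrow> complex) \<Rightarrow> bool" where
  "bi_Carleman T K \<longleftrightarrow> integral_operator T K \<and>
     (AE s in half_leb. square_integrable (\<lambda>t. K s t)) \<and>
     (AE t in half_leb. square_integrable (\<lambda>s. K s t))"

text \<open>The two Carleman functions. They are meaningful only at points where the respective section
  of the kernel is square integrable, since \<^const>\<open>abs_l2\<close> is unspecified on other functions.\<close>

definition carleman_fun :: "(real \<Rightarrow> real \<Rightarrow> complex) \<Rightarrow> real \<Rightarrow> l2" where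
  "carleman_fun K s = abs_l2 (\<lambda>t. cnj (K s t))"

definition carleman_fun' :: "(real \<Rightarrow> real \<Rightarrow> complex) \<Rightarrow> real \<Rightarrow> l2" where
  "carleman_fun' K t = abs_l2 (\<lambda>s. K s t)"

definition K0_kernel :: "operator \<Rightarrow> (real \<Rightarrow> real \<Rightarrow> complex) \<Rightarrow> bool" where
  "K0_kernel T K \<longleftrightarrow> bi_Carleman T K \<and>
     C0_on (half_line \<times> half_line) (\<lambda>(s, t). K s t) \<and>
     (\<forall>s\<ge>0. square_integrable (\<lambda>t. K s t)) \<and> C0_on half_line (carleman_fun K) \<and>
     (\<forall>t\<ge>0. square_integrable (\<lambda>s. K s t)) \<and> C0_on half_line (carleman_fun' K)"


section \<open>The spectral function of a kernel\<close>

definition Omega0 :: "complex set set" where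
  "Omega0 = {\<omega> \<in> sets borel. 0 \<notin> closure \<omega>}"

definition v_fun :: "complex set \<Rightarrow> complex \<Rightarrow> complex" where
  "v_fun \<omega> z = indicator \<omega> z / z"

text \<open>With \<open>\<nu>\<close> the Carleman function of the kernel \<^term>\<open>K\<close>, this is the vector
  \<open>e(s; \<omega>) = (v\<^sub>\<omega>(N))\<^sup>* (\<nu>(s))\<close>; for \<open>\<omega>\<close> in \<^term>\<open>Omega0\<close> the operator
  \<open>v\<^sub>\<omega>(N)\<close> is bounded, so its adjoint is everywhere defined.\<close>

definition e_fun ::
    "(complex set \<Rightarrow> l2 \<Rightarrow> l2) \<Rightarrow> (real \<Rightarrow> real \<Rightarrow> complex) \<Rightarrow> complex set \<Rightarrow> real \<Rightarrow> l2" where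
  "e_fun E K \<omega> s = (THE y. (carleman_fun K s, y) \<in> adjoint_op (calculus E (v_fun \<omega>)))"

text \<open>The kernel inducing \<open>E(\<omega>)\<close>, namely \<open>E(s,t;\<omega>) = \<langle>e(t;\<omega>), e(s;\<omega>)\<rangle>\<close>.\<close>

definition spectral_function ::
    "(complex set \<Rightarrow> l2 \<Rightarrow> l2) \<Rightarrow> (real \<Rightarrow> real \<Rightarrow> complex) \<Rightarrow> complex set \<Rightarrow> real \<Rightarrow> real \<Rightarrow> complex" where
  "spectral_function E K =
     (\<lambda>\<omega>\<in>Omega0. \<lambda>s t. cinner (e_fun E K \<omega> t) (e_fun E K \<omega> s))"

definition omega :: "real \<Rightarrow> complex set" where
  "omega \<epsilon> = {z. \<epsilon> < norm z}"

text \<open>The Borel subsets of \<^term>\<open>omega \<epsilon>\<close> are the sets of \<^term>\<open>restrict_space borel (omega \<epsilon>)\<close>.\<close>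

definition truncated_integrable ::
    "(complex set \<Rightarrow> l2 \<Rightarrow> l2) \<Rightarrow> (real \<Rightarrow> real \<Rightarrow> complex) \<Rightarrow> (complex \<Rightarrow> complex) \<Rightarrow> real \<Rightarrow> real \<Rightarrow> real \<Rightarrow> bool" where
  "truncated_integrable E K \<phi> \<epsilon> s t \<longleftrightarrow>
     cm_integrable (restrict_space borel (omega \<epsilon>)) (\<lambda>\<sigma>. spectral_function E K \<sigma> s t) \<phi>"

definition truncated_integral ::
    "(complex set \<Rightarrow> l2 \<Rightarrow> l2) \<Rightarrow> (real \<Rightarrow> real \<Rightarrow> complex) \<Rightarrow> (complex \<Rightarrow> complex) \<Rightarrow> real \<Rightarrow> real \<Rightarrow> real \<Rightarrow> complex" where
  "truncated_integral E K \<phi> \<epsilon> s t =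
     cm_integral (restrict_space borel (omega \<epsilon>)) (\<lambda>\<sigma>. spectral_function E K \<sigma> s t) \<phi>"

end

(* With nu(s) the Carleman function, the truncated integral over |z| > eps is
     Phi_eps(s,t) = <F(v/conj z; |z| > eps) nu(t), nu(s)>,   F the bounded functional calculus of E,
   and both Phi_eps(s,.) and Phi_eps(.,t) converge in L_2 to the sections of a kernel of phi(N) = N v(N);
   what remains is uniform convergence. In a sector, c|z| <= Re(a z) for suitable a and c > 0, so
   Cauchy-Schwarz bounds |Phi_eps'(s,t) - Phi_eps(s,t)| by increments of the diagonal functions
   H_eps(s) = Re(a N_eps(s,s)), where N_eps is Phi_eps for v = 1. These increase as eps decreases, stay
   below H_0(s) = Re(a N(s,s)) by testing N against indicators of short intervals, and converge to
   H_0 pointwise by Mercer's argument, hence uniformly by Dini's theorem. *)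

theory Submission
  imports Defs
begin

section \<open>The Hilbert space\<close>

text \<open>The integrand collapses because each factor e(r;omega) carries 1/conj z: z v(z) *
  (1/conj z) * (1/z) = v(z)/conj z. This symbol is unbounded at 0 and nu(s) need not lie in its
  domain, so the calculus alone gives no value of the limit kernel at a point; L_2 convergence of
  rows and columns determines it only almost everywhere. That is the obstacle. The sector removes it
  by ruling out cancellation: 1/conj z is a positive multiple of z, so after multiplication by a the
  real part of the diagonal controls the integral of 1/|z| against the spectral measure of nu(s). A
  bound for this integral that is uniform in eps has to come from the continuity of N(s,t). A
  possible atom of E at 0, invisible to every truncation, does no harm because nu(s) is orthogonal
  to the null space of N. Pointwise convergence on the diagonal is obtained with one variable fixed,
  where smallness in s and mere boundedness in t suffice; only then does Dini's theorem make the
  smallness uniform in both variables.\<close>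

lemma square_integrable_rep: "square_integrable (rep_l2 x)"
  using Quotient3_rep_reflp[OF Quotient3_l2, of x] by (simp add: l2_rel_def)

lemma AE_rep_abs_l2:
  assumes "square_integrable f"
  shows "AE s in half_leb. rep_l2 (abs_l2 f) s = f s"
  using Quotient3_rep_abs[OF Quotient3_l2, of f] assms by (simp add: l2_rel_def)

lemma abs_rep_l2: "abs_l2 (rep_l2 x) = x"
  by (rule Quotient3_abs_rep[OF Quotient3_l2])

lemma abs_l2_eq_iff:
  assumes "square_integrable f" "square_integrable g"
  shows "abs_l2 f = abs_l2 g \<longleftrightarrow> (AE s in half_leb. f s = g s)"
  using Quotient3_rel[OF Quotient3_l2, of f g] assms by (auto simp: l2_rel_def)

lemma abs_l2_eqI:
  assumes "square_integrable f" "AE s in half_leb. f s = rep_l2 x s"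
  shows "abs_l2 f = x"
  using abs_l2_eq_iff[OF assms(1) square_integrable_rep, of x] assms(2)
  by (simp add: abs_rep_l2)

lemma cinner_rep: "cinner x y = (\<integral>s. rep_l2 x s * cnj (rep_l2 y s) \<partial>half_leb)"
  by (simp add: cinner_def)

lemma square_integrableD:
  "square_integrable f \<Longrightarrow> f \<in> borel_measurable half_leb"
  "square_integrable f \<Longrightarrow> integrable half_leb (\<lambda>s. (norm (f s))\<^sup>2)"
  by (auto simp: square_integrable_def)

lemmas rep_measurable [measurable] = square_integrableD(1)[OF square_integrable_rep]

lemma square_integrable_cong_AE:
  assumes "square_integrable f" "AE s in half_leb. f s = g s" "g \<in> borel_measurable half_leb"
  shows "square_integrable g"
  unfolding square_integrable_def
proof
  have "AE s in half_leb. (norm (f s))\<^sup>2 = (norm (g s))\<^sup>2"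
    using assms(2) by auto
  then show "integrable half_leb (\<lambda>s. (norm (g s))\<^sup>2)"
    using assms(1,3) integrable_cong_AE[of "\<lambda>s. (norm (f s))\<^sup>2" half_leb "\<lambda>s. (norm (g s))\<^sup>2"]
    by (auto simp: square_integrable_def)
qed (rule assms)

lemma borel_measurable_cnj [measurable]: "cnj \<in> borel_measurable borel"
  by (intro borel_measurable_continuous_onI continuous_intros)

lemma square_integrable_cnj: "square_integrable f \<Longrightarrow> square_integrable (\<lambda>s. cnj (f s))"
  by (auto simp: square_integrable_def)

lemma square_integrable_diff:
  assumes "square_integrable f" "square_integrable g"
  shows "square_integrable (\<lambda>s. f s - g s)"
  using square_integrable_add[OF assms(1) square_integrable_scale[OF assms(2), of "-1"]] by simp

lemma cinner_abs_l2_right: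
  assumes "square_integrable g"
  shows "cinner x (abs_l2 g) = (\<integral>s. rep_l2 x s * cnj (g s) \<partial>half_leb)"
  unfolding cinner_rep
proof (rule integral_cong_AE)
  show "AE s in half_leb. rep_l2 x s * cnj (rep_l2 (abs_l2 g) s) = rep_l2 x s * cnj (g s)"
    using AE_rep_abs_l2[OF assms] by auto
qed (use assms in \<open>auto simp: square_integrable_def\<close>)

lemma rep_scaleC: "AE s in half_leb. rep_l2 (c *\<^sub>C x) s = c * rep_l2 x s"
  using AE_rep_abs_l2[OF square_integrable_scale[OF square_integrable_rep]]
  by (simp add: scaleC_def)

lemma rep_add: "AE s in half_leb. rep_l2 (x + y) s = rep_l2 x s + rep_l2 y s"
  using AE_rep_abs_l2[OF square_integrable_add[OF square_integrable_rep square_integrable_rep]]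
  by (simp add: plus_l2_def)

lemma rep_diff: "AE s in half_leb. rep_l2 (x - y) s = rep_l2 x s - rep_l2 y s"
  using rep_add[of x "(-1) *\<^sub>C y"] rep_scaleC[of "-1" y]
  by eventually_elim (simp add: minus_l2_def uminus_l2_def)

lemma norm_l2_eq: "(norm x)\<^sup>2 = (\<integral>s. (norm (rep_l2 x s))\<^sup>2 \<partial>half_leb)"
proof -
  have "Re (cinner x x) = (\<integral>s. (norm (rep_l2 x s))\<^sup>2 \<partial>half_leb)"
    unfolding cinner_rep by (simp add: complex_norm_square[symmetric] del: of_real_power)
  then show ?thesis by (simp add: norm_l2_def)
qed

lemma cinner_add_left: "cinner (x + y) z = cinner x z + cinner y z"
  by transfer (auto simp: l2_rel_def distrib_right square_integrable_mult_cnj)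

lemma cinner_scaleC_left: "cinner (c *\<^sub>C x) z = c * cinner x z"
  by transfer (simp add: mult.assoc)

lemma cinner_commute: "cinner x y = cnj (cinner y x)"
  by transfer (simp add: Bochner_Integration.integral_cnj[symmetric] mult.commute
      del: Bochner_Integration.integral_cnj)

lemma cinner_add_right: "cinner x (y + z) = cinner x y + cinner x z"
  by (metis cinner_add_left cinner_commute complex_cnj_add)

lemma cinner_scaleC_right: "cinner x (c *\<^sub>C y) = cnj c * cinner x y"
  by (metis cinner_scaleC_left cinner_commute complex_cnj_mult)

lemma scaleR_scaleC_l2: "r *\<^sub>R (x::l2) = complex_of_real r *\<^sub>C x"
  by (rule scaleR_l2_def)

lemma Re_cinner: "Re (cinner x y) = x \<bullet> y"
  by (simp add: inner_l2_def)

lemma cinner_same: "cinner x x = complex_of_real ((norm x)\<^sup>2)"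
proof -
  have "Im (cinner x x) = 0"
    using cinner_commute[of x x] by (metis Im_complex_of_real Reals_cnj_iff complex_is_Real_iff)
  then show ?thesis by (simp add: complex_eq_iff Re_cinner power2_norm_eq_inner)
qed

lemma norm_scaleC: "norm (c *\<^sub>C (x::l2)) = norm c * norm x"
proof -
  have "complex_of_real ((norm (c *\<^sub>C x))\<^sup>2) = c * cnj c * cinner x x"
    by (simp only: cinner_same[symmetric] cinner_scaleC_left cinner_scaleC_right mult.assoc mult.left_commute)
  also have "\<dots> = complex_of_real ((norm c * norm x)\<^sup>2)"
    by (simp add: cinner_same complex_norm_square[symmetric] power_mult_distrib)
  finally show ?thesis
    by (simp only: of_real_eq_iff power2_eq_iff_nonneg norm_ge_zero mult_nonneg_nonneg)
qed

text \<open>Only the real part of \<open>cinner\<close> is the \<open>inner\<close> of the type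
  class. Multiplying x by the phase c, of modulus at most 1, makes the complex inner product real
  and nonnegative, so the real Cauchy-Schwarz inequality applies.\<close>

lemma norm_cinner_le: "norm (cinner x y) \<le> norm x * norm y"
proof -
  define c where "c = cnj (sgn (cinner x y))"
  have "cnj (sgn z) * z = complex_of_real (norm z)" for z :: complex
  proof (cases "z = 0")
    case False
    have "cnj (sgn z) * z = (z * cnj z) / complex_of_real (norm z)"
      by (simp add: sgn_eq)
    also have "\<dots> = complex_of_real ((norm z)\<^sup>2 / norm z)"
      by (simp only: complex_norm_square[symmetric] of_real_divide)
    also have "(norm z)\<^sup>2 / norm z = norm z"
      using False by (simp add: power2_eq_square)
    finally show ?thesis .
  qed simp
  then have "cinner (c *\<^sub>C x) y = complex_of_real (norm (cinner x y))"
    by (simp add: cinner_scaleC_left c_def)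
  then have "norm (cinner x y) = (c *\<^sub>C x) \<bullet> y"
    by (metis Re_cinner Re_complex_of_real)
  also have "\<dots> \<le> norm (c *\<^sub>C x) * norm y" by (rule norm_cauchy_schwarz)
  also have "\<dots> \<le> norm x * norm y"
    by (auto simp: norm_scaleC c_def norm_sgn)
  finally show ?thesis .
qed

lemma bounded_bilinear_cinner: "bounded_bilinear cinner"
proof (unfold_locales, goal_cases)
  case 5
  show ?case using norm_cinner_le by (metis mult.right_neutral)
qed (auto simp: cinner_add_left cinner_add_right scaleR_scaleC_l2 cinner_scaleC_left
      cinner_scaleC_right scaleR_conv_of_real)

interpretation cinner: bounded_bilinear cinner
  by (rule bounded_bilinear_cinner)

lemma bounded_linear_scaleC: "bounded_linear (\<lambda>x::l2. c *\<^sub>C x)"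
proof
  fix x y :: l2 and r :: real
  show "c *\<^sub>C (x + y) = c *\<^sub>C x + c *\<^sub>C y"
    by transfer (auto simp: l2_rel_def distrib_left
        intro!: square_integrable_add square_integrable_scale
        dest: square_integrable_scale square_integrable_add)
  show "c *\<^sub>C r *\<^sub>R x = r *\<^sub>R c *\<^sub>C x"
    unfolding scaleR_l2_def
    by transfer (auto simp: l2_rel_def mult.left_commute intro!: square_integrable_scale)
  show "\<exists>K. \<forall>x::l2. norm (c *\<^sub>C x) \<le> norm x * K"
    by (auto simp: norm_scaleC intro!: exI[of _ "norm c"])
qed

lemmas scaleC_add_right = linear_add[OF bounded_linear.linear[OF bounded_linear_scaleC]]

lemma scaleC_scaleC: "a *\<^sub>C b *\<^sub>C (x::l2) = (a * b) *\<^sub>C x"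
  by transfer (auto simp: l2_rel_def mult.assoc intro!: square_integrable_scale)

lemma scaleC_one: "1 *\<^sub>C (x::l2) = x"
  by transfer (auto simp: l2_rel_def)

lemma scaleC_minus_one: "(-1) *\<^sub>C (x::l2) = - x"
  by (simp add: uminus_l2_def)

lemma l2_eq_cinnerI: "(\<And>z. cinner x z = cinner y z) \<Longrightarrow> x = (y::l2)"
proof -
  assume "\<And>z. cinner x z = cinner y z"
  then have "cinner (x - y) (x - y) = 0" by (simp add: cinner.diff_left)
  then show ?thesis by (simp add: cinner_same)
qed

lemma integrable_rep_norm_diff:
  "integrable half_leb (\<lambda>s. (norm (rep_l2 x s - rep_l2 y s))\<^sup>2)"
  using square_integrable_diff[OF square_integrable_rep square_integrable_rep]
  by (simp add: square_integrable_def)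

lemma norm_diff_l2_eq:
  "(norm (x - y))\<^sup>2 = (\<integral>s. (norm (rep_l2 x s - rep_l2 y s))\<^sup>2 \<partial>half_leb)"
  unfolding norm_l2_eq
proof (rule integral_cong_AE)
  show "AE s in half_leb. (norm (rep_l2 (x - y) s))\<^sup>2 = (norm (rep_l2 x s - rep_l2 y s))\<^sup>2"
    using rep_diff[of x y] by auto
qed auto

lemma nn_integral_norm_diff_l2:
  "(\<integral>\<^sup>+s. ennreal ((norm (rep_l2 x s - rep_l2 y s))\<^sup>2) \<partial>half_leb) = ennreal ((norm (x - y))\<^sup>2)"
  unfolding norm_diff_l2_eq
  by (intro nn_integral_eq_integral integrable_rep_norm_diff) auto

section \<open>Completeness of L_2 (Riesz-Fischer)\<close>

text \<open>The weight 2^k is affordable: the squared increments integrate to at most 4^(-k), so the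
  weighted sum still has integral at most 2. Where it is finite, the increments are eventually at
  most 2^(-k/2), and the pointwise series telescopes.\<close>

lemma fast_Cauchy_AE_convergent:
  fixes Y :: "nat \<Rightarrow> l2"
  assumes "\<And>k. norm (Y (Suc k) - Y k) \<le> (1/2) ^ k"
  shows "AE s in half_leb. convergent (\<lambda>k. rep_l2 (Y k) s)"
proof -
  define d where "d k s = norm (rep_l2 (Y (Suc k)) s - rep_l2 (Y k) s)" for k s
  have [measurable]: "d k \<in> borel_measurable half_leb" for k
    unfolding d_def by measurable
  have "(\<integral>\<^sup>+s. (\<Sum>k. ennreal (2 ^ k * (d k s)\<^sup>2)) \<partial>half_leb) =
      (\<Sum>k. (\<integral>\<^sup>+s. ennreal (2 ^ k * (d k s)\<^sup>2) \<partial>half_leb))"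
    by (rule nn_integral_suminf) auto
  also have "\<dots> \<le> (\<Sum>k. ennreal ((1/2) ^ k))"
  proof (intro suminf_le summableI)
    fix k
    have "(\<integral>\<^sup>+s. ennreal (2 ^ k * (d k s)\<^sup>2) \<partial>half_leb) =
        ennreal (2 ^ k) * (\<integral>\<^sup>+s. ennreal ((d k s)\<^sup>2) \<partial>half_leb)"
      by (simp add: ennreal_mult nn_integral_cmult)
    also have "\<dots> = ennreal (2 ^ k * (norm (Y (Suc k) - Y k))\<^sup>2)"
      unfolding d_def nn_integral_norm_diff_l2 by (simp add: ennreal_mult)
    also have "\<dots> \<le> ennreal (2 ^ k * ((1/2) ^ k)\<^sup>2)"
      by (intro ennreal_leI mult_left_mono power_mono assms) auto
    also have "2 ^ k * ((1/2) ^ k)\<^sup>2 = ((1/2) ^ k :: real)"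
      by (simp add: power2_eq_square power_one_over)
    finally show "(\<integral>\<^sup>+s. ennreal (2 ^ k * (d k s)\<^sup>2) \<partial>half_leb) \<le> ennreal ((1/2) ^ k)" .
  qed
  also have "\<dots> = ennreal 2"
    by (subst suminf_ennreal_eq[where x=2]) (use power_half_series geometric_sums[of "1/2::real"] in auto)
  finally have "AE s in half_leb. (\<Sum>k. ennreal (2 ^ k * (d k s)\<^sup>2)) \<noteq> \<infinity>"
    by (intro nn_integral_PInf_AE) (auto simp: top_unique)
  then show ?thesis
  proof eventually_elim
    case (elim s)
    then have sm: "summable (\<lambda>k. 2 ^ k * (d k s)\<^sup>2)"
      by (intro summable_suminf_not_top) (auto simp: d_def)
    then have "(\<lambda>k. 2 ^ k * (d k s)\<^sup>2) \<longlonglongrightarrow> 0" by (rule summable_LIMSEQ_zero)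
    then have "\<forall>\<^sub>F k in sequentially. 2 ^ k * (d k s)\<^sup>2 < 1"
      by (rule order_tendstoD) auto
    then have "\<forall>\<^sub>F k in sequentially. norm (rep_l2 (Y (Suc k)) s - rep_l2 (Y k) s) \<le> (sqrt (1/2)) ^ k"
    proof eventually_elim
      case (elim k)
      then have "(d k s)\<^sup>2 \<le> (1/2) ^ k" by (simp add: power_one_over field_simps)
      then have "d k s \<le> sqrt ((1/2) ^ k)" by (rule real_le_rsqrt)
      then show ?case by (simp add: d_def real_sqrt_power)
    qed
    moreover have "summable (\<lambda>k. (sqrt (1/2)) ^ k)" 
      by (rule summable_geometric) (auto simp: real_sqrt_divide)
    ultimately have "summable (\<lambda>k. rep_l2 (Y (Suc k)) s - rep_l2 (Y k) s)"
      by (rule summable_comparison_test_ev)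
    then have "convergent (\<lambda>k. rep_l2 (Y k) s - rep_l2 (Y 0) s)"
      by (simp add: summable_iff_convergent sum_lessThan_telescope[where f="\<lambda>k. rep_l2 (Y k) s"])
    from convergent_add[OF this convergent_const[of "rep_l2 (Y 0) s"]]
    show ?case by simp
  qed
qed

text \<open>L_2 convergence gives an almost everywhere convergent subsequence, whose limit has to be
  the given pointwise one. This is how rows and columns of limit kernels are later recognised as
  vectors.\<close>

lemma l2_tendsto_AE:
  fixes X :: "nat \<Rightarrow> l2"
  assumes "X \<longlonglongrightarrow> x" "AE s in half_leb. (\<lambda>k. rep_l2 (X k) s) \<longlonglongrightarrow> f s"
  shows "AE s in half_leb. rep_l2 x s = f s"
proof -
  have *: "integrable half_leb (\<lambda>s. (norm (rep_l2 (X k) s - rep_l2 x s))\<^sup>2)" for k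
    by (rule integrable_rep_norm_diff)
  have "(\<lambda>k. (norm (X k - x))\<^sup>2) \<longlonglongrightarrow> 0\<^sup>2"
    using assms(1) by (intro tendsto_power) (simp add: tendsto_norm_zero_iff LIM_zero_iff)
  then have lim: "(\<lambda>k. \<integral>s. norm ((norm (rep_l2 (X k) s - rep_l2 x s))\<^sup>2) \<partial>half_leb) \<longlonglongrightarrow> 0"
    by (simp add: norm_diff_l2_eq)
  obtain r where r: "strict_mono r"
    "AE s in half_leb. (\<lambda>k. (norm (rep_l2 (X (r k)) s - rep_l2 x s))\<^sup>2) \<longlonglongrightarrow> 0"
    using tendsto_L1_AE_subseq[OF * lim] by auto
  from r(2) assms(2) show ?thesis
  proof eventually_elim
    case (elim s)
    have "(\<lambda>k. (norm (rep_l2 (X (r k)) s - rep_l2 x s))\<^sup>2) \<longlonglongrightarrow> (norm (f s - rep_l2 x s))\<^sup>2"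
      using LIMSEQ_subseq_LIMSEQ[OF elim(2) r(1)]
      by (intro tendsto_intros) (simp add: o_def)
    with elim(1) have "(norm (f s - rep_l2 x s))\<^sup>2 = 0" using LIMSEQ_unique by blast
    then show ?case by simp
  qed
qed

text \<open>Fatou's lemma in m, with k fixed, turns Cauchy estimates into estimates against the
  pointwise limit \<open>f\<close>. Applied once it shows that \<open>f\<close> is square
  integrable, applied again it gives convergence in norm.\<close>

lemma fast_Cauchy_l2_convergent:
  fixes Y :: "nat \<Rightarrow> l2"
  assumes fast: "\<And>k. norm (Y (Suc k) - Y k) \<le> (1/2) ^ k" and "Cauchy Y"
  shows "convergent Y"
proof -
  define f where "f s = lim (\<lambda>k. rep_l2 (Y k) s)" for s
  have lim: "AE s in half_leb. (\<lambda>k. rep_l2 (Y k) s) \<longlonglongrightarrow> f s"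
    using fast_Cauchy_AE_convergent[OF fast] by eventually_elim (simp add: f_def convergent_LIMSEQ_iff)
  have [measurable]: "f \<in> borel_measurable half_leb"
    unfolding f_def by measurable
  have bound: "(\<integral>\<^sup>+s. ennreal ((norm (rep_l2 (Y k) s - f s))\<^sup>2) \<partial>half_leb) \<le> ennreal (e\<^sup>2)"
    if e: "e > 0" and k: "\<And>m. m \<ge> k \<Longrightarrow> norm (Y k - Y m) \<le> e" for k e
  proof -
    have "(\<integral>\<^sup>+s. ennreal ((norm (rep_l2 (Y k) s - f s))\<^sup>2) \<partial>half_leb) =
      (\<integral>\<^sup>+s. liminf (\<lambda>m. ennreal ((norm (rep_l2 (Y k) s - rep_l2 (Y m) s))\<^sup>2)) \<partial>half_leb)"
    proof (rule nn_integral_cong_AE)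
      show "AE s in half_leb. ennreal ((norm (rep_l2 (Y k) s - f s))\<^sup>2) =
         liminf (\<lambda>m. ennreal ((norm (rep_l2 (Y k) s - rep_l2 (Y m) s))\<^sup>2))"
        using lim
      proof eventually_elim
        case (elim s)
        have "(\<lambda>m. ennreal ((norm (rep_l2 (Y k) s - rep_l2 (Y m) s))\<^sup>2)) \<longlonglongrightarrow>
            ennreal ((norm (rep_l2 (Y k) s - f s))\<^sup>2)"
          by (intro tendsto_ennrealI tendsto_intros elim)
        then show ?case by (intro lim_imp_Liminf[symmetric]) auto
      qed
    qed
    also have "\<dots> \<le> liminf (\<lambda>m. \<integral>\<^sup>+s. ennreal ((norm (rep_l2 (Y k) s - rep_l2 (Y m) s))\<^sup>2) \<partial>half_leb)"
      by (rule nn_integral_liminf) auto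
    also have "\<dots> \<le> ennreal (e\<^sup>2)"
      unfolding nn_integral_norm_diff_l2
    proof (rule Liminf_le)
      show "\<forall>\<^sub>F m in sequentially. ennreal ((norm (Y k - Y m))\<^sup>2) \<le> ennreal (e\<^sup>2)"
        using eventually_ge_at_top[of k]
        by eventually_elim (intro ennreal_leI power_mono k, auto)
    qed simp
    finally show ?thesis .
  qed
  have cauchy: "\<exists>K. \<forall>k\<ge>K. \<forall>m\<ge>k. norm (Y k - Y m) \<le> e" if "e > 0" for e
    using CauchyD[OF \<open>Cauchy Y\<close> that] by (meson less_imp_le order_trans)
  obtain K where "\<forall>k\<ge>K. \<forall>m\<ge>k. norm (Y k - Y m) \<le> 1" using cauchy[of 1] by auto
  then have "(\<integral>\<^sup>+s. ennreal ((norm (rep_l2 (Y K) s - f s))\<^sup>2) \<partial>half_leb) \<le> ennreal (1\<^sup>2)"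
    by (intro bound) auto
  then have "square_integrable (\<lambda>s. rep_l2 (Y K) s - f s)"
    unfolding square_integrable_def
    by (auto intro!: integrableI_bounded elim!: le_less_trans)
  from square_integrable_diff[OF square_integrable_rep[of "Y K"] this]
  have f: "square_integrable f" by simp
  have "Y \<longlonglongrightarrow> abs_l2 f"
  proof (rule LIMSEQ_I)
    fix r :: real assume "r > 0"
    then obtain K where K: "\<forall>k\<ge>K. \<forall>m\<ge>k. norm (Y k - Y m) \<le> r / 2" using cauchy[of "r/2"] by auto
    show "\<exists>K. \<forall>k\<ge>K. norm (Y k - abs_l2 f) < r"
    proof (intro exI allI impI)
      fix k assume "k \<ge> K"
      have "ennreal ((norm (Y k - abs_l2 f))\<^sup>2) =
          (\<integral>\<^sup>+s. ennreal ((norm (rep_l2 (Y k) s - f s))\<^sup>2) \<partial>half_leb)"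
        unfolding nn_integral_norm_diff_l2[symmetric]
        by (intro nn_integral_cong_AE) (use AE_rep_abs_l2[OF f] in auto)
      also have "\<dots> \<le> ennreal ((r/2)\<^sup>2)"
        using \<open>r > 0\<close> K \<open>k \<ge> K\<close> by (intro bound) auto
      finally have "(norm (Y k - abs_l2 f))\<^sup>2 \<le> (r/2)\<^sup>2" by simp
      then have "norm (Y k - abs_l2 f) \<le> r / 2" 
        by (rule power2_le_imp_le) (use \<open>r > 0\<close> in simp)
      then show "norm (Y k - abs_l2 f) < r" using \<open>r > 0\<close> by simp
    qed
  qed
  then show ?thesis by (rule convergentI)
qed

text \<open>Completeness later sums a series of projections when the functional calculus is built,
  and it provides the vector-valued integral of \<open>nu\<close> over an interval.\<close>

instance l2 :: banach
proof
  fix X :: "nat \<Rightarrow> l2" assume X: "Cauchy X"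
  have "\<exists>r :: nat \<Rightarrow> nat. \<forall>k. (\<forall>m\<ge>r k. \<forall>n\<ge>r k. norm (X m - X n) \<le> (1/2) ^ k) \<and> r k < r (Suc k)"
  proof (rule dependent_nat_choice)
    show "\<exists>x. \<forall>m\<ge>x. \<forall>n\<ge>x. norm (X m - X n) \<le> (1/2) ^ 0"
      using CauchyD[OF X, of 1] by (auto intro: less_imp_le)
    fix x k :: nat
    obtain M where "\<forall>m\<ge>M. \<forall>n\<ge>M. norm (X m - X n) < (1/2) ^ Suc k"
      using CauchyD[OF X, of "(1/2) ^ Suc k"] by auto
    then show "\<exists>y. (\<forall>m\<ge>y. \<forall>n\<ge>y. norm (X m - X n) \<le> (1/2) ^ Suc k) \<and> x < y"
      by (intro exI[of _ "max M (Suc x)"]) (auto intro: less_imp_le)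
  qed
  then obtain r :: "nat \<Rightarrow> nat" where
    r0: "\<forall>k. (\<forall>m\<ge>r k. \<forall>n\<ge>r k. norm (X m - X n) \<le> (1/2) ^ k) \<and> r k < r (Suc k)" ..
  have r: "norm (X m - X n) \<le> (1/2) ^ k" if "m \<ge> r k" "n \<ge> r k" for k m n
    using spec[OF r0, of k] that by simp
  have r2: "r k < r (Suc k)" for k using r0 by simp
  have mono: "strict_mono r" using r2 by (simp add: strict_mono_Suc_iff)
  have "convergent (X \<circ> r)"
  proof (rule fast_Cauchy_l2_convergent)
    show "norm ((X \<circ> r) (Suc k) - (X \<circ> r) k) \<le> (1/2) ^ k" for k
      using r[of k "r (Suc k)" "r k"] r2[of k] by auto
    show "Cauchy (X \<circ> r)" using X mono by (rule Cauchy_subseq_Cauchy)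
  qed
  then obtain x where "(X \<circ> r) \<longlonglongrightarrow> x" by (auto simp: convergent_def)
  from Cauchy_converges_subseq[OF X mono this] show "convergent X" by (rule convergentI)
qed

section \<open>Auxiliary analysis\<close>

text \<open>The set where f and g agree is closed and has full measure in the open half-line, hence
  contains it; the endpoint 0 follows by closure. Pointwise statements about kernels are recovered
  from almost everywhere ones in this way.\<close>

lemma continuous_AE_half_line_eqD:
  fixes f g :: "real \<Rightarrow> 'b::real_normed_vector"
  assumes "continuous_on half_line f" "continuous_on half_line g"
    "AE x in half_leb. f x = g x" "x \<ge> 0"
  shows "f x = g x"
proof -
  define C where "C = {x\<in>{0..}. f x - g x = 0}"
  have C: "closed C"
    unfolding C_def
    using continuous_closed_preimage_constant[of "{0..}" "\<lambda>x. f x - g x" 0] assms(1,2)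
    by (auto intro: continuous_on_diff)
  have "AE x in lebesgue. x \<in> {0..} \<longrightarrow> f x = g x"
    using assms(3) by (subst (asm) AE_restrict_space_iff) auto
  then have "AE x \<in> {0<..} in lebesgue. x \<in> C"
  proof eventually_elim
    case (elim x)
    then show ?case by (simp add: C_def)
  qed
  then have "{0<..} \<subseteq> C"
    using mem_closed_if_AE_lebesgue_open[OF open_greaterThan C] by blast
  then have "closure {0<..} \<subseteq> C" using C by (rule closure_minimal)
  then show ?thesis using assms(4) by (auto simp: C_def)
qed

text \<open>Vanishing at infinity is asked of \<open>D 0\<close> alone, since every later
  \<open>D n\<close> lies below it. A failure would give bad points \<open>s n\<close> trapped in
  one compact set; at a cluster point l each fixed \<open>D m\<close> would stay at least \<eta>,
  although D m l tends to 0.\<close>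

lemma Dini_half_line:
  fixes D :: "nat \<Rightarrow> real \<Rightarrow> real"
  assumes cont: "\<And>n. continuous_on half_line (D n)"
    and van: "\<And>\<epsilon>. \<epsilon> > 0 \<Longrightarrow> \<exists>C. compact C \<and> C \<subseteq> half_line \<and> (\<forall>x\<in>half_line - C. D 0 x < \<epsilon>)"
    and dec: "\<And>m n s. m \<le> n \<Longrightarrow> s \<ge> 0 \<Longrightarrow> D n s \<le> D m s"
    and lim: "\<And>s. s \<ge> 0 \<Longrightarrow> (\<lambda>n. D n s) \<longlonglongrightarrow> 0"
    and "\<eta> > 0"
  shows "\<exists>m. \<forall>n\<ge>m. \<forall>s\<ge>0. D n s < \<eta>"
proof (rule ccontr)
  assume "\<nexists>m. \<forall>n\<ge>m. \<forall>s\<ge>0. D n s < \<eta>"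
  then have "\<exists>s\<ge>0. D n s \<ge> \<eta>" for n
    using dec by (metis linorder_not_less order_trans)
  then obtain s where s: "\<And>n. s n \<ge> 0" "\<And>n. D n (s n) \<ge> \<eta>" by metis
  obtain C where C: "compact C" "C \<subseteq> half_line" "\<And>x. x \<in> half_line - C \<Longrightarrow> D 0 x < \<eta>"
    using van[OF \<open>\<eta> > 0\<close>] by auto
  have "s n \<in> C" for n
    using C(3)[of "s n"] s[of n] dec[of 0 n "s n"] by force
  then obtain l r where l: "l \<in> C" "strict_mono r" "(s \<circ> r) \<longlonglongrightarrow> l"
    using C(1) unfolding compact_def by blast
  have "D m l \<ge> \<eta>" for m
  proof (rule tendsto_lowerbound)
    show "(\<lambda>n. D m ((s \<circ> r) n)) \<longlonglongrightarrow> D m l"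
      using continuous_on_tendsto_compose[OF cont[of m] l(3)] l(1) C(2) s(1) by auto
    show "\<forall>\<^sub>F n in sequentially. \<eta> \<le> D m ((s \<circ> r) n)"
      using eventually_ge_at_top[of m]
    proof eventually_elim
      case (elim n)
      then have "m \<le> r n" using seq_suble[OF l(2), of n] by simp
      then show ?case using dec[of m "r n" "s (r n)"] s[of "r n"] by simp
    qed
  qed simp
  moreover have "\<forall>\<^sub>F m in sequentially. D m l < \<eta>"
    using order_tendstoD(2)[OF lim \<open>\<eta> > 0\<close>, of l] l(1) C(2) by auto
  ultimately have "\<forall>\<^sub>F m in sequentially. False"
    by (auto simp: not_less[symmetric])
  then show False by simp
qed

subsection \<open>Bounded Borel functions\<close>

definition bounded_borel :: "(complex \<Rightarrow> complex) \<Rightarrow> bool" where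
  "bounded_borel f \<longleftrightarrow> f \<in> borel_measurable borel \<and> bounded (range f)"

lemma bounded_borelI:
  "f \<in> borel_measurable borel \<Longrightarrow> (\<And>z. norm (f z) \<le> K) \<Longrightarrow> bounded_borel f"
  unfolding bounded_borel_def by (auto simp: bounded_iff)

lemma bounded_borelE:
  assumes "bounded_borel f"
  obtains K where "f \<in> borel_measurable borel" "\<And>z. norm (f z) \<le> K" "K \<ge> 0"
proof -
  obtain K where K: "\<And>z. norm (f z) \<le> K"
    using assms unfolding bounded_borel_def bounded_iff by auto
  then have "K \<ge> 0" using norm_ge_zero order_trans by blast
  with K assms that show ?thesis by (auto simp: bounded_borel_def)
qed

lemma bounded_borel_measurable: "bounded_borel f \<Longrightarrow> f \<in> borel_measurable borel"
  by (simp add: bounded_borel_def)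

lemma bounded_borel_const: "bounded_borel (\<lambda>z. c)"
  by (rule bounded_borelI[of _ "norm c"]) auto

lemma bounded_borel_indicator: "A \<in> sets borel \<Longrightarrow> bounded_borel (\<lambda>z. indicator A z)"
  by (rule bounded_borelI[of _ 1]) (auto simp: indicator_def)

lemma bounded_borel_add:
  assumes "bounded_borel f" "bounded_borel g"
  shows "bounded_borel (\<lambda>z. f z + g z)"
  using assms unfolding bounded_borel_def by (auto intro: bounded_plus_comp)

lemma bounded_borel_mult:
  assumes "bounded_borel f" "bounded_borel g"
  shows "bounded_borel (\<lambda>z. f z * g z)"
proof -
  obtain K where K: "f \<in> borel_measurable borel" "\<And>z. norm (f z) \<le> K" "K \<ge> 0"
    using assms(1) by (rule bounded_borelE) (rule that)
  obtain L where L: "g \<in> borel_measurable borel" "\<And>z. norm (g z) \<le> L" "L \<ge> 0"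
    using assms(2) by (rule bounded_borelE) (rule that)
  show ?thesis
    using K L by (intro bounded_borelI[of _ "K * L"]) (auto simp: norm_mult intro!: mult_mono)
qed

lemma bounded_borel_cmult: "bounded_borel f \<Longrightarrow> bounded_borel (\<lambda>z. c * f z)"
  by (intro bounded_borel_mult bounded_borel_const)

lemma bounded_borel_cnj: "bounded_borel f \<Longrightarrow> bounded_borel (\<lambda>z. cnj (f z))"
  by (auto elim!: bounded_borelE intro!: bounded_borelI)

lemma bounded_borel_diff: "bounded_borel f \<Longrightarrow> bounded_borel g \<Longrightarrow> bounded_borel (\<lambda>z. f z - g z)"
  using bounded_borel_add[of f "\<lambda>z. (-1) * g z"] bounded_borel_cmult[of g "-1"] by simp

lemmas bounded_borel_intros =
  bounded_borel_const bounded_borel_indicator bounded_borel_add bounded_borel_mult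
  bounded_borel_cnj bounded_borel_diff

text \<open>Identities for the calculus are transferred by this rule from projections to all bounded
  Borel symbols. The bound K in the case \<open>lim\<close> is uniform in i, so that constants serve
  as integrable majorants for the finite spectral measures.\<close>

lemma bounded_borel_induct [consumes 1, case_names base add lim]:
  fixes f :: "complex \<Rightarrow> complex"
  assumes "bounded_borel f"
    and base: "\<And>c A. A \<in> sets borel \<Longrightarrow> P (\<lambda>z. c * indicator A z)"
    and add: "\<And>f g. bounded_borel f \<Longrightarrow> P f \<Longrightarrow> bounded_borel g \<Longrightarrow> P g \<Longrightarrow> P (\<lambda>z. f z + g z)"
    and lim: "\<And>f u K. (\<And>i. u i \<in> borel_measurable borel) \<Longrightarrow> (\<And>i z. norm (u i z) \<le> K) \<Longrightarrow>
      (\<And>i. P (u i)) \<Longrightarrow> (\<And>z. (\<lambda>i. u i z) \<longlonglongrightarrow> f z) \<Longrightarrow>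
      bounded_borel f \<Longrightarrow> P f"
  shows "P f"
proof -
  obtain K where f: "f \<in> borel_measurable borel" and K: "\<And>z. norm (f z) \<le> K" "K \<ge> 0"
    using assms(1) by (rule bounded_borelE) (rule that)
  obtain u where u: "\<And>i. simple_function borel (u i)" "\<And>z. (\<lambda>i. u i z) \<longlonglongrightarrow> f z"
    "\<And>i z. dist (u i z) 0 \<le> 2 * dist (f z) 0"
    using borel_measurable_implies_sequence_metric[OF f, of 0] by auto
  have simple: "P g" if g: "simple_function borel g" for g :: "complex \<Rightarrow> complex"
  proof -
    have meas: "g -` {c} \<in> sets borel" for c
      using simple_functionD(2)[OF g, of "{c}"] by simp
    have "finite C \<Longrightarrow> P (\<lambda>z. \<Sum>c\<in>C. c * indicator (g -` {c}) z) \<and>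
        bounded_borel (\<lambda>z. \<Sum>c\<in>C. c * indicator (g -` {c}) z)" for C
    proof (induction rule: finite_induct)
      case empty
      show ?case using base[of "{}" 0] by (simp add: bounded_borel_const)
    next
      case (insert c C)
      have eq: "(\<lambda>z. \<Sum>c\<in>insert c C. c * indicator (g -` {c}) z) =
          (\<lambda>z. c * indicator (g -` {c}) z + (\<Sum>c\<in>C. c * indicator (g -` {c}) z))"
        by (rule ext) (rule sum.insert[OF insert.hyps])
      have "bounded_borel (\<lambda>z. c * indicator (g -` {c}) z)"
        by (intro bounded_borel_mult bounded_borel_const bounded_borel_indicator meas)
      then show ?case
        unfolding eq using insert.IH by (intro conjI add base meas bounded_borel_add) auto
    qed
    moreover have "finite (range g)" using simple_functionD(1)[OF g] by simp
    moreover have "g = (\<lambda>z. \<Sum>c\<in>range g. c * indicator (g -` {c}) z)"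
    proof
      fix z
      have "(\<Sum>c\<in>range g. c * indicator (g -` {c}) z) = (\<Sum>c\<in>range g. if c = g z then c else 0)"
        by (intro sum.cong) (auto simp: indicator_def)
      also have "\<dots> = g z" using \<open>finite (range g)\<close> by (subst sum.delta) auto
      finally show "g z = (\<Sum>c\<in>range g. c * indicator (g -` {c}) z)" ..
    qed
    ultimately show ?thesis by metis
  qed
  show ?thesis
  \<comment> \<open>The approximating simple functions satisfy |u i z| \<le> 2 |f z|, whence the
    constant 2 K.\<close>
  proof (rule lim[of u "2 * K"])
    show "u i \<in> borel_measurable borel" for i using borel_measurable_simple_function[OF u(1)] .
    show "norm (u i z) \<le> 2 * K" for i z using u(3)[of i z] K(1)[of z] by simp
  qed (use u simple assms in auto)
qed

section \<open>Integration against differences of finite measures\<close>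

text \<open>Each summand lies below M as a measure, so integrability passes to it. The equality is
  then an induction over integrable functions, with 2 |f| dominating all three limits.\<close>

lemma integral_add_measure:
  fixes f :: "'a \<Rightarrow> 'b::{banach, second_countable_topology}"
  assumes sets: "sets M1 = sets M" "sets M2 = sets M"
    and eq: "\<And>A. A \<in> sets M \<Longrightarrow> emeasure M A = emeasure M1 A + emeasure M2 A"
    and "integrable M f"
  shows "integrable M1 f \<and> integrable M2 f \<and> integral\<^sup>L M f = integral\<^sup>L M1 f + integral\<^sup>L M2 f"
proof -
  have "emeasure M1 A \<le> emeasure M A \<and> emeasure M2 A \<le> emeasure M A" for A
    by (cases "A \<in> sets M") (auto simp: sets emeasure_notin_sets eq)
  then have le: "M1 \<le> M" "M2 \<le> M"
    using sets by (auto simp: le_measure le_fun_def)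
  have int: "integrable M1 g \<and> integrable M2 g" if "integrable M g" for g :: "'a \<Rightarrow> 'b"
    using that nn_integral_mono_measure[OF _ le(1), of "\<lambda>x. ennreal (norm (g x))"]
      nn_integral_mono_measure[OF _ le(2), of "\<lambda>x. ennreal (norm (g x))"]
    by (auto simp: integrable_iff_bounded measurable_cong_sets[OF sets(1) refl]
        measurable_cong_sets[OF sets(2) refl] sets)
  have "integral\<^sup>L M f = integral\<^sup>L M1 f + integral\<^sup>L M2 f"
    using \<open>integrable M f\<close>
  proof (induction rule: integrable_induct)
    case (base A c)
    have "emeasure M1 A < \<infinity>" "emeasure M2 A < \<infinity>"
      using base eq[of A] by (auto simp: less_top[symmetric])
    then show ?case
      using base eq[of A] sets
      by (simp add: measure_def enn2real_plus less_top scaleR_add_left)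
  next
    case (add f g)
    then show ?case using int[of f] int[of g] by simp
  next
    case (lim f s)
    have m1: "f \<in> borel_measurable M1" "f \<in> borel_measurable M2"
      "s i \<in> borel_measurable M1" "s i \<in> borel_measurable M2" for i
      using int[OF lim.hyps(1)[of i]] int[OF lim.hyps(4)] by (simp_all add: borel_measurable_integrable)
    have sp: "space M1 = space M" "space M2 = space M" using sets by (auto dest: sets_eq_imp_space_eq)
    have "(\<lambda>i. integral\<^sup>L M (s i)) \<longlonglongrightarrow> integral\<^sup>L M f"
      by (rule integral_dominated_convergence[where w="\<lambda>x. 2 * norm (f x)"]) (use lim in auto)
    moreover have "(\<lambda>i. integral\<^sup>L M1 (s i)) \<longlonglongrightarrow> integral\<^sup>L M1 f"
      by (rule integral_dominated_convergence[where w="\<lambda>x. 2 * norm (f x)"])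
        (use lim int[OF lim.hyps(4)] m1 sp in auto)
    moreover have "(\<lambda>i. integral\<^sup>L M2 (s i)) \<longlonglongrightarrow> integral\<^sup>L M2 f"
      by (rule integral_dominated_convergence[where w="\<lambda>x. 2 * norm (f x)"])
        (use lim int[OF lim.hyps(4)] m1 sp in auto)
    ultimately have "(\<lambda>i. integral\<^sup>L M (s i)) \<longlonglongrightarrow> integral\<^sup>L M1 f + integral\<^sup>L M2 f"
      unfolding lim.IH by (auto intro: tendsto_add)
    with \<open>(\<lambda>i. integral\<^sup>L M (s i)) \<longlonglongrightarrow> integral\<^sup>L M f\<close> show ?case using LIMSEQ_unique by blast
  qed
  with int[OF \<open>integrable M f\<close>] show ?thesis by simp
qed

text \<open>Y is a Hahn set for P - Q, so the supremum defining the positive variation of A is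
  attained at A \<inter> Y. The explicit value is also what shows the set function to be countably
  additive, without which \<open>measure_of\<close> would yield the zero measure.\<close>

lemma emeasure_pos_variation:
  assumes "finite_measure P" "finite_measure Q" and sets: "sets P = sets M" "sets Q = sets M"
    and \<mu>: "\<And>A. A \<in> sets M \<Longrightarrow> \<mu> A = measure P A - measure Q A"
    and Y: "Y \<in> sets M" "\<And>X. X \<in> sets M \<Longrightarrow> X \<subseteq> Y \<Longrightarrow> Q X \<le> P X"
      "\<And>X. X \<in> sets M \<Longrightarrow> X \<inter> Y = {} \<Longrightarrow> P X \<le> Q X"
    and A: "A \<in> sets M"
  shows "emeasure (pos_variation M \<mu>) A = ennreal (measure P (A \<inter> Y) - measure Q (A \<inter> Y))"
proof -
  interpret P: finite_measure P by fact
  interpret Q: finite_measure Q by fact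
  have le1: "measure Q X \<le> measure P X" if "X \<in> sets M" "X \<subseteq> Y" for X
    using Y(2)[OF that] by (simp add: P.emeasure_eq_measure Q.emeasure_eq_measure)
  have le2: "measure P X \<le> measure Q X" if "X \<in> sets M" "X \<inter> Y = {}" for X
    using Y(3)[OF that] by (simp add: P.emeasure_eq_measure Q.emeasure_eq_measure)
  have SUP: "(SUP B\<in>{B \<in> sets M. B \<subseteq> A}. ennreal (\<mu> B)) = ennreal (measure P (A \<inter> Y) - measure Q (A \<inter> Y))"
    if A: "A \<in> sets M" for A
  proof (rule antisym)
    show "(SUP B\<in>{B \<in> sets M. B \<subseteq> A}. ennreal (\<mu> B)) \<le> ennreal (measure P (A \<inter> Y) - measure Q (A \<inter> Y))"
    proof (rule SUP_least)
      fix B assume "B \<in> {B \<in> sets M. B \<subseteq> A}"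
      then have B: "B \<in> sets M" "B \<subseteq> A" by auto
      have s: "B \<inter> Y \<in> sets M" "B - Y \<in> sets M" "A \<inter> Y - B \<in> sets M" using A B Y by auto
      have "\<mu> B = (measure P (B \<inter> Y) + measure P (B - Y)) - (measure Q (B \<inter> Y) + measure Q (B - Y))"
        using B Y s \<mu>[of B] P.finite_measure_Union[of "B \<inter> Y" "B - Y"] Q.finite_measure_Union[of "B \<inter> Y" "B - Y"]
        by (simp add: sets Int_Diff_disjoint Int_Diff_Un)
      \<comment> \<open>Passing from B to A \<inter> Y drops B - Y, where P \<le> Q, and adds A
        \<inter> Y - B, where Q \<le> P.\<close>
      also have "\<dots> \<le> measure P (B \<inter> Y) - measure Q (B \<inter> Y) + (measure P (A \<inter> Y - B) - measure Q (A \<inter> Y - B))"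
        using le1[OF s(3)] le2[OF s(2)] by fastforce
      also have "\<dots> = measure P (A \<inter> Y) - measure Q (A \<inter> Y)"
      proof -
        have "(B \<inter> Y) \<union> (A \<inter> Y - B) = A \<inter> Y" "(B \<inter> Y) \<inter> (A \<inter> Y - B) = {}" using B by auto
        then show ?thesis
          using P.finite_measure_Union[of "B \<inter> Y" "A \<inter> Y - B"] Q.finite_measure_Union[of "B \<inter> Y" "A \<inter> Y - B"] s
          by (simp add: sets)
      qed
      finally show "ennreal (\<mu> B) \<le> ennreal (measure P (A \<inter> Y) - measure Q (A \<inter> Y))" by (rule ennreal_leI)
    qed
    show "ennreal (measure P (A \<inter> Y) - measure Q (A \<inter> Y)) \<le> (SUP B\<in>{B \<in> sets M. B \<subseteq> A}. ennreal (\<mu> B))"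
      using A Y(1) by (intro SUP_upper2[of "A \<inter> Y"]) (auto simp: \<mu>)
  qed
  show ?thesis
    unfolding SUP[OF A, symmetric]
  proof (rule emeasure_measure_of[OF pos_variation_def])
    show "sets M \<subseteq> Pow (space M)" by (rule sets.space_closed)
    show "A \<in> sets (pos_variation M \<mu>)" using A by (simp add: pos_variation_def)
    have "positive (sets M) (\<lambda>A. SUP B\<in>{B \<in> sets M. B \<subseteq> A}. ennreal (\<mu> B))"
      unfolding positive_def by (subst SUP) auto
    moreover have "countably_additive (sets M) (\<lambda>A. SUP B\<in>{B \<in> sets M. B \<subseteq> A}. ennreal (\<mu> B))"
      unfolding countably_additive_def
    proof (intro allI impI)
      fix X :: "nat \<Rightarrow> 'a set" assume X: "range X \<subseteq> sets M" "disjoint_family X" "(\<Union>i. X i) \<in> sets M"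
      have d: "disjoint_family (\<lambda>i. X i \<inter> Y)" "range (\<lambda>i. X i \<inter> Y) \<subseteq> sets M"
        using X Y by (auto simp: disjoint_family_on_def)
      have "(\<lambda>i. measure P (X i \<inter> Y) - measure Q (X i \<inter> Y)) sums
          (measure P (\<Union>i. X i \<inter> Y) - measure Q (\<Union>i. X i \<inter> Y))"
        using d by (intro sums_diff P.finite_measure_UNION Q.finite_measure_UNION) (auto simp: sets)
      then have "(\<Sum>i. ennreal (measure P (X i \<inter> Y) - measure Q (X i \<inter> Y))) =
          ennreal (measure P (\<Union>i. X i \<inter> Y) - measure Q (\<Union>i. X i \<inter> Y))"
        using d(2) by (intro suminf_ennreal_eq) (auto intro!: le1)
      then show "(\<Sum>i. SUP B\<in>{B \<in> sets M. B \<subseteq> X i}. ennreal (\<mu> B)) =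
          (SUP B\<in>{B \<in> sets M. B \<subseteq> (\<Union>i. X i)}. ennreal (\<mu> B))"
        using X by (simp add: SUP range_subsetD)
    qed
    ultimately show "positive (sets (pos_variation M \<mu>)) (\<lambda>A. SUP B\<in>{B \<in> sets M. B \<subseteq> A}. ennreal (\<mu> B))"
      "countably_additive (sets (pos_variation M \<mu>)) (\<lambda>A. SUP B\<in>{B \<in> sets M. B \<subseteq> A}. ennreal (\<mu> B))"
      by (simp_all add: pos_variation_def)
  qed
qed

lemma sets_pos_variation [simp]: "sets (pos_variation M \<mu>) = sets M"
  by (simp add: pos_variation_def)

text \<open>P and Q need not be mutually singular, so they are in general not the Jordan parts of
  \<mu>. On the Hahn set Y, P is the positive part plus Q; on its complement, Q is the negative part
  plus P; the common parts cancel in the difference of integrals. The case in view is that of the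
  polarization measures, which overlap.\<close>

lemma pos_variation_integral:
  fixes f :: "'a \<Rightarrow> 'b::{banach, second_countable_topology}"
  assumes fin: "finite_measure P" "finite_measure Q" and sets: "sets P = sets M" "sets Q = sets M"
    and \<mu>: "\<And>A. A \<in> sets M \<Longrightarrow> \<mu> A = measure P A - measure Q A"
    and int: "integrable P f" "integrable Q f"
  shows "integrable (pos_variation M \<mu>) f"
    and "integrable (pos_variation M (\<lambda>A. - \<mu> A)) f"
    and "integral\<^sup>L (pos_variation M \<mu>) f - integral\<^sup>L (pos_variation M (\<lambda>A. - \<mu> A)) f =
      integral\<^sup>L P f - integral\<^sup>L Q f"
proof -
  interpret P: finite_measure P by fact
  interpret Q: finite_measure Q by fact
  have sp: "space P = space M" "space Q = space M" using sets by (auto dest: sets_eq_imp_space_eq)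
  obtain Y where Y: "Y \<in> sets M" "\<And>X. X \<in> sets M \<Longrightarrow> X \<subseteq> Y \<Longrightarrow> Q X \<le> P X"
      "\<And>X. X \<in> sets M \<Longrightarrow> X \<inter> Y = {} \<Longrightarrow> P X \<le> Q X"
    using finite_unsigned_Hahn_decomposition[OF fin] sets by auto
  define Z where "Z = space M - Y"
  have Z: "Z \<in> sets M" using Y by (simp add: Z_def)
  define R where "R M' A = density M' (indicator A)" for M' :: "'a measure" and A
  have R: "emeasure (R M' A) B = emeasure M' (A \<inter> B)" "sets (R M' A) = sets M"
    if "sets M' = sets M" "A \<in> sets M" "B \<in> sets M" for M' A B
    using that by (auto simp: R_def emeasure_restricted)
  have Rs: "sets (R M' A) = sets M" if "sets M' = sets M" for M' A
    using that by (simp add: R_def)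
  have split: "integrable (R M' Y) f \<and> integrable (R M' Z) f \<and>
      integral\<^sup>L M' f = integral\<^sup>L (R M' Y) f + integral\<^sup>L (R M' Z) f"
    if "sets M' = sets M" "integrable M' f" for M'
  proof (rule integral_add_measure)
    fix A assume "A \<in> sets M'"
    then have A: "A \<in> sets M" "A \<subseteq> space M" using that sets.sets_into_space[of A M] by auto
    have "emeasure M' A = emeasure M' (Y \<inter> A) + emeasure M' (Z \<inter> A)"
      using A Y Z that(1) by (subst plus_emeasure) (auto intro!: arg_cong[of _ _ "emeasure M'"] simp: Z_def)
    then show "emeasure M' A = emeasure (R M' Y) A + emeasure (R M' Z) A"
      using R(1)[OF that(1) Y(1) A(1)] R(1)[OF that(1) Z A(1)] by simp
  qed (use that Rs in auto)
  have add_diff: "ennreal (a - b) + ennreal b = ennreal a" if "0 \<le> b" "b \<le> a" for a b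
    using that by (subst ennreal_plus[symmetric]) auto
  have neg: "- \<mu> A = measure Q A - measure P A" if "A \<in> sets M" for A
    using \<mu>[OF that] by simp
  have p: "integrable (pos_variation M \<mu>) f \<and> integrable (R Q Y) f \<and>
      integral\<^sup>L (R P Y) f = integral\<^sup>L (pos_variation M \<mu>) f + integral\<^sup>L (R Q Y) f"
  proof (rule integral_add_measure)
    fix A assume "A \<in> sets (R P Y)"
    then have A: "A \<in> sets M" using Rs[OF sets(1)] by simp
    have "measure Q (A \<inter> Y) \<le> measure P (A \<inter> Y)"
      using Y(2)[of "A \<inter> Y"] A Y(1) by (simp add: P.emeasure_eq_measure Q.emeasure_eq_measure)
    moreover have pv: "emeasure (pos_variation M \<mu>) A = ennreal (measure P (A \<inter> Y) - measure Q (A \<inter> Y))"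
      by (rule emeasure_pos_variation[OF fin sets _ Y A]) (rule \<mu>)
    ultimately show "emeasure (R P Y) A = emeasure (pos_variation M \<mu>) A + emeasure (R Q Y) A"
      unfolding R(1)[OF sets(1) Y(1) A] R(1)[OF sets(2) Y(1) A] pv P.emeasure_eq_measure Q.emeasure_eq_measure
      by (simp add: Int_commute add_diff)
  qed (use split[OF sets(1) int(1)] Rs sets in auto)
  have n: "integrable (pos_variation M (\<lambda>A. - \<mu> A)) f \<and> integrable (R P Z) f \<and>
      integral\<^sup>L (R Q Z) f = integral\<^sup>L (pos_variation M (\<lambda>A. - \<mu> A)) f + integral\<^sup>L (R P Z) f"
  proof (rule integral_add_measure)
    fix A assume "A \<in> sets (R Q Z)"
    then have A: "A \<in> sets M" using Rs[OF sets(2)] by simp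
    have Z': "P X \<le> Q X" if "X \<in> sets M" "X \<subseteq> Z" for X
      using that by (intro Y(3)) (auto simp: Z_def)
    have Z'': "Q X \<le> P X" if "X \<in> sets M" "X \<inter> Z = {}" for X
      using that sets.sets_into_space[of X M] by (intro Y(2)) (auto simp: Z_def)
    have "measure P (A \<inter> Z) \<le> measure Q (A \<inter> Z)"
      using Z'[of "A \<inter> Z"] A Z by (simp add: P.emeasure_eq_measure Q.emeasure_eq_measure)
    moreover have pv: "emeasure (pos_variation M (\<lambda>A. - \<mu> A)) A =
        ennreal (measure Q (A \<inter> Z) - measure P (A \<inter> Z))"
      by (rule emeasure_pos_variation[OF fin(2,1) sets(2,1) _ Z Z' Z'' A]) (rule neg)
    ultimately show "emeasure (R Q Z) A = emeasure (pos_variation M (\<lambda>A. - \<mu> A)) A + emeasure (R P Z) A"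
      unfolding R(1)[OF sets(1) Z A] R(1)[OF sets(2) Z A] pv P.emeasure_eq_measure Q.emeasure_eq_measure
      by (simp add: Int_commute add_diff)
  qed (use split[OF sets(2) int(2)] Rs sets in auto)
  show "integrable (pos_variation M \<mu>) f" "integrable (pos_variation M (\<lambda>A. - \<mu> A)) f"
    using p n by auto
  show "integral\<^sup>L (pos_variation M \<mu>) f - integral\<^sup>L (pos_variation M (\<lambda>A. - \<mu> A)) f =
      integral\<^sup>L P f - integral\<^sup>L Q f"
    using p n split[OF sets(1) int(1)] split[OF sets(2) int(2)] by (simp add: algebra_simps)
qed

section \<open>Bounded Borel functional calculus\<close>

text \<open>Half of the polarization vector x + i^k y: the factor 1/2 absorbs the usual 1/4, so the
  polarization identity becomes a plain sum of squared norms with coefficients i^k.\<close>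

definition pol :: "nat \<Rightarrow> l2 \<Rightarrow> l2 \<Rightarrow> l2" where
  "pol k x y = (1/2) *\<^sub>C (x + \<i> ^ k *\<^sub>C y)"

lemma polarization:
  "(\<Sum>k<4. \<i> ^ k * complex_of_real ((norm (pol k x y))\<^sup>2)) = cinner x y"
proof -
  have "complex_of_real ((norm (pol k x y))\<^sup>2) =
     1/4 * (cinner x x + \<i> ^ k * cinner y x + cnj (\<i> ^ k) * cinner x y + \<i> ^ k * cnj (\<i> ^ k) * cinner y y)" for k
    unfolding cinner_same[symmetric] pol_def
    by (simp add: cinner_scaleC_left cinner_scaleC_right cinner_add_left cinner_add_right algebra_simps
        del: complex_cnj_power)
  then show ?thesis
    by (simp add: lessThan_Suc eval_nat_numeral algebra_simps)
qed

locale pvm =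
  fixes E :: "complex set \<Rightarrow> l2 \<Rightarrow> l2"
  assumes pvm: "projection_valued_measure E"
begin

lemma E_bounded_linear: "A \<in> sets borel \<Longrightarrow> bounded_linear (E A)"
  and E_scaleC: "A \<in> sets borel \<Longrightarrow> E A (c *\<^sub>C x) = c *\<^sub>C E A x"
  and E_idem: "A \<in> sets borel \<Longrightarrow> E A (E A x) = E A x"
  and E_self_adjoint: "A \<in> sets borel \<Longrightarrow> cinner (E A x) y = cinner x (E A y)"
  using pvm by (auto simp: projection_valued_measure_def orthogonal_projection_def)

lemma E_UNIV: "E UNIV x = x"
  and E_Int: "A \<in> sets borel \<Longrightarrow> B \<in> sets borel \<Longrightarrow> E (A \<inter> B) x = E A (E B x)"
  and E_sums: "range X \<subseteq> sets borel \<Longrightarrow> disjoint_family X \<Longrightarrow> (\<lambda>n. E (X n) x) sums E (\<Union>n. X n) x"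
  using pvm by (auto simp: projection_valued_measure_def)

lemma E_add: "A \<in> sets borel \<Longrightarrow> E A (x + y) = E A x + E A y"
  using E_bounded_linear linear_add bounded_linear.linear by blast

lemma E_empty: "E {} x = 0"
proof -
  have "(\<lambda>n::nat. E {} x) sums E {} x"
    using E_sums[of "\<lambda>_. {}" x] by (simp add: disjoint_family_on_def)
  then have "(\<lambda>n::nat. E {} x) \<longlonglongrightarrow> 0"
    by (intro summable_LIMSEQ_zero) (rule sums_summable)
  then show ?thesis by (simp add: LIMSEQ_const_iff)
qed

abbreviation mu :: "l2 \<Rightarrow> complex measure" where
  "mu \<equiv> spectral_measure E"

lemma cinner_E_same: "A \<in> sets borel \<Longrightarrow> cinner (E A x) x = complex_of_real ((norm (E A x))\<^sup>2)"
  by (metis E_idem E_self_adjoint cinner_same)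

lemma sets_mu [simp, measurable_cong]: "sets (mu x) = sets borel"
  using sets.sigma_sets_eq[of "borel :: complex measure"] by (simp add: spectral_measure_def)

lemma space_mu [simp]: "space (mu x) = UNIV"
  by (simp add: spectral_measure_def)

lemma emeasure_mu:
  assumes "A \<in> sets borel"
  shows "emeasure (mu x) A = ennreal ((norm (E A x))\<^sup>2)"
proof -
  have "emeasure (mu x) A = ennreal (Re (cinner (E A x) x))"
  proof (rule emeasure_measure_of[OF spectral_measure_def])
    show "positive (sets (mu x)) (\<lambda>A. ennreal (Re (cinner (E A x) x)))"
      by (simp add: positive_def E_empty cinner.zero_left)
    show "countably_additive (sets (mu x)) (\<lambda>A. ennreal (Re (cinner (E A x) x)))"
      unfolding countably_additive_def
    proof (intro allI impI)
      fix X :: "nat \<Rightarrow> complex set"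
      assume X: "range X \<subseteq> sets (mu x)" "disjoint_family X"
      have "(\<lambda>n. Re (cinner (E (X n) x) x)) sums Re (cinner (E (\<Union>n. X n) x) x)"
        unfolding Re_cinner
        by (intro bounded_linear.sums[OF bounded_linear_inner_left] E_sums) (use X in auto)
      moreover have "Re (cinner (E (X n) x) x) \<ge> 0" for n
        using X cinner_E_same[of "X n" x] by (simp add: range_subsetD del: of_real_power)
      ultimately show "(\<Sum>i. ennreal (Re (cinner (E (X i) x) x))) = ennreal (Re (cinner (E (\<Union>n. X n) x) x))"
        by (intro suminf_ennreal_eq)
    qed
  qed (use assms in auto)
  then show ?thesis using cinner_E_same[OF assms, of x] by (simp del: of_real_power)
qed

lemma finite_measure_mu: "finite_measure (mu x)"
  by (rule finite_measureI) (simp add: emeasure_mu)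

lemma measure_mu: "A \<in> sets borel \<Longrightarrow> measure (mu x) A = (norm (E A x))\<^sup>2"
  by (simp add: measure_def emeasure_mu)

lemma AE_muI: "A \<in> sets borel \<Longrightarrow> E A x = 0 \<Longrightarrow> (\<And>z. z \<notin> A \<Longrightarrow> P z) \<Longrightarrow> AE z in mu x. P z"
  by (rule AE_I'[of A]) (auto simp: null_sets_def emeasure_mu)

lemma integrable_mu: "bounded_borel f \<Longrightarrow> integrable (mu x) f"
  by (erule bounded_borelE)
    (auto intro!: finite_measure.integrable_const_bound[OF finite_measure_mu] AE_I2)

text \<open>The integral of f against the complex measure A \<mapsto> \<langle>E A x, y\<rangle>,
  written through four finite positive measures so that the usual convergence theorems
  apply.\<close>

definition S :: "(complex \<Rightarrow> complex) \<Rightarrow> l2 \<Rightarrow> l2 \<Rightarrow> complex" where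
  "S f x y = (\<Sum>k<4. \<i> ^ k * (\<integral>z. f z \<partial>mu (pol k x y)))"

lemma E_pol: "A \<in> sets borel \<Longrightarrow> E A (pol k x y) = pol k (E A x) (E A y)"
  by (simp add: pol_def E_scaleC E_add)

lemma integral_mu_indicator:
  assumes "A \<in> sets borel"
  shows "(\<integral>z. c * indicator A z \<partial>mu v) = c * complex_of_real ((norm (E A v))\<^sup>2)"
proof -
  have "has_bochner_integral (mu v) (\<lambda>z. indicator A z *\<^sub>R c) (measure (mu v) A *\<^sub>R c)"
    using assms by (intro has_bochner_integral_indicator) (auto simp: emeasure_mu)
  moreover have "(\<lambda>z. indicator A z *\<^sub>R c) = (\<lambda>z. c * indicator A z)"
    by (auto simp: indicator_def)
  ultimately show ?thesis
    using assms by (intro has_bochner_integral_integral_eq) (simp add: measure_mu scaleR_conv_of_real mult.commute)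
qed

lemma S_indicator:
  assumes "A \<in> sets borel"
  shows "S (\<lambda>z. c * indicator A z) x y = c * cinner (E A x) y"
proof -
  have "S (\<lambda>z. c * indicator A z) x y =
      c * (\<Sum>k<4. \<i> ^ k * complex_of_real ((norm (pol k (E A x) (E A y)))\<^sup>2))"
    unfolding S_def integral_mu_indicator[OF assms] E_pol[OF assms] sum_distrib_left by (simp only: mult.left_commute)
  also have "\<dots> = c * cinner (E A x) (E A y)" by (simp only: polarization)
  also have "cinner (E A x) (E A y) = cinner (E A x) y"
    using assms by (metis E_idem E_self_adjoint)
  finally show ?thesis .
qed

lemma S_add: "bounded_borel f \<Longrightarrow> bounded_borel g \<Longrightarrow> S (\<lambda>z. f z + g z) x y = S f x y + S g x y"
  by (simp add: S_def integrable_mu distrib_left sum.distrib)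

lemma S_cmult: "S (\<lambda>z. c * f z) x y = c * S f x y"
  by (simp add: S_def sum_distrib_left mult.left_commute)

lemma S_lim:
  assumes "\<And>i. u i \<in> borel_measurable borel" "\<And>i z. norm (u i z) \<le> K" "f \<in> borel_measurable borel"
    "\<And>z. (\<lambda>i. u i z) \<longlonglongrightarrow> f z"
  shows "(\<lambda>i. S (u i) x y) \<longlonglongrightarrow> S f x y"
  unfolding S_def
proof (intro tendsto_sum tendsto_mult tendsto_const)
  fix k
  show "(\<lambda>i. \<integral>z. u i z \<partial>mu (pol k x y)) \<longlonglongrightarrow> (\<integral>z. f z \<partial>mu (pol k x y))"
    by (rule integral_dominated_convergence[where w="\<lambda>_. K"])
      (use assms in \<open>auto intro: finite_measure.integrable_const finite_measure_mu\<close>)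
qed

section \<open>Existence of f(N)x for bounded Borel f\<close>

definition represents :: "l2 \<Rightarrow> (complex \<Rightarrow> complex) \<Rightarrow> l2 \<Rightarrow> bool" where
  "represents z f x \<longleftrightarrow> (\<forall>y. cinner z y = S f x y)"

text \<open>Expanding \<open>g\<close> in binary digits turns \<open>g(N)x\<close> into an absolutely convergent series.\<close>

lemma represents_unit_interval:
  fixes g :: "complex \<Rightarrow> real"
  assumes [measurable]: "g \<in> borel_measurable borel" and g: "\<And>z. 0 \<le> g z" "\<And>z. g z < 1"
  shows "\<exists>v. represents v (\<lambda>z. complex_of_real (g z)) x"
proof -
  \<comment> \<open>\<open>B n\<close> is the set where the binary digit number n + 1 of g is 1;
    \<open>u n\<close> below keeps the first n digits.\<close>
  define B where "B n = {z. \<lfloor>2 ^ Suc n * g z\<rfloor> - 2 * \<lfloor>2 ^ n * g z\<rfloor> = 1}" for n :: nat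
  have [measurable]: "B n \<in> sets borel" for n
    unfolding B_def by measurable
  define u where "u n z = complex_of_real (of_int \<lfloor>2 ^ n * g z\<rfloor> / 2 ^ n)" for n :: nat and z
  have floor_bound: "0 \<le> \<lfloor>2 ^ n * g z\<rfloor>" "of_int \<lfloor>2 ^ n * g z\<rfloor> \<le> (2 ^ n :: real)" for n z
  proof -
    show "0 \<le> \<lfloor>2 ^ n * g z\<rfloor>" using g by simp
    have "of_int \<lfloor>2 ^ n * g z\<rfloor> \<le> 2 ^ n * g z" by simp
    also have "\<dots> \<le> 2 ^ n" using g(2)[of z] by simp
    finally show "of_int \<lfloor>2 ^ n * g z\<rfloor> \<le> (2 ^ n :: real)" .
  qed
  have u: "u n \<in> borel_measurable borel" "norm (u n z) \<le> 1" for n z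
  proof -
    show "u n \<in> borel_measurable borel" unfolding u_def by measurable
    show "norm (u n z) \<le> 1"
      using floor_bound[of n z] unfolding u_def norm_of_real by (simp add: field_simps)
  qed
  have u_Suc: "u (Suc n) z = u n z + (1/2) ^ Suc n * indicator (B n) z" for n z
  proof -
    have "\<lfloor>2 * (2 ^ n * g z)\<rfloor> - 2 * \<lfloor>2 ^ n * g z\<rfloor> = 0 \<or> \<lfloor>2 * (2 ^ n * g z)\<rfloor> - 2 * \<lfloor>2 ^ n * g z\<rfloor> = 1"
      by linarith
    then have "of_int \<lfloor>2 ^ Suc n * g z\<rfloor> = 2 * of_int \<lfloor>2 ^ n * g z\<rfloor> + (indicator (B n) z :: real)"
      by (auto simp: B_def indicator_def mult.assoc)
    then have "u (Suc n) z = complex_of_real ((2 * of_int \<lfloor>2 ^ n * g z\<rfloor> + indicator (B n) z) / 2 ^ Suc n)"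
      by (simp only: u_def)
    also have "\<dots> = u n z + (1/2) ^ Suc n * indicator (B n) z"
      by (cases "z \<in> B n") (simp_all add: u_def add_divide_distrib power_one_over)
    finally show ?thesis .
  qed
  have u0: "u 0 z = 0" for z
    using g[of z] by (simp add: u_def floor_eq_iff)
  define s where "s n = (\<Sum>k<n. (1/2) ^ Suc k *\<^sub>C E (B k) x)" for n
  have s: "cinner (s n) y = S (u n) x y" for n y
  proof (induction n)
    case 0
    then show ?case using S_cmult[of 0 "\<lambda>_. 0" x y] by (simp add: s_def u0[abs_def] cinner.zero_left)
  next
    case (Suc n)
    have "S (u (Suc n)) x y = S (u n) x y + S (\<lambda>z. (1/2) ^ Suc n * indicator (B n) z) x y"
      unfolding u_Suc[abs_def] using u
      by (intro S_add bounded_borel_intros) (auto intro: bounded_borelI[of _ 1])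
    with Suc show ?case
      by (simp add: s_def cinner_add_left cinner_scaleC_left S_indicator del: power_Suc)
  qed
  have norm_E: "norm (E A x) \<le> norm x" if "A \<in> sets borel" for A
  proof -
    have "(norm (E A x))\<^sup>2 \<le> norm (E A x) * norm x"
      using norm_cinner_le[of "E A x" x] cinner_E_same[OF that, of x] by (simp add: norm_power)
    then show ?thesis
      by (cases "norm (E A x) = 0") (auto simp: power2_eq_square)
  qed
  \<comment> \<open>Projections do not increase norms, so the series has a geometric majorant and
    converges by completeness of \<open>l2\<close>.\<close>
  have "summable (\<lambda>k. (1/2) ^ Suc k *\<^sub>C E (B k) x)"
  proof (rule summable_comparison_test')
    show "summable (\<lambda>k. (1/2::real) ^ Suc k * norm x)"
      by (intro summable_mult2) (simp add: summable_Suc_iff[of "\<lambda>k. (1/2) ^ k"] del: power_Suc)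
    show "norm ((1/2) ^ Suc k *\<^sub>C E (B k) x) \<le> (1/2) ^ Suc k * norm x" for k
      by (simp add: norm_scaleC norm_E norm_power norm_divide del: power_Suc)
  qed
  then obtain v where v: "s \<longlonglongrightarrow> v"
    unfolding s_def using summable_LIMSEQ by blast
  have "cinner v y = S (\<lambda>z. complex_of_real (g z)) x y" for y
  proof (rule LIMSEQ_unique)
    show "(\<lambda>n. cinner (s n) y) \<longlonglongrightarrow> cinner v y"
      by (intro cinner.tendsto v tendsto_const)
    show "(\<lambda>n. cinner (s n) y) \<longlonglongrightarrow> S (\<lambda>z. complex_of_real (g z)) x y"
      unfolding s
    proof (rule S_lim)
      fix z
      have "(\<lambda>n. of_int \<lfloor>2 ^ n * g z\<rfloor> / 2 ^ n) \<longlonglongrightarrow> g z"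
      proof (rule tendsto_sandwich)
        show "\<forall>\<^sub>F n in sequentially. g z - (1/2) ^ n \<le> of_int \<lfloor>2 ^ n * g z\<rfloor> / 2 ^ n"
        proof (intro always_eventually allI)
          fix n
          have "2 ^ n * g z - 1 \<le> of_int \<lfloor>2 ^ n * g z\<rfloor>" by linarith
          then have "(2 ^ n * g z - 1) / 2 ^ n \<le> of_int \<lfloor>2 ^ n * g z\<rfloor> / 2 ^ n"
            by (rule divide_right_mono) simp
          then show "g z - (1/2) ^ n \<le> of_int \<lfloor>2 ^ n * g z\<rfloor> / 2 ^ n"
            by (simp add: diff_divide_distrib power_one_over)
        qed
        show "\<forall>\<^sub>F n in sequentially. of_int \<lfloor>2 ^ n * g z\<rfloor> / 2 ^ n \<le> g z"
          by (intro always_eventually allI) (simp add: field_simps)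
        show "(\<lambda>n. g z - (1/2) ^ n) \<longlonglongrightarrow> g z"
          by (rule tendsto_eq_intros LIMSEQ_power_zero | simp)+
      qed auto
      then show "(\<lambda>n. u n z) \<longlonglongrightarrow> complex_of_real (g z)"
        unfolding u_def by (rule tendsto_of_real)
    qed (use u in auto)
  qed
  then show ?thesis by (auto simp: represents_def)
qed

lemma represents_add:
  "represents v f x \<Longrightarrow> represents w g x \<Longrightarrow> bounded_borel f \<Longrightarrow> bounded_borel g \<Longrightarrow>
    represents (v + w) (\<lambda>z. f z + g z) x"
  by (simp add: represents_def cinner_add_left S_add)

lemma represents_cmult: "represents v f x \<Longrightarrow> represents (c *\<^sub>C v) (\<lambda>z. c * f z) x"
  by (simp add: represents_def cinner_scaleC_left S_cmult)

lemma represents_exists: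
  assumes f: "bounded_borel f"
  shows "\<exists>v. represents v f x"
proof -
  obtain K where K: "f \<in> borel_measurable borel" "\<And>z. norm (f z) \<le> K" "K \<ge> 0"
    using f by (rule bounded_borelE) (rule that)
  note [measurable] = K(1)
  \<comment> \<open>The margin 1 makes Re f / (2 L) + 1/2 strictly smaller than 1, as the binary
    expansion requires: its digit before the point must be 0.\<close>
  define L where "L = K + 1"
  have L: "L > 0" "\<bar>Re (f z)\<bar> < L" "\<bar>Im (f z)\<bar> < L" for z
    using K(2)[of z] K(3) abs_Re_le_cmod[of "f z"] abs_Im_le_cmod[of "f z"] by (auto simp: L_def)
  define g h where "g z = Re (f z) / (2 * L) + 1/2" and "h z = Im (f z) / (2 * L) + 1/2" for z
  have gh: "0 \<le> g z" "g z < 1" "0 \<le> h z" "h z < 1" for z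
    using L(1) L(2)[of z] L(3)[of z] by (auto simp: g_def h_def field_simps abs_less_iff)
  have [measurable]: "g \<in> borel_measurable borel" "h \<in> borel_measurable borel"
    unfolding g_def h_def by measurable
  obtain v w where v: "represents v (\<lambda>z. complex_of_real (g z)) x"
    and w: "represents w (\<lambda>z. complex_of_real (h z)) x"
    using represents_unit_interval[of g x] represents_unit_interval[of h x] gh by auto
  have one: "represents x (\<lambda>z. 1) x"
    using S_indicator[of UNIV 1 x] by (simp add: represents_def E_UNIV)
  have b: "bounded_borel (\<lambda>z. complex_of_real (g z))" "bounded_borel (\<lambda>z. complex_of_real (h z))"
    using gh by (auto intro!: bounded_borelI[of _ 1] less_imp_le)
  have "f = (\<lambda>z. 2 * L * complex_of_real (g z) + (2 * L * \<i> * complex_of_real (h z) + (- L - L * \<i>) * 1))"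
    using L(1) by (auto simp: g_def h_def complex_eq_iff field_simps)
  moreover have "\<exists>v. represents v (\<lambda>z. 2 * L * complex_of_real (g z) +
      (2 * L * \<i> * complex_of_real (h z) + (- L - L * \<i>) * 1)) x"
    by (rule exI, rule represents_add[OF represents_cmult[OF v]
        represents_add[OF represents_cmult[OF w] represents_cmult[OF one]]];
        intro bounded_borel_intros b)
  ultimately show ?thesis by metis
qed

text \<open>The operator f(N), pinned down weakly: a vector is determined by its inner products, and
  existence comes from the binary expansion. The value is meaningful for bounded Borel f
  only.\<close>

definition F :: "(complex \<Rightarrow> complex) \<Rightarrow> l2 \<Rightarrow> l2" where
  "F f x = (THE v. represents v f x)"

lemma cinner_F:
  assumes "bounded_borel f"
  shows "cinner (F f x) y = S f x y"
proof -
  obtain v where "represents v f x" using represents_exists[OF assms] by blast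
  then have "represents (F f x) f x"
    unfolding F_def
    by (rule theI) (use \<open>represents v f x\<close> in \<open>auto simp: represents_def intro: l2_eq_cinnerI\<close>)
  then show ?thesis by (simp add: represents_def)
qed

lemma F_eqI: "bounded_borel f \<Longrightarrow> (\<And>y. cinner v y = S f x y) \<Longrightarrow> F f x = v"
  by (rule l2_eq_cinnerI) (simp add: cinner_F)

lemma F_cindicator: "A \<in> sets borel \<Longrightarrow> F (\<lambda>z. c * indicator A z) x = c *\<^sub>C E A x"
  by (intro F_eqI bounded_borel_intros) (auto simp: cinner_scaleC_left S_indicator)

lemma F_indicator: "A \<in> sets borel \<Longrightarrow> F (indicator A) x = E A x"
  using F_cindicator[of A 1 x] by (simp add: scaleC_one)

lemma F_add: "bounded_borel f \<Longrightarrow> bounded_borel g \<Longrightarrow> F (\<lambda>z. f z + g z) x = F f x + F g x"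
  by (intro F_eqI bounded_borel_intros) (auto simp: cinner_add_left S_add cinner_F)

lemma F_cmult: "bounded_borel f \<Longrightarrow> F (\<lambda>z. c * f z) x = c *\<^sub>C F f x"
  by (intro F_eqI bounded_borel_intros) (auto simp: cinner_scaleC_left S_cmult cinner_F)

lemma F_diff: "bounded_borel f \<Longrightarrow> bounded_borel g \<Longrightarrow> F (\<lambda>z. f z - g z) x = F f x - F g x"
  using F_add[of f "\<lambda>z. (-1) * g z" x] F_cmult[of g "-1" x] bounded_borel_cmult[of g "-1"]
  by (simp add: scaleC_minus_one)

lemma F_weak_lim:
  assumes "\<And>i. u i \<in> borel_measurable borel" "\<And>i z. norm (u i z) \<le> K" "bounded_borel f"
    "\<And>z. (\<lambda>i. u i z) \<longlonglongrightarrow> f z"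
  shows "(\<lambda>i. cinner (F (u i) x) y) \<longlonglongrightarrow> cinner (F f x) y"
proof -
  have "bounded_borel (u i)" for i using assms by (auto intro: bounded_borelI)
  then show ?thesis
    using S_lim[of u K f x y] assms by (simp add: cinner_F bounded_borel_measurable)
qed

lemma F_weak_lim':
  assumes "\<And>i. u i \<in> borel_measurable borel" "\<And>i z. norm (u i z) \<le> K" "bounded_borel f"
    "\<And>z. (\<lambda>i. u i z) \<longlonglongrightarrow> f z"
  shows "(\<lambda>i. cinner y (F (u i) x)) \<longlonglongrightarrow> cinner y (F f x)"
  using tendsto_cnj[OF F_weak_lim[OF assms, of x y]] by (simp flip: cinner_commute)

lemma F_eq_lim:
  assumes "\<And>y. (\<lambda>i. cinner (v i) y) \<longlonglongrightarrow> cinner w y" "\<And>y. (\<lambda>i. cinner (v i) y) \<longlonglongrightarrow> cinner w' y"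
  shows "w = w'"
  using assms by (intro l2_eq_cinnerI) (meson LIMSEQ_unique)

lemma F_arg_add: 
  assumes "bounded_borel f" shows "F f (x + y) = F f x + F f y"
  using assms
proof (induction rule: bounded_borel_induct)
  case (base c A)
  then show ?case by (simp add: F_cindicator E_add scaleC_add_right)
next
  case (add f g)
  then show ?case by (simp add: F_add)
next
  case (lim f u K)
  show ?case
  proof (rule F_eq_lim[of "\<lambda>i. F (u i) (x + y)"])
    fix z
    show "(\<lambda>i. cinner (F (u i) (x + y)) z) \<longlonglongrightarrow> cinner (F f (x + y)) z"
      using lim by (intro F_weak_lim) auto
    show "(\<lambda>i. cinner (F (u i) (x + y)) z) \<longlonglongrightarrow> cinner (F f x + F f y) z"
      unfolding lim.IH cinner_add_left using lim by (intro tendsto_add F_weak_lim) auto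
  qed
qed

lemma F_arg_scaleC:
  assumes "bounded_borel f" shows "F f (a *\<^sub>C x) = a *\<^sub>C F f x"
  using assms
proof (induction rule: bounded_borel_induct)
  case (base c A)
  then show ?case by (simp add: F_cindicator E_scaleC scaleC_scaleC mult.commute)
next
  case (add f g)
  then show ?case by (simp add: F_add scaleC_add_right)
next
  case (lim f u K)
  show ?case
  proof (rule F_eq_lim[of "\<lambda>i. F (u i) (a *\<^sub>C x)"])
    fix z
    show "(\<lambda>i. cinner (F (u i) (a *\<^sub>C x)) z) \<longlonglongrightarrow> cinner (F f (a *\<^sub>C x)) z"
      using lim by (intro F_weak_lim) auto
    show "(\<lambda>i. cinner (F (u i) (a *\<^sub>C x)) z) \<longlonglongrightarrow> cinner (a *\<^sub>C F f x) z"
      unfolding lim.IH cinner_scaleC_left using lim by (intro tendsto_mult tendsto_const F_weak_lim) auto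
  qed
qed

lemma F_adjoint:
  assumes "bounded_borel f" shows "cinner (F f x) y = cinner x (F (\<lambda>z. cnj (f z)) y)"
  using assms
proof (induction rule: bounded_borel_induct)
  case (base c A)
  have "(\<lambda>z. cnj (c * indicator A z)) = (\<lambda>z. cnj c * indicator A z)"
    by (auto simp: indicator_def)
  with base show ?case
    by (simp add: F_cindicator cinner_scaleC_left cinner_scaleC_right E_self_adjoint)
next
  case (add f g)
  then show ?case
    using add by (simp add: F_add bounded_borel_cnj cinner_add_left cinner_add_right)
next
  case (lim f u K)
  have b: "bounded_borel (\<lambda>z. cnj (f z))"
    using lim by (intro bounded_borel_cnj)
  show ?case
  proof (rule LIMSEQ_unique)
    show "(\<lambda>i. cinner (F (u i) x) y) \<longlonglongrightarrow> cinner (F f x) y"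
      using lim by (intro F_weak_lim) auto
    show "(\<lambda>i. cinner (F (u i) x) y) \<longlonglongrightarrow> cinner x (F (\<lambda>z. cnj (f z)) y)"
      unfolding lim.IH using lim b by (intro F_weak_lim'[of _ K] tendsto_cnj) auto
  qed
qed

text \<open>Multiplicativity starts from E (B \<inter> A) = E B E A, extended here to an arbitrary
  left factor f; \<open>F_mult\<close> then extends it in the right factor.\<close>

lemma F_mult_indicator:
  assumes "bounded_borel f" and A: "A \<in> sets borel"
  shows "F (\<lambda>z. f z * indicator A z) x = F f (E A x)"
  using assms(1)
proof (induction rule: bounded_borel_induct)
  case (base c B)
  have "(\<lambda>z. c * indicator B z * indicator A z) = (\<lambda>z. c * (indicator (B \<inter> A) z :: complex))"
    by (auto simp: indicator_def)
  with base A show ?case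
    using E_Int[of B A x] by (simp add: F_cindicator)
next
  case (add f g)
  with add A show ?case
    by (simp add: F_add distrib_right bounded_borel_intros)
next
  case (lim f u K)
  have b: "bounded_borel (\<lambda>z. f z * indicator A z)"
    using lim A by (intro bounded_borel_intros)
  have "norm (u i z * indicator A z) \<le> K" for i z
    using lim.hyps(2)[of i z] order_trans[OF norm_ge_zero lim.hyps(2)[of i z]] by (auto simp: indicator_def)
  show ?case
  proof (rule F_eq_lim[of "\<lambda>i. F (u i) (E A x)"])
    fix y
    show "(\<lambda>i. cinner (F (u i) (E A x)) y) \<longlonglongrightarrow> cinner (F f (E A x)) y"
      using lim by (intro F_weak_lim) auto
    show "(\<lambda>i. cinner (F (u i) (E A x)) y) \<longlonglongrightarrow> cinner (F (\<lambda>z. f z * indicator A z) x) y"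
      unfolding lim.IH[symmetric]
      using \<open>\<And>i z. norm (u i z * indicator A z) \<le> K\<close> b lim A
      by (intro F_weak_lim[of _ K]) (auto intro!: tendsto_intros)
  qed
qed

lemma F_mult:
  assumes f: "bounded_borel f" and "bounded_borel g"
  shows "F (\<lambda>z. f z * g z) x = F f (F g x)"
  using assms(2)
proof (induction rule: bounded_borel_induct)
  case (base c A)
  have "F (\<lambda>z. f z * (c * indicator A z)) x = F (\<lambda>z. c * (f z * indicator A z)) x"
    by (simp add: mult.left_commute)
  also have "\<dots> = c *\<^sub>C F f (E A x)"
    using f base by (simp add: F_cmult F_mult_indicator bounded_borel_intros)
  finally show ?case using f base by (simp add: F_cindicator F_arg_scaleC)
next
  case (add g h)
  with add f show ?case
    by (simp add: F_add distrib_left bounded_borel_intros F_arg_add)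
next
  case (lim g u K)
  obtain L where L: "f \<in> borel_measurable borel" "\<And>z. norm (f z) \<le> L" "L \<ge> 0"
    using f by (rule bounded_borelE) (rule that)
  have b: "bounded_borel (\<lambda>z. f z * g z)"
    using lim f by (intro bounded_borel_intros)
  have nb: "norm (f z * u i z) \<le> L * K" for i z
    unfolding norm_mult using L lim.hyps(2)[of i z] by (intro mult_mono) auto
  show ?case
  proof (rule F_eq_lim[of "\<lambda>i. F f (F (u i) x)"])
    fix y
    show "(\<lambda>i. cinner (F f (F (u i) x)) y) \<longlonglongrightarrow> cinner (F f (F g x)) y"
      \<comment> \<open>Moving F f to the other side leaves F (u i) x paired with a fixed vector, so
        weak convergence suffices.\<close>
      unfolding F_adjoint[OF f] using lim by (intro F_weak_lim) auto
    show "(\<lambda>i. cinner (F f (F (u i) x)) y) \<longlonglongrightarrow> cinner (F (\<lambda>z. f z * g z) x) y"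
      unfolding lim.IH[symmetric]
      using nb b L(1) lim
      by (intro F_weak_lim[of _ "L * K"]) (auto intro!: tendsto_intros)
  qed
qed

lemma cinner_F_same:
  assumes "bounded_borel f"
  shows "cinner (F f x) x = (\<integral>z. f z \<partial>mu x)"
  using assms
proof (induction rule: bounded_borel_induct)
  case (base c A)
  then show ?case
    by (simp only: F_cindicator cinner_scaleC_left cinner_E_same integral_mu_indicator)
next
  case (add f g)
  with add show ?case by (simp add: F_add cinner_add_left integrable_mu)
next
  case (lim f u K)
  show ?case
  proof (rule LIMSEQ_unique)
    show "(\<lambda>i. cinner (F (u i) x) x) \<longlonglongrightarrow> cinner (F f x) x"
      using lim by (intro F_weak_lim) auto
    show "(\<lambda>i. cinner (F (u i) x) x) \<longlonglongrightarrow> (\<integral>z. f z \<partial>mu x)"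
      unfolding lim.IH
      by (rule integral_dominated_convergence[where w="\<lambda>_. K"])
        (use lim bounded_borel_measurable[OF lim.hyps(4)] in \<open>auto intro: finite_measure.integrable_const finite_measure_mu\<close>)
  qed
qed

text \<open>The squared norm is the quadratic form of conj f * f, by the adjoint and product rules.
  This isometry into L_2 of the spectral measure of x reduces norm bounds and strong limits to
  integrals over \<open>mu x\<close>.\<close>

lemma norm_F:
  assumes f: "bounded_borel f"
  shows "(norm (F f x))\<^sup>2 = (\<integral>z. (norm (f z))\<^sup>2 \<partial>mu x)"
proof -
  have "complex_of_real ((norm (F f x))\<^sup>2) = cinner (F (\<lambda>z. cnj (f z)) (F f x)) x"
    unfolding cinner_same[symmetric] using F_adjoint[OF bounded_borel_cnj[OF f], of "F f x" x] by simp
  also have "\<dots> = (\<integral>z. cnj (f z) * f z \<partial>mu x)"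
    using f by (simp add: F_mult[symmetric] bounded_borel_cnj cinner_F_same bounded_borel_mult)
  also have "\<dots> = (\<integral>z. complex_of_real ((norm (f z))\<^sup>2) \<partial>mu x)"
    by (simp only: complex_norm_square mult.commute)
  also have "\<dots> = complex_of_real (\<integral>z. (norm (f z))\<^sup>2 \<partial>mu x)"
    by (rule integral_complex_of_real)
  finally show ?thesis by (simp only: of_real_eq_iff)
qed

lemma integrable_norm_power2: "bounded_borel f \<Longrightarrow> integrable (mu x) (\<lambda>z. (norm (f z))\<^sup>2)"
proof (erule bounded_borelE)
  fix K assume K: "f \<in> borel_measurable borel" "\<And>z. norm (f z) \<le> K" "0 \<le> K"
  then show "integrable (mu x) (\<lambda>z. (norm (f z))\<^sup>2)"
    by (intro finite_measure.integrable_const_bound[OF finite_measure_mu, where B = "K\<^sup>2"] AE_I2)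
       (auto intro: power_mono)
qed

lemma norm_F_le:
  assumes f: "bounded_borel f" and K: "\<And>z. norm (f z) \<le> K"
  shows "norm (F f x) \<le> K * norm x"
proof -
  have "K \<ge> 0" using K norm_ge_zero order_trans by blast
  have "(norm (F f x))\<^sup>2 \<le> (\<integral>z. K\<^sup>2 \<partial>mu x)"
    unfolding norm_F[OF f]
    using K by (intro integral_mono integrable_norm_power2 f)
      (auto intro: finite_measure.integrable_const finite_measure_mu power_mono)
  also have "\<dots> = (K * norm x)\<^sup>2"
    using measure_mu[of UNIV x] by (simp add: E_UNIV power_mult_distrib mult.commute)
  finally show ?thesis by (rule power2_le_imp_le) (simp add: \<open>K \<ge> 0\<close>)
qed

lemma F_bounded_linear:
  assumes f: "bounded_borel f"
  shows "bounded_linear (F f)"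
proof -
  obtain K where "\<And>z. norm (f z) \<le> K" using f by (rule bounded_borelE) blast
  then show ?thesis
    using norm_F_le[OF f]
    by (intro bounded_linear_intro[of _ K])
      (auto simp: F_arg_add[OF f] F_arg_scaleC[OF f] scaleR_scaleC_l2 mult.commute)
qed

lemma F_cong_AE:
  assumes "bounded_borel f" "bounded_borel g" "AE z in mu x. f z = g z"
  shows "F f x = F g x"
proof -
  have "(norm (F (\<lambda>z. f z - g z) x))\<^sup>2 = (\<integral>z. 0 \<partial>mu x)"
    unfolding norm_F[OF bounded_borel_diff[OF assms(1,2)]]
    using assms by (intro integral_cong_AE) (auto simp: bounded_borel_def)
  then show ?thesis by (simp add: F_diff[OF assms(1,2)])
qed

lemma F_strong_lim:
  assumes u: "\<And>i. u i \<in> borel_measurable borel" "\<And>i z. norm (u i z) \<le> K" and f: "f \<in> borel_measurable borel"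
    and lim: "\<And>z. (\<lambda>i. u i z) \<longlonglongrightarrow> f z"
  shows "(\<lambda>i. F (u i) x) \<longlonglongrightarrow> F f x"
proof -
  have fK: "norm (f z) \<le> K" for z
    by (rule Lim_bounded[OF tendsto_norm[OF lim]]) (use u in auto)
  have b: "bounded_borel f" "bounded_borel (u i)" for i
    using u f fK by (auto intro: bounded_borelI[where K=K])
  have "(\<lambda>i. (norm (F (u i) x - F f x))\<^sup>2) \<longlonglongrightarrow> (\<integral>z. 0 \<partial>mu x)"
    unfolding F_diff[OF b(2) b(1), symmetric] norm_F[OF bounded_borel_diff[OF b(2) b(1)]]
  proof (rule integral_dominated_convergence[where w="\<lambda>_. (2 * K)\<^sup>2"])
    show "AE z in mu x. (\<lambda>i. (norm (u i z - f z))\<^sup>2) \<longlonglongrightarrow> 0"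
      using lim by (intro AE_I2) (auto intro!: tendsto_eq_intros simp: tendsto_norm_zero_iff LIM_zero_iff)
    have "norm (u i z - f z) \<le> 2 * K" for i z
      using norm_triangle_ineq4[of "u i z" "f z"] u(2)[of i z] fK[of z] by simp
    then show "AE z in mu x. norm ((norm (u i z - f z))\<^sup>2) \<le> (2 * K)\<^sup>2" for i
      unfolding real_norm_def abs_power2 by (intro AE_I2 power_mono norm_ge_zero)
  qed (use u f in \<open>auto intro: finite_measure.integrable_const finite_measure_mu\<close>)
  then have "(\<lambda>i. sqrt ((norm (F (u i) x - F f x))\<^sup>2)) \<longlonglongrightarrow> sqrt 0"
    by (intro tendsto_real_sqrt) simp
  then show ?thesis
    by (simp add: tendsto_norm_zero_iff LIM_zero_iff)
qed

lemma E_exhaust: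
  assumes "\<And>n. X n \<in> sets borel" "\<And>z. \<forall>\<^sub>F n in sequentially. z \<in> X n"
  shows "(\<lambda>n. E (X n) x) \<longlonglongrightarrow> x"
proof -
  have "(\<lambda>n. F (indicator (X n)) x) \<longlonglongrightarrow> F (indicator UNIV) x"
  proof (rule F_strong_lim[where K=1])
    fix z
    show "(\<lambda>n. indicator (X n) z :: complex) \<longlonglongrightarrow> indicator UNIV z"
      by (rule tendsto_eventually, rule eventually_mono[OF assms(2)[of z]]) simp
  qed (use assms in \<open>auto simp: indicator_def\<close>)
  moreover have "F (indicator UNIV) x = x" by (subst F_indicator) (auto simp: E_UNIV)
  ultimately show ?thesis using assms by (simp only: F_indicator)
qed

section \<open>Unbounded functional calculus\<close>

lemma bounded_borel_indicator_mult:
  assumes "\<phi> \<in> borel_measurable borel" "A \<in> sets borel" "bounded (\<phi> ` A)"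
  shows "bounded_borel (\<lambda>z. indicator A z * \<phi> z)"
proof -
  obtain K where K: "\<And>z. z \<in> A \<Longrightarrow> norm (\<phi> z) \<le> K"
    using assms(3) by (auto simp: bounded_iff)
  show ?thesis
  proof (rule bounded_borelI[of _ "max K 0"])
    show "norm (indicator A z * \<phi> z) \<le> max K 0" for z
      using K[of z] by (auto simp: indicator_def)
  qed (use assms in measurable)
qed

text \<open>The level sets of |\<phi>| increase to the whole plane, and \<open>cut\<close> restricts
  \<phi> to one of them: these are the bounded symbols through which the unbounded \<phi>(N) is
  reached.\<close>

definition lev :: "(complex \<Rightarrow> complex) \<Rightarrow> nat \<Rightarrow> complex set" where
  "lev \<phi> n = {z. norm (\<phi> z) \<le> real n}"

abbreviation cut :: "(complex \<Rightarrow> complex) \<Rightarrow> nat \<Rightarrow> complex \<Rightarrow> complex" where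
  "cut \<phi> n \<equiv> \<lambda>z. indicator (lev \<phi> n) z * \<phi> z"

lemma lev_sets [measurable]:
  assumes [measurable]: "\<phi> \<in> borel_measurable borel"
  shows "lev \<phi> n \<in> sets borel"
  unfolding lev_def by measurable

lemma bounded_lev: "bounded (\<phi> ` lev \<phi> n)"
  by (auto simp: bounded_iff lev_def)

lemma bounded_borel_cut: "\<phi> \<in> borel_measurable borel \<Longrightarrow> bounded_borel (cut \<phi> n)"
  by (intro bounded_borel_indicator_mult lev_sets bounded_lev)

lemma eventually_lev: "\<forall>\<^sub>F n in sequentially. z \<in> lev \<phi> n"
proof -
  obtain m where "norm (\<phi> z) \<le> real m" using real_arch_simple by blast
  have "\<forall>\<^sub>F n in sequentially. m \<le> n" by (rule eventually_ge_at_top)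
  then show ?thesis
  proof eventually_elim
    case (elim n)
    with \<open>norm (\<phi> z) \<le> real m\<close> show ?case by (simp add: lev_def)
  qed
qed

lemma cut_tendsto: "(\<lambda>n. cut \<phi> n z) \<longlonglongrightarrow> \<phi> z"
  by (rule tendsto_eventually, rule eventually_mono[OF eventually_lev[of z \<phi>]]) simp

lemma norm_cut_le: "norm (cut \<phi> n z) \<le> norm (\<phi> z)"
  by (auto simp: indicator_def)

text \<open>Monotone convergence over the level sets. In terms of norms of the linear maps F (cut
  \<phi> n) it becomes evident that the domain is a linear space, which the integral condition hides
  because \<open>mu x\<close> is not linear in x.\<close>

lemma calculus_domain_iff:
  assumes [measurable]: "\<phi> \<in> borel_measurable borel"
  shows "x \<in> calculus_domain E \<phi> \<longleftrightarrow> (\<exists>C. \<forall>n. norm (F (cut \<phi> n) x) \<le> C)"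
proof -
  have nn: "ennreal ((norm (F (cut \<phi> n) x))\<^sup>2) = (\<integral>\<^sup>+z. ennreal ((norm (cut \<phi> n z))\<^sup>2) \<partial>mu x)" for n
    using bounded_borel_cut[OF assms]
    by (subst nn_integral_eq_integral) (auto simp: norm_F intro: integrable_norm_power2)
  have sup: "(\<integral>\<^sup>+z. ennreal ((norm (\<phi> z))\<^sup>2) \<partial>mu x) = (SUP n. ennreal ((norm (F (cut \<phi> n) x))\<^sup>2))"
  proof -
    have inc: "incseq (\<lambda>n z. ennreal ((norm (cut \<phi> n z))\<^sup>2))"
      by (auto simp: incseq_def le_fun_def indicator_def lev_def)
    have "(SUP n. ennreal ((norm (cut \<phi> n z))\<^sup>2)) = ennreal ((norm (\<phi> z))\<^sup>2)" for z
    proof (rule LIMSEQ_unique)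
      show "(\<lambda>n. ennreal ((norm (cut \<phi> n z))\<^sup>2)) \<longlonglongrightarrow> (SUP n. ennreal ((norm (cut \<phi> n z))\<^sup>2))"
        using inc by (intro LIMSEQ_SUP) (auto simp: incseq_def le_fun_def)
      show "(\<lambda>n. ennreal ((norm (cut \<phi> n z))\<^sup>2)) \<longlonglongrightarrow> ennreal ((norm (\<phi> z))\<^sup>2)"
        by (intro tendsto_ennrealI tendsto_power tendsto_norm cut_tendsto)
    qed
    then have "(\<integral>\<^sup>+z. ennreal ((norm (\<phi> z))\<^sup>2) \<partial>mu x) = (\<integral>\<^sup>+z. (SUP n. ennreal ((norm (cut \<phi> n z))\<^sup>2)) \<partial>mu x)"
      by simp
    also have "\<dots> = (SUP n. (\<integral>\<^sup>+z. ennreal ((norm (cut \<phi> n z))\<^sup>2) \<partial>mu x))"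
      by (rule nn_integral_monotone_convergence_SUP[OF inc]) measurable
    finally show ?thesis by (simp only: nn)
  qed
  show ?thesis
  proof
    assume "x \<in> calculus_domain E \<phi>"
    then have "(SUP n. ennreal ((norm (F (cut \<phi> n) x))\<^sup>2)) < \<infinity>"
      by (simp add: calculus_domain_def sup)
    then obtain C where C: "C \<ge> 0" "(SUP n. ennreal ((norm (F (cut \<phi> n) x))\<^sup>2)) = ennreal C"
      unfolding infinity_ennreal_def less_top_ennreal by (elim exE conjE) (rule that)
    have "norm (F (cut \<phi> n) x) \<le> sqrt C" for n
    proof -
      have "ennreal ((norm (F (cut \<phi> n) x))\<^sup>2) \<le> ennreal C"
        unfolding C(2)[symmetric] by (rule SUP_upper) simp
      with C(1) show ?thesis by (intro real_le_rsqrt) simp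
    qed
    then show "\<exists>C. \<forall>n. norm (F (cut \<phi> n) x) \<le> C" by blast
  next
    assume "\<exists>C. \<forall>n. norm (F (cut \<phi> n) x) \<le> C"
    then obtain C where C: "\<And>n. norm (F (cut \<phi> n) x) \<le> C" by blast
    have "(SUP n. ennreal ((norm (F (cut \<phi> n) x))\<^sup>2)) \<le> ennreal (C\<^sup>2)"
      by (intro SUP_least ennreal_leI power_mono C) auto
    also have "\<dots> < \<infinity>" by simp
    finally show "x \<in> calculus_domain E \<phi>" by (simp add: calculus_domain_def sup)
  qed
qed

lemma calculus_domain_add:
  assumes \<phi>: "\<phi> \<in> borel_measurable borel" and "x \<in> calculus_domain E \<phi>" "y \<in> calculus_domain E \<phi>"
  shows "x + y \<in> calculus_domain E \<phi>"
proof -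
  obtain C D where CD: "norm (F (cut \<phi> n) x) \<le> C" "norm (F (cut \<phi> n) y) \<le> D" for n
    using assms by (auto simp: calculus_domain_iff)
  have "norm (F (cut \<phi> n) (x + y)) \<le> C + D" for n
    unfolding F_arg_add[OF bounded_borel_cut[OF \<phi>]] by (rule norm_triangle_mono) (rule CD)+
  then show ?thesis using \<phi> by (auto simp: calculus_domain_iff)
qed

lemma calculus_domain_scaleC:
  assumes \<phi>: "\<phi> \<in> borel_measurable borel" and "x \<in> calculus_domain E \<phi>"
  shows "c *\<^sub>C x \<in> calculus_domain E \<phi>"
proof -
  obtain C where C: "norm (F (cut \<phi> n) x) \<le> C" for n
    using assms by (auto simp: calculus_domain_iff)
  have "norm (F (cut \<phi> n) (c *\<^sub>C x)) \<le> norm c * C" for n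
    unfolding F_arg_scaleC[OF bounded_borel_cut[OF \<phi>]] norm_scaleC
    by (intro mult_left_mono C) auto
  then show ?thesis using \<phi> by (auto simp: calculus_domain_iff)
qed

lemma calculus_domain_pol:
  assumes "\<phi> \<in> borel_measurable borel" "x \<in> calculus_domain E \<phi>" "y \<in> calculus_domain E \<phi>"
  shows "pol k x y \<in> calculus_domain E \<phi>"
  unfolding pol_def by (intro calculus_domain_scaleC calculus_domain_add assms)

lemma integrable_calculus_domain:
  assumes [measurable]: "\<phi> \<in> borel_measurable borel" and "x \<in> calculus_domain E \<phi>"
  shows "integrable (mu x) \<phi>"
proof (rule Bochner_Integration.integrable_bound)
  have "integrable (mu x) (\<lambda>z. (norm (\<phi> z))\<^sup>2)"
    using assms(2) by (intro integrableI_bounded) (auto simp: calculus_domain_def)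
  then show "integrable (mu x) (\<lambda>z. 1 + (norm (\<phi> z))\<^sup>2)"
    by (intro Bochner_Integration.integrable_add finite_measure.integrable_const finite_measure_mu)
  have "a \<le> 1 + a\<^sup>2" for a :: real
    using sum_squares_bound[of 1 a] by (simp add: power2_eq_square) (smt (verit) mult_nonneg_nonneg zero_le_square)
  then show "AE z in mu x. norm (\<phi> z) \<le> norm (1 + (norm (\<phi> z))\<^sup>2)"
    by (intro AE_I2) auto
qed simp

lemma S_dominated:
  assumes \<phi>: "\<phi> \<in> borel_measurable borel" "x \<in> calculus_domain E \<phi>" "y \<in> calculus_domain E \<phi>"
    and u: "\<And>n. u n \<in> borel_measurable borel" "\<And>n z. norm (u n z) \<le> norm (\<phi> z)"
    and f: "f \<in> borel_measurable borel" "\<And>z. (\<lambda>n. u n z) \<longlonglongrightarrow> f z"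
  shows "(\<lambda>n. S (u n) x y) \<longlonglongrightarrow> S f x y"
  unfolding S_def
proof (intro tendsto_sum tendsto_mult tendsto_const)
  fix k
  show "(\<lambda>i. \<integral>z. u i z \<partial>mu (pol k x y)) \<longlonglongrightarrow> (\<integral>z. f z \<partial>mu (pol k x y))"
    by (rule integral_dominated_convergence[where w="\<lambda>z. norm (\<phi> z)"])
      (use u f integrable_calculus_domain[OF \<phi>(1) calculus_domain_pol[OF \<phi>]] in auto)
qed

text \<open>By polarization the real part of \<mu> is P 0 - P 2 and the imaginary part P 1 - P 3,
  with P k the spectral measure of \<open>pol k x y\<close> on \<Omega>. Allowing any Borel \<Omega>
  covers both the plane, as in \<open>calculus\<close>, and the sets \<open>omega\<close> of the
  truncated integrals.\<close>

lemma cm_integral_eq_S: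
  assumes \<phi>: "\<phi> \<in> borel_measurable borel" "x \<in> calculus_domain E \<phi>" "y \<in> calculus_domain E \<phi>"
    and \<Omega>: "\<Omega> \<in> sets borel" and M: "sets M = sets (restrict_space borel \<Omega>)"
    and \<mu>: "\<And>\<sigma>. \<sigma> \<in> sets M \<Longrightarrow> \<mu> \<sigma> = cinner (E \<sigma> x) y"
  shows "cm_integrable M \<mu> \<phi>" and "cm_integral M \<mu> \<phi> = S (\<lambda>z. indicator \<Omega> z * \<phi> z) x y"
proof -
  have M_iff: "\<sigma> \<in> sets M \<longleftrightarrow> \<sigma> \<subseteq> \<Omega> \<and> \<sigma> \<in> sets borel" for \<sigma>
    unfolding M using \<Omega> by (subst sets_restrict_space_iff) auto
  define P where "P k = restrict_space (mu (pol k x y)) \<Omega>" for k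
  have sets_P: "sets (P k) = sets M" for k
    unfolding P_def M by (rule sets_restrict_space_cong) simp
  have fin: "finite_measure (P k)" for k
    unfolding P_def using \<Omega> by (intro finite_measure_restrict_space finite_measure_mu) auto
  have meas_P: "measure (P k) \<sigma> = (norm (pol k (E \<sigma> x) (E \<sigma> y)))\<^sup>2" if "\<sigma> \<in> sets M" for k \<sigma>
    using that \<Omega> unfolding P_def M_iff by (subst measure_restrict_space) (auto simp: measure_mu E_pol)
  have int: "integrable (mu (pol k x y)) \<phi>" for k
    by (rule integrable_calculus_domain[OF \<phi>(1) calculus_domain_pol[OF \<phi>]])
  have int_P: "integrable (P k) \<phi>" for k
    unfolding P_def using \<Omega> int[of k]
    by (subst integrable_restrict_space) (auto intro!: integrable_mult_indicator)
  have integral_P: "integral\<^sup>L (P k) \<phi> = (\<integral>z. indicator \<Omega> z * \<phi> z \<partial>mu (pol k x y))" for k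
    unfolding P_def using \<Omega>
    by (subst integral_restrict_space) (auto intro!: Bochner_Integration.integral_cong simp: indicator_def)
  have \<mu>': "\<mu> \<sigma> = (\<Sum>k<4. \<i> ^ k * complex_of_real (measure (P k) \<sigma>))" if "\<sigma> \<in> sets M" for \<sigma>
  proof -
    have "\<mu> \<sigma> = cinner (E \<sigma> x) (E \<sigma> y)"
      using that \<mu> by (metis M_iff E_idem E_self_adjoint)
    then show ?thesis using that by (simp only: meas_P polarization)
  qed
  have Re: "Re (\<mu> \<sigma>) = measure (P 0) \<sigma> - measure (P 2) \<sigma>"
    and Im: "Im (\<mu> \<sigma>) = measure (P 1) \<sigma> - measure (P 3) \<sigma>" if "\<sigma> \<in> sets M" for \<sigma>
    unfolding \<mu>'[OF that] by (simp_all add: lessThan_Suc eval_nat_numeral)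
  have cm: "complex_measure M \<mu>"
    unfolding complex_measure_def
  proof (intro allI impI)
    fix A :: "nat \<Rightarrow> complex set" assume A: "range A \<subseteq> sets M" "disjoint_family A"
    have "(\<lambda>n. cinner (E (A n) x) y) sums cinner (E (\<Union>n. A n) x) y"
      using A M_iff by (intro bounded_linear.sums[OF cinner.bounded_linear_left] E_sums) auto
    moreover have "(\<Union>n. A n) \<in> sets M" using A(1) by auto
    ultimately show "(\<lambda>n. \<mu> (A n)) sums \<mu> (\<Union>n. A n)" using A(1) by (simp add: \<mu> range_subsetD)
  qed
  note R = pos_variation_integral[where \<mu> = "\<lambda>A. Re (\<mu> A)" and P = "P 0" and Q = "P 2",
      OF fin fin sets_P sets_P Re int_P int_P]
  note I = pos_variation_integral[where \<mu> = "\<lambda>A. Im (\<mu> A)" and P = "P 1" and Q = "P 3",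
      OF fin fin sets_P sets_P Im int_P int_P]
  show "cm_integrable M \<mu> \<phi>"
    unfolding cm_integrable_def using cm R(1,2) I(1,2) by simp
  have "cm_integral M \<mu> \<phi> = (integral\<^sup>L (P 0) \<phi> - integral\<^sup>L (P 2) \<phi>) + \<i> * (integral\<^sup>L (P 1) \<phi> - integral\<^sup>L (P 3) \<phi>)"
    using R(3) I(3) by (simp add: cm_integral_def)
  also have "\<dots> = S (\<lambda>z. indicator \<Omega> z * \<phi> z) x y"
    unfolding S_def integral_P by (simp add: lessThan_Suc eval_nat_numeral algebra_simps)
  finally show "cm_integral M \<mu> \<phi> = S (\<lambda>z. indicator \<Omega> z * \<phi> z) x y" .
qed

lemma calculus_iff_S:
  assumes \<phi>: "\<phi> \<in> borel_measurable borel"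
  shows "(x, y) \<in> calculus E \<phi> \<longleftrightarrow>
    x \<in> calculus_domain E \<phi> \<and> (\<forall>g\<in>calculus_domain E \<phi>. cinner y g = S \<phi> x g)"
proof -
  have sets: "sets borel = sets (restrict_space borel (UNIV :: complex set))"
    by (auto simp: sets_restrict_space)
  have "cm_integral borel (\<lambda>A. cinner (E A x) g) \<phi> = S \<phi> x g"
    if "x \<in> calculus_domain E \<phi>" "g \<in> calculus_domain E \<phi>" for g
    using cm_integral_eq_S(2)[OF \<phi> that _ sets refl] by simp
  then show ?thesis by (auto simp: calculus_def)
qed

section \<open>Membership in the graph of \<phi>(N) by truncation\<close>

lemma F_indicator_mult:
  assumes "A \<in> sets borel" "bounded_borel f"
  shows "F (\<lambda>z. indicator A z * f z) x = E A (F f x)" "F (\<lambda>z. indicator A z * f z) x = F f (E A x)"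
  using assms F_mult[OF bounded_borel_indicator[OF assms(1)] assms(2)] F_indicator[OF assms(1)]
    F_mult_indicator[OF assms(2,1)]
  by (simp_all add: mult.commute)

lemma E_in_calculus_domain:
  assumes \<phi>: "\<phi> \<in> borel_measurable borel" and A: "A \<in> sets borel" "bounded (\<phi> ` A)"
  shows "E A x \<in> calculus_domain E \<phi>"
proof -
  obtain K where K: "\<And>z. norm (indicator A z * \<phi> z) \<le> K"
    using bounded_borel_indicator_mult[OF assms] by (rule bounded_borelE) blast
  have "norm (F (cut \<phi> n) (E A x)) \<le> K * norm x" for n
    unfolding F_indicator_mult(2)[OF A(1) bounded_borel_cut[OF \<phi>], symmetric]
  proof (rule norm_F_le)
    show "bounded_borel (\<lambda>z. indicator A z * cut \<phi> n z)"
      using \<phi> A by (intro bounded_borel_mult bounded_borel_cut bounded_borel_indicator)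
    show "norm (indicator A z * cut \<phi> n z) \<le> K" for z
      using K[of z] order_trans[OF norm_ge_zero K] by (auto simp: indicator_def)
  qed
  then show ?thesis using \<phi> by (auto simp: calculus_domain_iff)
qed

text \<open>Testing y against E A g, which lies in the domain since \<phi> is bounded on A, reduces
  the defining identity to symbols supported on A; there the truncations of \<phi> are eventually
  equal to \<phi>.\<close>

lemma calculus_imp_F:
  assumes \<phi>: "\<phi> \<in> borel_measurable borel" and xy: "(x, y) \<in> calculus E \<phi>"
    and A: "A \<in> sets borel" "bounded (\<phi> ` A)"
  shows "E A y = F (\<lambda>z. indicator A z * \<phi> z) x"
proof (rule l2_eq_cinnerI)
  fix g
  have xd: "x \<in> calculus_domain E \<phi>" and y: "\<And>g. g \<in> calculus_domain E \<phi> \<Longrightarrow> cinner y g = S \<phi> x g"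
    using xy \<phi> by (auto simp: calculus_iff_S)
  have gd: "E A g \<in> calculus_domain E \<phi>" using \<phi> A by (rule E_in_calculus_domain)
  have "cinner (E A y) g = S \<phi> x (E A g)"
    using y[OF gd] A by (simp add: E_self_adjoint)
  also have "S \<phi> x (E A g) = cinner (F (\<lambda>z. indicator A z * \<phi> z) x) g"
  proof (rule LIMSEQ_unique)
    show "(\<lambda>n. S (cut \<phi> n) x (E A g)) \<longlonglongrightarrow> S \<phi> x (E A g)"
      by (rule S_dominated[OF \<phi> xd gd])
        (use \<phi> in \<open>auto simp: norm_cut_le cut_tendsto bounded_borel_measurable bounded_borel_cut\<close>)
    obtain K where K: "\<And>z. z \<in> A \<Longrightarrow> norm (\<phi> z) \<le> K" using A(2) by (auto simp: bounded_iff)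
    obtain m where m: "K \<le> real m" using real_arch_simple by blast
    have "\<forall>\<^sub>F n in sequentially. S (cut \<phi> n) x (E A g) = cinner (F (\<lambda>z. indicator A z * \<phi> z) x) g"
      using eventually_ge_at_top[of m]
    proof eventually_elim
      case (elim n)
      have "S (cut \<phi> n) x (E A g) = cinner (F (\<lambda>z. indicator A z * cut \<phi> n z) x) g"
        using A(1) bounded_borel_cut[OF \<phi>] by (simp add: F_indicator_mult(1) E_self_adjoint cinner_F)
      also have "(\<lambda>z. indicator A z * cut \<phi> n z) = (\<lambda>z. indicator A z * \<phi> z)"
        using K m elim by (fastforce simp: indicator_def lev_def)
      finally show ?case .
    qed
    then show "(\<lambda>n. S (cut \<phi> n) x (E A g)) \<longlonglongrightarrow> cinner (F (\<lambda>z. indicator A z * \<phi> z) x) g"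
      by (rule tendsto_eventually)
  qed
  finally show "cinner (E A y) g = cinner (F (\<lambda>z. indicator A z * \<phi> z) x) g" .
qed

lemma norm_E_le:
  assumes "A \<in> sets borel"
  shows "norm (E A x) \<le> norm x"
proof -
  have "norm (F (indicator A) x) \<le> 1 * norm x"
    using assms by (intro norm_F_le bounded_borel_indicator) (auto simp: indicator_def)
  then show ?thesis using assms by (simp only: F_indicator mult_1_left)
qed

text \<open>Converse of \<open>calculus_imp_F\<close> on the level sets: the norm of F (cut \<phi>
  n) x is at most that of y, which puts x into the domain, and E (lev \<phi> n) y tends to y, which
  identifies the image. Together the two replace integrals by identities between bounded
  operators.\<close>

lemma calculus_cutI:
  assumes \<phi>: "\<phi> \<in> borel_measurable borel" and eq: "\<And>n. E (lev \<phi> n) y = F (cut \<phi> n) x"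
  shows "(x, y) \<in> calculus E \<phi>"
proof -
  have "norm (F (cut \<phi> n) x) \<le> norm y" for n
    using eq[of n] norm_E_le[OF lev_sets[OF \<phi>]] by metis
  then have xd: "x \<in> calculus_domain E \<phi>" using \<phi> by (auto simp: calculus_domain_iff)
  moreover have "cinner y g = S \<phi> x g" if g: "g \<in> calculus_domain E \<phi>" for g
  proof (rule LIMSEQ_unique)
    show "(\<lambda>n. S (cut \<phi> n) x g) \<longlonglongrightarrow> S \<phi> x g"
      by (rule S_dominated[OF \<phi> xd g])
        (use \<phi> in \<open>auto simp: norm_cut_le cut_tendsto bounded_borel_measurable bounded_borel_cut\<close>)
    have "S (cut \<phi> n) x g = cinner (E (lev \<phi> n) y) g" for n
      using bounded_borel_cut[OF \<phi>] by (simp add: eq cinner_F)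
    then show "(\<lambda>n. S (cut \<phi> n) x g) \<longlonglongrightarrow> cinner y g"
      using E_exhaust[of "lev \<phi>" y] \<phi> eventually_lev by (simp add: cinner.tendsto)
  qed
  ultimately show ?thesis using \<phi> by (simp add: calculus_iff_S)
qed

text \<open>The exhausting sets may differ from the level sets of \<phi>, which allows two symbols
  to be compared on the same sets. Spectral projections commute, so each level set can be tested
  after cutting by \<open>X n\<close>, and then n tends to infinity.\<close>

lemma calculus_exhaustI:
  assumes \<phi>: "\<phi> \<in> borel_measurable borel"
    and X: "\<And>n. X n \<in> sets borel" "\<And>z. \<forall>\<^sub>F n in sequentially. z \<in> X n" "\<And>n. bounded (\<phi> ` X n)"
    and eq: "\<And>n. E (X n) y = F (\<lambda>z. indicator (X n) z * \<phi> z) x"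
  shows "(x, y) \<in> calculus E \<phi>"
proof (rule calculus_cutI[OF \<phi>])
  fix m :: nat
  let ?A = "lev \<phi> m"
  have "E (X n) (E ?A y) = E (X n) (F (cut \<phi> m) x)" for n
  proof -
    have "E (X n) (E ?A y) = E ?A (E (X n) y)"
      using X(1)[of n] lev_sets[OF \<phi>, of m] by (metis E_Int Int_commute)
    also have "\<dots> = F (\<lambda>z. indicator ?A z * (indicator (X n) z * \<phi> z)) x"
      unfolding eq
      by (rule F_indicator_mult(1)[symmetric, OF lev_sets[OF \<phi>] bounded_borel_indicator_mult[OF \<phi> X(1,3)]])
    also have "\<dots> = F (\<lambda>z. indicator (X n) z * cut \<phi> m z) x"
      by (simp only: mult.left_commute)
    finally show ?thesis by (simp add: F_indicator_mult(1) X bounded_borel_cut \<phi>)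
  qed
  then have "(\<lambda>n. E (X n) (E ?A y)) \<longlonglongrightarrow> F (cut \<phi> m) x"
    using E_exhaust[OF X(1,2), of "F (cut \<phi> m) x"] by simp
  with E_exhaust[OF X(1,2)] show "E ?A y = F (cut \<phi> m) x"
    by (rule LIMSEQ_unique)
qed

lemma calculus_bounded_iff:
  assumes "bounded_borel \<phi>"
  shows "(x, y) \<in> calculus E \<phi> \<longleftrightarrow> y = F \<phi> x"
proof
  have \<phi>: "\<phi> \<in> borel_measurable borel" "bounded (range \<phi>)" using assms by (auto simp: bounded_borel_def)
  show "(x, y) \<in> calculus E \<phi> \<Longrightarrow> y = F \<phi> x"
    using calculus_imp_F[OF \<phi>(1), of x y UNIV] \<phi> by (simp add: E_UNIV)
  show "y = F \<phi> x \<Longrightarrow> (x, y) \<in> calculus E \<phi>"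
    using \<phi> by (intro calculus_exhaustI[of _ "\<lambda>_. UNIV"]) (auto simp: E_UNIV)
qed

text \<open>A source of vectors in the domain: if w compensates the growth of \<phi>, then F w x is
  in the domain of \<phi>(N) whatever x is. With \<phi>(z) = z it puts vectors into the range of N,
  so that their values can be read off from the kernel.\<close>

lemma calculus_F_range:
  assumes \<phi>: "\<phi> \<in> borel_measurable borel" and w: "bounded_borel w" "bounded_borel (\<lambda>z. \<phi> z * w z)"
  shows "(F w x, F (\<lambda>z. \<phi> z * w z) x) \<in> calculus E \<phi>"
proof (rule calculus_cutI[OF \<phi>])
  fix n
  have "E (lev \<phi> n) (F (\<lambda>z. \<phi> z * w z) x) = F (\<lambda>z. cut \<phi> n z * w z) x"
    using F_indicator_mult(1)[OF lev_sets[OF \<phi>] w(2), of n x] by (simp add: mult.assoc)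
  also have "\<dots> = F (cut \<phi> n) (F w x)"
    by (rule F_mult[OF bounded_borel_cut[OF \<phi>] w(1)])
  finally show "E (lev \<phi> n) (F (\<lambda>z. \<phi> z * w z) x) = F (cut \<phi> n) (F w x)" .
qed

lemma calculus_F:
  assumes \<phi>: "\<phi> \<in> borel_measurable borel" and w: "bounded_borel w" and xy: "(x, y) \<in> calculus E \<phi>"
  shows "(F w x, F w y) \<in> calculus E \<phi>"
proof (rule calculus_cutI[OF \<phi>])
  fix n
  note L = lev_sets[OF \<phi>, of n]
  have "E (lev \<phi> n) (F w y) = F w (E (lev \<phi> n) y)"
    using F_indicator_mult[OF L w] by metis
  also have "\<dots> = F w (F (cut \<phi> n) x)"
    by (simp only: calculus_imp_F[OF \<phi> xy L bounded_lev])
  also have "\<dots> = F (cut \<phi> n) (F w x)"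
    using F_mult[OF w bounded_borel_cut[OF \<phi>]] F_mult[OF bounded_borel_cut[OF \<phi>] w]
    by (simp add: mult.commute)
  finally show "E (lev \<phi> n) (F w y) = F (cut \<phi> n) (F w x)" .
qed

lemma linear_operator_calculus:
  assumes \<phi>: "\<phi> \<in> borel_measurable borel"
  shows "linear_operator (calculus E \<phi>)"
proof -
  note b = bounded_borel_cut[OF \<phi>] and L = lev_sets[OF \<phi>]
  have D: "E (lev \<phi> n) y = F (cut \<phi> n) x" if "(x, y) \<in> calculus E \<phi>" for x y n
    by (rule calculus_imp_F[OF \<phi> that L bounded_lev])
  have "y = y'" if "(x, y) \<in> calculus E \<phi>" "(x, y') \<in> calculus E \<phi>" for x y y'
  proof (rule LIMSEQ_unique)
    show "(\<lambda>n. E (lev \<phi> n) y) \<longlonglongrightarrow> y" by (rule E_exhaust[OF L eventually_lev])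
    have "(\<lambda>n. E (lev \<phi> n) y') \<longlonglongrightarrow> y'" by (rule E_exhaust[OF L eventually_lev])
    then show "(\<lambda>n. E (lev \<phi> n) y) \<longlonglongrightarrow> y'" by (simp only: D[OF that(1)] D[OF that(2)])
  qed
  then have "single_valued (calculus E \<phi>)" by (auto simp: single_valued_def)
  moreover have "(0, 0) \<in> calculus E \<phi>"
    using linear_0[OF bounded_linear.linear[OF E_bounded_linear[OF L]]]
      linear_0[OF bounded_linear.linear[OF F_bounded_linear[OF b]]]
    by (intro calculus_cutI \<phi>) simp
  moreover have "(x + x', y + y') \<in> calculus E \<phi>"
    if "(x, y) \<in> calculus E \<phi>" "(x', y') \<in> calculus E \<phi>" for x y x' y'
    using D[OF that(1)] D[OF that(2)] by (intro calculus_cutI \<phi>) (simp add: E_add L F_arg_add b)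
  moreover have "(c *\<^sub>C x, c *\<^sub>C y) \<in> calculus E \<phi>" if "(x, y) \<in> calculus E \<phi>" for c x y
    using D[OF that] by (intro calculus_cutI \<phi>) (simp add: E_scaleC L F_arg_scaleC b)
  ultimately show ?thesis by (auto simp: linear_operator_def)
qed

lemma calculus_E_lev:
  assumes \<phi>: "\<phi> \<in> borel_measurable borel"
  shows "(E (lev \<phi> n) x, F (cut \<phi> n) x) \<in> calculus E \<phi>"
  using calculus_F_range[OF \<phi> bounded_borel_indicator[OF lev_sets[OF \<phi>]], of n x] bounded_borel_cut[OF \<phi>, of n]
  by (simp add: F_indicator lev_sets \<phi> mult.commute)

lemma densely_defined_calculus:
  assumes \<phi>: "\<phi> \<in> borel_measurable borel"
  shows "densely_defined (calculus E \<phi>)"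
proof -
  have "x \<in> closure (Domain (calculus E \<phi>))" for x
    unfolding closure_sequential
  proof (intro exI conjI allI)
    show "E (lev \<phi> n) x \<in> Domain (calculus E \<phi>)" for n
      by (rule DomainI) (rule calculus_E_lev[OF \<phi>])
    show "(\<lambda>n. E (lev \<phi> n) x) \<longlonglongrightarrow> x"
      by (rule E_exhaust[OF lev_sets[OF \<phi>] eventually_lev])
  qed
  then show ?thesis by (auto simp: densely_defined_def)
qed

text \<open>Both inclusions are checked on the level sets, which \<phi> and its conjugate share. The
  pairs (E (lev \<phi> n) x, F (cut \<phi> n) x) with arbitrary x are enough tests to recover the
  truncations of an adjoint pair.\<close>

lemma adjoint_calculus:
  assumes \<phi>[measurable]: "\<phi> \<in> borel_measurable borel"
  shows "adjoint_op (calculus E \<phi>) = calculus E (\<lambda>z. cnj (\<phi> z))"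
proof -
  let ?\<psi> = "\<lambda>z. cnj (\<phi> z)"
  have \<psi>: "?\<psi> \<in> borel_measurable borel" by measurable
  have lev: "lev ?\<psi> n = lev \<phi> n" for n by (simp add: lev_def)
  have cnj_cut: "(\<lambda>z. cnj (cut \<phi> n z)) = cut ?\<psi> n" for n
    by (auto simp: lev indicator_def)
  note L = lev_sets[OF \<phi>]
  have "(g, h) \<in> adjoint_op (calculus E \<phi>) \<longleftrightarrow> (g, h) \<in> calculus E ?\<psi>" for g h
  proof
    assume "(g, h) \<in> adjoint_op (calculus E \<phi>)"
    then have adj: "cinner y g = cinner x h" if "(x, y) \<in> calculus E \<phi>" for x y
      using that by (auto simp: adjoint_op_def)
    show "(g, h) \<in> calculus E ?\<psi>"
    proof (rule calculus_cutI[OF \<psi>])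
      fix n
      have "cinner x (E (lev \<phi> n) h) = cinner x (F (cut ?\<psi> n) g)" for x
        using adj[OF calculus_E_lev[OF \<phi>, of n x]] F_adjoint[OF bounded_borel_cut[OF \<phi>], of n x g]
        unfolding cnj_cut by (simp add: E_self_adjoint L)
      then have "E (lev \<phi> n) h = F (cut ?\<psi> n) g"
        by (metis cinner_commute l2_eq_cinnerI)
      then show "E (lev ?\<psi> n) h = F (cut ?\<psi> n) g" by (simp add: lev)
    qed
  next
    assume gh: "(g, h) \<in> calculus E ?\<psi>"
    have "cinner y g = cinner x h" if xy: "(x, y) \<in> calculus E \<phi>" for x y
    proof (rule LIMSEQ_unique)
      have "cinner (E (lev \<phi> n) y) g = cinner x (E (lev \<phi> n) h)" for n
      proof -
        have "E (lev \<phi> n) y = F (cut \<phi> n) x"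
          by (rule calculus_imp_F[OF \<phi> xy L bounded_lev])
        moreover have "E (lev \<phi> n) h = F (cut ?\<psi> n) g"
          using calculus_imp_F[OF \<psi> gh lev_sets[OF \<psi>] bounded_lev, of n] by (simp add: lev)
        ultimately show ?thesis
          using F_adjoint[OF bounded_borel_cut[OF \<phi>], of n x g] unfolding cnj_cut by simp
      qed
      then show "(\<lambda>n. cinner (E (lev \<phi> n) y) g) \<longlonglongrightarrow> cinner x h"
        using E_exhaust[OF L eventually_lev, of h] by (simp add: cinner.tendsto)
      show "(\<lambda>n. cinner (E (lev \<phi> n) y) g) \<longlonglongrightarrow> cinner y g"
        using E_exhaust[OF L eventually_lev, of y] by (simp add: cinner.tendsto)
    qed
    then show "(g, h) \<in> adjoint_op (calculus E \<phi>)" by (auto simp: adjoint_op_def)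
  qed
  then show ?thesis by auto
qed

text \<open>The identity \<phi>(N) = N v(N), domains included. Discs about 0 exhaust the plane and
  both symbols are bounded on them, so membership on either side amounts to the same system of
  truncated identities.\<close>

lemma calculus_id_mult_iff:
  assumes v: "bounded_borel v" and \<phi>: "\<And>z. \<phi> z = z * v z"
  shows "(f, g) \<in> calculus E \<phi> \<longleftrightarrow> (F v f, g) \<in> calculus E (\<lambda>z. z)"
proof -
  obtain K where K: "v \<in> borel_measurable borel" "\<And>z. norm (v z) \<le> K" "K \<ge> 0"
    using v by (rule bounded_borelE) (rule that)
  have \<phi>_eq: "\<phi> = (\<lambda>z. z * v z)" using \<phi> by auto
  have \<phi>m: "\<phi> \<in> borel_measurable borel" unfolding \<phi>_eq using K by measurable
  have id: "(\<lambda>z. z) \<in> borel_measurable (borel :: complex measure)" by simp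
  let ?B = "\<lambda>n. lev (\<lambda>z. z) n"
  have bd: "bounded (\<phi> ` ?B n)" for n
  proof -
    have "norm (\<phi> z) \<le> real n * K" if "z \<in> ?B n" for z
      unfolding \<phi> norm_mult using that K by (intro mult_mono) (auto simp: lev_def)
    then show ?thesis by (auto simp: bounded_iff)
  qed
  have F_eq: "F (\<lambda>z. indicator (?B n) z * \<phi> z) f = F (cut (\<lambda>z. z) n) (F v f)" for n
    using F_mult[OF bounded_borel_cut[OF id] v, of n f] by (simp add: \<phi> mult.assoc)
  show ?thesis
  proof
    assume fg: "(f, g) \<in> calculus E \<phi>"
    show "(F v f, g) \<in> calculus E (\<lambda>z. z)"
      using calculus_imp_F[OF \<phi>m fg lev_sets[OF id] bd] by (intro calculus_cutI id) (simp add: F_eq)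
  next
    assume fg: "(F v f, g) \<in> calculus E (\<lambda>z. z)"
    show "(f, g) \<in> calculus E \<phi>"
      using calculus_imp_F[OF id fg lev_sets[OF id] bounded_lev]
      by (intro calculus_exhaustI[OF \<phi>m lev_sets[OF id] eventually_lev bd]) (simp add: F_eq)
  qed
qed

section \<open>The spectral measure is carried by the spectrum\<close>

text \<open>On the range of E (ball z0 r) the operator N - z0 has norm at most r, while its inverse
  R has norm at most K; once r K = 1/2, that range must be 0.\<close>

lemma E_ball_resolvent:
  assumes "z0 \<in> resolvent_set (calculus E (\<lambda>z. z))"
  shows "\<exists>r>0. \<forall>x. E (ball z0 r) x = 0"
proof -
  obtain R where R: "bounded_linear R"
    "{(y - z0 *\<^sub>C x, x) | x y. (x, y) \<in> calculus E (\<lambda>z. z)} = {(w, R w) | w. True}"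
    using assms by (auto simp: resolvent_set_def)
  obtain K where K: "K > 0" "\<And>w. norm (R w) \<le> norm w * K"
    using bounded_linear.pos_bounded[OF R(1)] by blast
  define r where "r = 1 / (2 * K)"
  have r: "r > 0" "r * K = 1/2" using K(1) by (auto simp: r_def)
  have B: "ball z0 r \<in> sets borel" by simp
  let ?i = "\<lambda>z. indicator (ball z0 r) z :: complex"
  have b: "bounded_borel (\<lambda>z. z * ?i z)"
  proof -
    have "bounded_borel (\<lambda>z. ?i z * z)"
      using bounded_subset[OF bounded_ball[of z0 r]] by (intro bounded_borel_indicator_mult) auto
    then show ?thesis by (simp add: mult.commute)
  qed
  have bi: "bounded_borel ?i" by (rule bounded_borel_indicator[OF B])
  have "E (ball z0 r) x = 0" for x
  proof -
    define x' where "x' = E (ball z0 r) x"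
    have x': "F ?i x' = x'" using B by (simp add: x'_def F_indicator E_idem)
    have "(F ?i x', F (\<lambda>z. z * ?i z) x') \<in> calculus E (\<lambda>z. z)"
      by (rule calculus_F_range[OF _ bi b]) simp
    then have "(F (\<lambda>z. z * ?i z) x' - z0 *\<^sub>C x', x') \<in> {(w, R w) | w. True}"
      unfolding R(2)[symmetric] x' by blast
    then have "x' = R (F (\<lambda>z. z * ?i z) x' - z0 *\<^sub>C x')" by auto
    also have "F (\<lambda>z. z * ?i z) x' - z0 *\<^sub>C x' = F (\<lambda>z. z * ?i z - z0 * ?i z) x'"
      by (simp only: F_diff[OF b bounded_borel_cmult[OF bi]] F_cmult[OF bi] x')
    finally have "norm x' \<le> norm (F (\<lambda>z. z * ?i z - z0 * ?i z) x') * K"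
      using K(2) by metis
    also have "\<dots> \<le> r * norm x' * K"
    proof (intro mult_right_mono norm_F_le)
      show "bounded_borel (\<lambda>z. z * ?i z - z0 * ?i z)"
        by (intro bounded_borel_diff b bounded_borel_cmult bi)
      show "norm (z * ?i z - z0 * ?i z) \<le> r" for z
        using r(1) by (auto simp: indicator_def dist_norm norm_minus_commute)
    qed (use K in auto)
    also have "\<dots> = norm x' / 2" using r(2) by (simp add: mult.commute mult.left_commute)
    finally show ?thesis by (simp add: x'_def)
  qed
  with r(1) show ?thesis by blast
qed

lemma E_Union_zero:
  assumes "countable \<G>" "\<And>A. A \<in> \<G> \<Longrightarrow> A \<in> sets borel \<and> E A x = 0"
  shows "E (\<Union>\<G>) x = 0"
proof -
  have "\<Union>\<G> \<in> sets borel" using assms by auto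
  moreover have "(\<Union>A\<in>\<G>. A) \<in> null_sets (mu x)"
    using assms by (intro null_sets_UN') (auto simp: null_sets_def emeasure_mu)
  ultimately show ?thesis using emeasure_mu[of "\<Union>\<G>" x] by (simp add: null_sets_def)
qed

text \<open>Every point of the resolvent set lies in an open set on which E vanishes. Such sets may
  form an uncountable family; Lindelof's theorem replaces its union by a countable one, which is
  still null.\<close>

lemma AE_spectrum:
  assumes "\<And>z. z \<in> spectrum (calculus E (\<lambda>z. z)) \<Longrightarrow> P z"
  shows "AE z in mu x. P z"
proof -
  define \<G> where "\<G> = {B. open B \<and> (\<forall>x. E B x = 0)}"
  obtain \<G>' where G': "\<G>' \<subseteq> \<G>" "countable \<G>'" "\<Union>\<G>' = \<Union>\<G>"
    using Lindelof[of \<G>] by (auto simp: \<G>_def)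
  have "E (\<Union>\<G>') x = 0"
    using G' by (intro E_Union_zero) (auto simp: \<G>_def)
  moreover have "\<Union>\<G>' \<in> sets borel"
    using G'(1) by (intro borel_open open_Union) (auto simp: \<G>_def)
  moreover have "P z" if "z \<notin> \<Union>\<G>'" for z
  proof (rule assms, rule ccontr)
    assume "z \<notin> spectrum (calculus E (\<lambda>z. z))"
    then obtain r where "r > 0" "\<forall>x. E (ball z r) x = 0"
      using E_ball_resolvent[of z] by (auto simp: spectrum_def)
    then have "ball z r \<in> \<G>" "z \<in> ball z r" by (auto simp: \<G>_def)
    with that G' show False by blast
  qed
  ultimately show ?thesis by (intro AE_muI)
qed

end

section \<open>Functions vanishing at infinity\<close>

lemma C0_onE:
  assumes "C0_on X f" "\<epsilon> > 0"
  obtains C where "compact C" "C \<subseteq> X" "\<And>x. x \<in> X \<Longrightarrow> x \<notin> C \<Longrightarrow> norm (f x) < \<epsilon>"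
proof -
  have "\<exists>C. compact C \<and> C \<subseteq> X \<and> (\<forall>x\<in>X - C. norm (f x) < \<epsilon>)"
    using assms by (simp add: C0_on_def)
  then obtain C where "compact C" "C \<subseteq> X" "\<forall>x\<in>X - C. norm (f x) < \<epsilon>" by (elim exE conjE)
  then show ?thesis by (intro that[of C]) auto
qed

lemma C0_onI:
  assumes "continuous_on X f"
    and "\<And>\<epsilon>. \<epsilon> > 0 \<Longrightarrow> \<exists>C. compact C \<and> C \<subseteq> X \<and> (\<forall>x\<in>X - C. norm (f x) < \<epsilon>)"
  shows "C0_on X f"
  using assms by (simp add: C0_on_def)

lemma C0_on_bounded_linear:
  assumes "bounded_linear f" "C0_on X g"
  shows "C0_on X (\<lambda>x. f (g x))"
  proof (rule C0_onI)
  show "continuous_on X (\<lambda>x. f (g x))"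
    using assms by (auto simp: C0_on_def intro: bounded_linear.continuous_on)
  fix \<epsilon> :: real assume "\<epsilon> > 0"
  obtain K where K: "K > 0" "\<And>y. norm (f y) \<le> norm y * K"
    using bounded_linear.pos_bounded[OF assms(1)] by blast
  have "\<epsilon> / K > 0" using K \<open>\<epsilon> > 0\<close> by simp
  then obtain C where C: "compact C" "C \<subseteq> X" "\<And>x. x \<in> X \<Longrightarrow> x \<notin> C \<Longrightarrow> norm (g x) < \<epsilon> / K"
    using C0_onE[OF assms(2)] by metis
  have "norm (f (g x)) < \<epsilon>" if "x \<in> X - C" for x
    using K(2)[of "g x"] C(3)[of x] that K(1) by (simp add: pos_less_divide_eq)
  with C(1,2) show "\<exists>C. compact C \<and> C \<subseteq> X \<and> (\<forall>x\<in>X - C. norm (f (g x)) < \<epsilon>)"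
    by (intro exI[of _ C]) simp
qed

lemma C0_on_bounded:
  assumes "C0_on X f"
  obtains B where "B > 0" "\<And>x. x \<in> X \<Longrightarrow> norm (f x) \<le> B"
proof -
  obtain C where C: "compact C" "C \<subseteq> X" "\<And>x. x \<in> X \<Longrightarrow> x \<notin> C \<Longrightarrow> norm (f x) < 1"
    using C0_onE[OF assms zero_less_one] by metis
  have "compact (f ` C)"
    using assms C by (intro compact_continuous_image) (auto simp: C0_on_def intro: continuous_on_subset)
  then obtain B where B: "B > 0" "\<And>y. y \<in> f ` C \<Longrightarrow> norm y \<le> B"
    using compact_imp_bounded bounded_pos by metis
  have "norm (f x) \<le> max B 1" if "x \<in> X" for x
    using B(2)[of "f x"] C(3)[of x] that by (cases "x \<in> C") auto
  with B(1) show ?thesis by (intro that[of "max B 1"]) auto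
qed

lemma C0_on_cinner:
  assumes f: "C0_on half_line f" and g: "C0_on half_line g"
  shows "C0_on (half_line \<times> half_line) (\<lambda>(s, t). cinner (f t) (g s))"
  proof (rule C0_onI)
  have "continuous_on (half_line \<times> half_line) (\<lambda>x::real\<times>real. f (snd x))"
    "continuous_on (half_line \<times> half_line) (\<lambda>x::real\<times>real. g (fst x))"
    using f g by (auto simp: C0_on_def intro!: continuous_on_compose2[of half_line f]
        continuous_on_compose2[of half_line g] continuous_intros)
  then show "continuous_on (half_line \<times> half_line) (\<lambda>(s, t). cinner (f t) (g s))"
    unfolding case_prod_unfold by (rule bounded_bilinear.continuous_on[OF bounded_bilinear_cinner])
  fix \<epsilon> :: real assume "\<epsilon> > 0"
  obtain A where A: "A > 0" "\<And>x. x \<in> half_line \<Longrightarrow> norm (f x) \<le> A" using f by (rule C0_on_bounded) blast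
  obtain B where B: "B > 0" "\<And>x. x \<in> half_line \<Longrightarrow> norm (g x) \<le> B" using g by (rule C0_on_bounded) blast
  have "\<epsilon> / B > 0" "\<epsilon> / A > 0" using \<open>\<epsilon> > 0\<close> A B by auto
  obtain C where C: "compact C" "C \<subseteq> half_line"
    "\<And>x. x \<in> half_line \<Longrightarrow> x \<notin> C \<Longrightarrow> norm (f x) < \<epsilon> / B"
    using C0_onE[OF f \<open>\<epsilon> / B > 0\<close>] by metis
  obtain D where D: "compact D" "D \<subseteq> half_line"
    "\<And>x. x \<in> half_line \<Longrightarrow> x \<notin> D \<Longrightarrow> norm (g x) < \<epsilon> / A"
    using C0_onE[OF g \<open>\<epsilon> / A > 0\<close>] by metis
  have "norm (cinner (f t) (g s)) < \<epsilon>" if st: "s \<ge> 0" "t \<ge> 0" "s \<notin> D \<or> t \<notin> C" for s t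
  proof -
    have "norm (f t) * norm (g s) < \<epsilon>"
    proof (cases "s \<in> D")
      case False
      have "norm (f t) * norm (g s) \<le> A * norm (g s)"
        using A(2)[of t] st by (intro mult_right_mono) auto
      also have "\<dots> < A * (\<epsilon> / A)" using D(3)[of s] False st A(1) by (intro mult_strict_left_mono) auto
      finally show ?thesis using A(1) by simp
    next
      case True
      have "norm (f t) * norm (g s) \<le> norm (f t) * B"
        using B(2)[of s] st by (intro mult_left_mono) auto
      also have "\<dots> < (\<epsilon> / B) * B" using C(3)[of t] True st B(1) by (intro mult_strict_right_mono) auto
      finally show ?thesis using B(1) by simp
    qed
    then show ?thesis using norm_cinner_le[of "f t" "g s"] by simp
  qed
  then have "\<forall>x\<in>half_line \<times> half_line - D \<times> C. norm (case x of (s, t) \<Rightarrow> cinner (f t) (g s)) < \<epsilon>"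
    by auto
  moreover have "compact (D \<times> C)" using C D by (intro compact_Times)
  moreover have "D \<times> C \<subseteq> half_line \<times> half_line" using C D by auto
  ultimately show "\<exists>C. compact C \<and> C \<subseteq> half_line \<times> half_line \<and>
      (\<forall>x\<in>half_line \<times> half_line - C. norm (case x of (s, t) \<Rightarrow> cinner (f t) (g s)) < \<epsilon>)"
    by (intro exI[of _ "D \<times> C"] conjI)
qed

lemma C0_on_uniform_limit:
  assumes lim: "uniform_limit X f g sequentially" and f: "\<And>k. C0_on X (f k)"
  shows "C0_on X g"
  proof (rule C0_onI)
  show "continuous_on X g"
    by (rule uniform_limit_theorem[OF _ lim]) (use f in \<open>auto simp: C0_on_def\<close>)
  fix \<epsilon> :: real assume "\<epsilon> > 0"
  then have "\<forall>\<^sub>F k in sequentially. \<forall>x\<in>X. dist (f k x) (g x) < \<epsilon> / 2"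
    using lim by (intro uniform_limitD) auto
  then obtain k where k: "\<And>x. x \<in> X \<Longrightarrow> dist (f k x) (g x) < \<epsilon> / 2"
    using eventually_happens'[OF sequentially_bot, of "\<lambda>k. \<forall>x\<in>X. dist (f k x) (g x) < \<epsilon> / 2"] by blast
  have "\<epsilon> / 2 > 0" using \<open>\<epsilon> > 0\<close> by simp
  then obtain C where C: "compact C" "C \<subseteq> X" "\<And>x. x \<in> X \<Longrightarrow> x \<notin> C \<Longrightarrow> norm (f k x) < \<epsilon> / 2"
    using C0_onE[OF f[of k]] by metis
  have "norm (g x) < \<epsilon>" if "x \<in> X - C" for x
    using k[of x] C(3)[of x] norm_triangle_sub[of "g x" "f k x"] that
    by (simp add: dist_norm norm_minus_commute)
  with C(1,2) show "\<exists>C. compact C \<and> C \<subseteq> X \<and> (\<forall>x\<in>X - C. norm (g x) < \<epsilon>)"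
    by (intro exI[of _ C]) simp
qed

lemma C0_on_cong:
  assumes "C0_on X f" "\<And>x. x \<in> X \<Longrightarrow> f x = g x"
  shows "C0_on X g"
  using assms unfolding C0_on_def by (simp cong: continuous_on_cong)

lemma continuous_section:
  fixes f :: "real \<Rightarrow> real \<Rightarrow> complex"
  assumes "continuous_on (half_line \<times> half_line) (\<lambda>(s, t). f s t)"
  shows "s \<ge> 0 \<Longrightarrow> continuous_on half_line (f s)"
    and "t \<ge> 0 \<Longrightarrow> continuous_on half_line (\<lambda>s. f s t)"
    and "continuous_on half_line (\<lambda>s. f s s)"
proof -
  have comp: "continuous_on half_line (\<lambda>x. f (g x) (h x))"
    if "continuous_on half_line g" "continuous_on half_line h" "\<And>x. x \<ge> 0 \<Longrightarrow> g x \<ge> 0 \<and> h x \<ge> 0" for g h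
    using continuous_on_compose2[OF assms, of half_line "\<lambda>x. (g x, h x)"] that
    by (auto intro!: continuous_on_Pair)
  show "s \<ge> 0 \<Longrightarrow> continuous_on half_line (f s)"
    by (rule comp) (auto intro: continuous_intros)
  show "t \<ge> 0 \<Longrightarrow> continuous_on half_line (\<lambda>s. f s t)"
    by (rule comp) (auto intro: continuous_intros)
  show "continuous_on half_line (\<lambda>s. f s s)"
    by (rule comp) (auto intro: continuous_intros)
qed

lemma continuous_half_line_measurable:
  fixes f :: "real \<Rightarrow> complex"
  shows "continuous_on half_line f \<Longrightarrow> f \<in> borel_measurable half_leb"
  by (rule continuous_imp_measurable_on_sets_lebesgue) auto

lemma AE_half_lebI: "(\<And>s. s \<ge> 0 \<Longrightarrow> P s) \<Longrightarrow> AE s in half_leb. P s"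
  by (rule AE_I2) (simp add: space_restrict_space)

lemma AE_half_leb_nonneg: "AE s in half_leb. s \<ge> 0"
  by (rule AE_half_lebI)

section \<open>Integral operators with Carleman kernels\<close>

text \<open>The conjugation in the Carleman function is what makes (T f)(s) the inner product of f
  with it, hence linear in f.\<close>

lemma cinner_carleman_fun:
  assumes "square_integrable (\<lambda>t. K s t)"
  shows "cinner x (carleman_fun K s) = (\<integral>t. rep_l2 x t * K s t \<partial>half_leb)"
  unfolding carleman_fun_def by (subst cinner_abs_l2_right[OF square_integrable_cnj[OF assms]]) simp

lemma induces_AE:
  assumes "induces K T" "(f, g) \<in> T" "\<And>s. s \<ge> 0 \<Longrightarrow> square_integrable (\<lambda>t. K s t)"
  shows "AE s in half_leb. rep_l2 g s = cinner f (carleman_fun K s)"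
proof -
  have "AE s in half_leb. rep_l2 g s = (\<integral>t. K s t * rep_l2 f t \<partial>half_leb)"
    using assms(1,2) by (fastforce simp: induces_def)
  with AE_half_leb_nonneg show ?thesis
    by eventually_elim (simp add: cinner_carleman_fun assms(3) mult.commute)
qed

lemma K0_kernelD:
  assumes "K0_kernel T K"
  shows "C0_on (half_line \<times> half_line) (\<lambda>(s, t). K s t)" "s \<ge> 0 \<Longrightarrow> square_integrable (\<lambda>t. K s t)"
    "C0_on half_line (carleman_fun K)" "induces K T" "densely_defined T"
  using assms by (auto simp: K0_kernel_def bi_Carleman_def integral_operator_def)

lemma continuous_on_cinner_left:
  "continuous_on X f \<Longrightarrow> continuous_on X (\<lambda>s. cinner x (f s))"
  by (rule bounded_linear.continuous_on[OF cinner.bounded_linear_right])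

lemma K0_kernel_AE:
  assumes "K0_kernel T K" "(f, g) \<in> T"
  shows "AE s in half_leb. rep_l2 g s = cinner f (carleman_fun K s)"
  by (rule induces_AE[OF K0_kernelD(4)[OF assms(1)] assms(2)]) (rule K0_kernelD(2)[OF assms(1)])

text \<open>For fixed \<open>f\<close> in the dense domain both sides of \<open>(Tf)(s) = \<langle>f, k(s)\<rangle>\<close> are continuous in \<open>s\<close>,
  which determines the Carleman function at every point.\<close>

lemma K0_kernel_unique:
  assumes K: "K0_kernel T K" and L: "K0_kernel T L" and "s \<ge> 0" "t \<ge> 0"
  shows "K s t = L s t"
proof -
  have eq: "cinner f (carleman_fun K s) = cinner f (carleman_fun L s)" if f: "f \<in> Domain T" for f
  proof -
    obtain g where g: "(f, g) \<in> T" using f by blast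
    have "AE s in half_leb. cinner f (carleman_fun K s) = cinner f (carleman_fun L s)"
      using K0_kernel_AE[OF K g] K0_kernel_AE[OF L g]
      by eventually_elim simp
    then show ?thesis
      using K0_kernelD(3)[OF K] K0_kernelD(3)[OF L] \<open>s \<ge> 0\<close>
      by (intro continuous_AE_half_line_eqD[where x = s] continuous_on_cinner_left) (auto simp: C0_on_def)
  qed
  \<comment> \<open>Density of the domain extends the equality to all test vectors. Equal Carleman
    functions mean equal rows almost everywhere, and continuity in t makes them equal at each
    point.\<close>
  have "carleman_fun K s = carleman_fun L s"
  proof (rule l2_eq_cinnerI)
    fix z
    have "z \<in> closure (Domain T)" using K0_kernelD(5)[OF K] by (simp add: densely_defined_def)
    then obtain f where f: "\<And>n. f n \<in> Domain T" "f \<longlonglongrightarrow> z" by (auto simp: closure_sequential)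
    have "cinner z (carleman_fun K s) = cinner z (carleman_fun L s)"
    proof (rule LIMSEQ_unique)
      show "(\<lambda>n. cinner (f n) (carleman_fun K s)) \<longlonglongrightarrow> cinner z (carleman_fun K s)"
        by (intro cinner.tendsto f tendsto_const)
      show "(\<lambda>n. cinner (f n) (carleman_fun K s)) \<longlonglongrightarrow> cinner z (carleman_fun L s)"
        unfolding eq[OF f(1)] by (intro cinner.tendsto f tendsto_const)
    qed
    then show "cinner (carleman_fun K s) z = cinner (carleman_fun L s) z"
      by (metis cinner_commute)
  qed
  then have "AE t in half_leb. cnj (K s t) = cnj (L s t)"
    using K0_kernelD(2)[OF K \<open>s \<ge> 0\<close>] K0_kernelD(2)[OF L \<open>s \<ge> 0\<close>]
    by (simp only: carleman_fun_def abs_l2_eq_iff square_integrable_cnj)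
  then have "AE t in half_leb. K s t = L s t" by simp
  then show ?thesis
    using K0_kernelD(1)[OF K] K0_kernelD(1)[OF L] \<open>s \<ge> 0\<close> \<open>t \<ge> 0\<close>
    by (intro continuous_AE_half_line_eqD[where x = t] continuous_section(1)) (auto simp: C0_on_def)
qed

section \<open>Indicators of intervals as test vectors\<close>

lemma integral_indicator_half_leb:
  fixes g :: "real \<Rightarrow> complex"
  assumes "0 \<le> a" "continuous_on {a..b} g"
  shows "(\<integral>s. g s * indicator {a..b} s \<partial>half_leb) = integral {a..b} g"
proof -
  have "(\<integral>s. g s * indicator {a..b} s \<partial>half_leb) = (\<integral>s. indicator {0..} s *\<^sub>R (g s * indicator {a..b} s) \<partial>lebesgue)"
    by (rule integral_restrict_space) simp
  also have "\<dots> = set_lebesgue_integral lebesgue {a..b} g"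
    unfolding set_lebesgue_integral_def using assms(1)
    by (intro Bochner_Integration.integral_cong) (auto simp: indicator_def)
  also have "\<dots> = integral {a..b} g"
    by (rule set_lebesgue_integral_eq_integral(2)) (rule absolutely_integrable_continuous_real[OF assms(2)])
  finally show ?thesis .
qed

definition interval_l2 :: "real \<Rightarrow> real \<Rightarrow> l2" where
  "interval_l2 a b = abs_l2 (indicator {a..b})"

lemma square_integrable_interval: "square_integrable (indicator {a..b})"
proof -
  have "integrable half_leb (\<lambda>s. indicator {a..b} s :: real)"
  proof -
    have "integrable lebesgue (\<lambda>s. indicator {0..} s * indicator {a..b} s :: real)"
      unfolding indicator_inter_arith[symmetric]
      by (intro integrable_real_indicator) (auto simp: emeasure_lborel_Icc_eq)
    then show ?thesis
      by (subst integrable_restrict_space) simp_all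
  qed
  moreover have "(\<lambda>s. (norm (indicator {a..b} s :: complex))\<^sup>2) = (\<lambda>s. indicator {a..b} s :: real)"
    by (auto simp: indicator_def)
  moreover have "(indicator {a..b} :: real \<Rightarrow> complex) \<in> borel_measurable half_leb"
    by (intro measurable_restrict_space1 borel_measurable_indicator) auto
  ultimately show ?thesis by (simp add: square_integrable_def)
qed

lemma cinner_interval_right:
  "cinner x (interval_l2 a b) = (\<integral>s. rep_l2 x s * indicator {a..b} s \<partial>half_leb)"
  unfolding interval_l2_def cinner_abs_l2_right[OF square_integrable_interval]
  by (intro Bochner_Integration.integral_cong) (auto simp: indicator_def)

lemma cinner_interval_eq:
  assumes "0 \<le> a" "continuous_on {a..b} g" "AE s in half_leb. rep_l2 x s = g s"
    "g \<in> borel_measurable half_leb"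
  shows "cinner x (interval_l2 a b) = integral {a..b} g"
proof -
  have "cinner x (interval_l2 a b) = (\<integral>s. g s * indicator {a..b} s \<partial>half_leb)"
    unfolding cinner_interval_right
  proof (rule integral_cong_AE)
    show "AE s in half_leb. rep_l2 x s * indicator {a..b} s = g s * indicator {a..b} s"
      using assms(3) by eventually_elim simp
    show "(\<lambda>s. rep_l2 x s * indicator {a..b} s) \<in> borel_measurable half_leb"
      "(\<lambda>s. g s * indicator {a..b} s) \<in> borel_measurable half_leb"
      using assms(4) square_integrableD(1)[OF square_integrable_interval] rep_measurable
      by (auto intro!: borel_measurable_times)
  qed
  then show ?thesis using integral_indicator_half_leb[OF assms(1,2)] by simp
qed

lemma v_fun_measurable [measurable]: "\<omega> \<in> sets borel \<Longrightarrow> v_fun \<omega> \<in> borel_measurable borel"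
  unfolding v_fun_def[abs_def] by (intro borel_measurable_divide borel_measurable_indicator) auto

lemma omega_sets [measurable]: "omega \<epsilon> \<in> sets borel"
  unfolding omega_def by measurable

lemma bounded_borel_v_fun:
  assumes "\<omega> \<in> Omega0"
  shows "bounded_borel (v_fun \<omega>)"
proof -
  have "open (- closure \<omega>)" "0 \<in> - closure \<omega>" using assms by (auto simp: Omega0_def)
  then obtain r where r: "r > 0" "ball 0 r \<subseteq> - closure \<omega>" by (meson openE)
  have "norm (v_fun \<omega> z) \<le> 1 / r" for z
  proof (cases "z \<in> \<omega>")
    case True
    then have "z \<notin> ball 0 r" using r(2) closure_subset by blast
    then have "r \<le> norm z" by simp
    with True r(1) show ?thesis by (simp add: v_fun_def norm_divide frac_le)
  next
    case False
    then show ?thesis using r(1) by (simp add: v_fun_def)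
  qed
  then show ?thesis using assms by (intro bounded_borelI[of _ "1 / r"]) (auto simp: Omega0_def)
qed

lemma subset_omega_Omega0:
  assumes "\<sigma> \<in> sets borel" "\<sigma> \<subseteq> omega \<epsilon>" "\<epsilon> > 0"
  shows "\<sigma> \<in> Omega0"
proof -
  have "closed {z :: complex. \<epsilon> \<le> norm z}"
    by (intro closed_Collect_le continuous_intros)
  then have "closure \<sigma> \<subseteq> {z. \<epsilon> \<le> norm z}"
    using assms(2) by (intro closure_minimal) (auto simp: omega_def)
  then show ?thesis using assms(1,3) by (auto simp: Omega0_def)
qed

text \<open>The limit omits the point 0; \<open>E_zero_nu\<close> accounts for the mass that might
  sit there.\<close>

lemma tendsto_indicator_omega:
  fixes \<epsilon> :: "nat \<Rightarrow> real"
  assumes "\<epsilon> \<longlonglongrightarrow> 0" "\<And>k. 0 < \<epsilon> k"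
  shows "(\<lambda>k. indicator (omega (\<epsilon> k)) z :: complex) \<longlonglongrightarrow> indicator (- {0}) z"
proof (cases "z = 0")
  case True
  then have "indicator (omega (\<epsilon> k)) z = (0 :: complex)" for k
    using assms(2)[of k] by (simp add: omega_def)
  then show ?thesis using True by simp
next
  case False
  then have "\<forall>\<^sub>F k in sequentially. \<epsilon> k < norm z"
    using assms(1) by (intro order_tendstoD) auto
  then show ?thesis
    by (intro tendsto_eventually) (auto elim!: eventually_mono simp: omega_def False)
qed

locale normal_kernel = pvm E for E +
  fixes n :: "real \<Rightarrow> real \<Rightarrow> complex"
  assumes K0: "K0_kernel (calculus E (\<lambda>z. z)) n"
begin

abbreviation nu :: "real \<Rightarrow> l2" where
  "nu \<equiv> carleman_fun n"

lemmas n_C0 = K0_kernelD(1)[OF K0]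
lemmas n_square_integrable = K0_kernelD(2)[OF K0]
lemmas nu_C0 = K0_kernelD(3)[OF K0]

lemma nu_cont: "continuous_on half_line nu"
  using nu_C0 by (simp add: C0_on_def)

lemma rep_nu: "s \<ge> 0 \<Longrightarrow> AE t in half_leb. rep_l2 (nu s) t = cnj (n s t)"
  unfolding carleman_fun_def by (intro AE_rep_abs_l2 square_integrable_cnj n_square_integrable)

lemmas N_AE = K0_kernel_AE[OF K0]

lemma F_range_AE:
  assumes "bounded_borel w" "bounded_borel (\<lambda>z. z * w z)"
  shows "AE s in half_leb. rep_l2 (F (\<lambda>z. z * w z) x) s = cinner (F w x) (nu s)"
  by (rule N_AE, rule calculus_F_range) (use assms in auto)

text \<open>E {0} x lies in the null space of N, so the function s \<mapsto> \<langle>E {0} x, nu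
  s\<rangle> represents 0 and, being continuous, vanishes on the half-line. Hence nu s is orthogonal
  to that null space, and truncation away from 0 loses nothing in the limit.\<close>

lemma E_zero_nu:
  assumes "s \<ge> 0"
  shows "E {0} (nu s) = 0"
proof -
  have b: "bounded_borel (\<lambda>z. indicator {0} z)" by (intro bounded_borel_intros) simp
  have z: "(\<lambda>z::complex. z * indicator {0} z) = (\<lambda>z. 0 * indicator UNIV z)"
    by (auto simp: indicator_def)
  have "cinner (E {0} x) (nu s) = 0" for x
  proof -
    have "F (\<lambda>z. z * indicator {0} z) x = 0 *\<^sub>C x"
      unfolding z by (rule F_cindicator[of UNIV 0 x, unfolded E_UNIV]) simp
    moreover have "F (\<lambda>z. indicator {0} z) x = E {0} x"
      by (rule F_indicator) simp
    moreover have "AE s in half_leb. rep_l2 (F (\<lambda>z. z * indicator {0} z) x) s = cinner (F (\<lambda>z. indicator {0} z) x) (nu s)"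
      using b by (intro F_range_AE) (auto simp: z bounded_borel_const)
    ultimately have "AE s in half_leb. rep_l2 (0 *\<^sub>C x) s = cinner (E {0} x) (nu s)"
      by (simp only:)
    with rep_scaleC[of 0 x] have "AE s in half_leb. 0 = cinner (E {0} x) (nu s)"
      by eventually_elim simp
    then show ?thesis
      using continuous_AE_half_line_eqD[of "\<lambda>_. 0" "\<lambda>s. cinner (E {0} x) (nu s)" s] assms
        continuous_on_cinner_left[OF nu_cont] by auto
  qed
  then have "cinner (E {0} (nu s)) x = 0" for x
    using cinner_commute[of "E {0} (nu s)" x] by (simp add: E_self_adjoint)
  then show ?thesis by (intro l2_eq_cinnerI) (simp add: cinner.zero_left)
qed

text \<open>The kernel of \<open>E(\<omega>\<^sub>\<delta>) N v(N)\<close>: the symbol is \<open>v(z)\<close> over the conjugate of \<open>z\<close>, cut off at \<open>\<delta>\<close>.\<close>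

definition K :: "(complex \<Rightarrow> complex) \<Rightarrow> real \<Rightarrow> real \<Rightarrow> real \<Rightarrow> complex" where
  "K v \<delta> s t = cinner (F (\<lambda>z. v z * cnj (v_fun (omega \<delta>) z)) (nu t)) (nu s)"

lemma bounded_borel_v_omega: "\<delta> > 0 \<Longrightarrow> bounded_borel (v_fun (omega \<delta>))"
  by (intro bounded_borel_v_fun subset_omega_Omega0[of _ \<delta>]) auto

lemma bounded_borel_K: "\<delta> > 0 \<Longrightarrow> bounded_borel v \<Longrightarrow> bounded_borel (\<lambda>z. v z * cnj (v_fun (omega \<delta>) z))"
  by (intro bounded_borel_intros bounded_borel_v_omega)

text \<open>The phase carries the adjoint of N to N: z = (z / conj z) * conj z. At z = 0 it takes
  the value 0 by the convention x / 0 = 0.\<close>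

lemma bounded_borel_phase: "bounded_borel (\<lambda>z. z / cnj z)"
  by (rule bounded_borelI[of _ 1]) (auto simp: norm_divide)

lemma K_C0:
  assumes "\<delta> > 0" "bounded_borel v"
  shows "C0_on (half_line \<times> half_line) (\<lambda>(s, t). K v \<delta> s t)"
  unfolding K_def using assms
  by (intro C0_on_cinner C0_on_bounded_linear[OF F_bounded_linear] nu_C0 bounded_borel_K)

text \<open>Column t is s \<mapsto> \<langle>F w (nu t), nu s\<rangle> with w = v / conj z cut off
  at \<delta>, that is, N applied to F w (nu t). Multiplying w by z gives the bounded symbol v z /
  conj z, so the columns have a limit in L_2 although w has none.\<close>

lemma K_column_AE:
  assumes "\<delta> > 0" "bounded_borel v"
  shows "AE s in half_leb. rep_l2 (F (\<lambda>z. indicator (omega \<delta>) z * (v z * (z / cnj z))) (nu t)) s = K v \<delta> s t"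
proof -
  have eq: "(\<lambda>z. z * (v z * cnj (v_fun (omega \<delta>) z))) = (\<lambda>z. indicator (omega \<delta>) z * (v z * (z / cnj z)))"
    by (auto simp: v_fun_def indicator_def)
  show ?thesis
    unfolding K_def eq[symmetric]
  proof (rule F_range_AE)
    show "bounded_borel (\<lambda>z. z * (v z * cnj (v_fun (omega \<delta>) z)))"
      unfolding eq using assms by (intro bounded_borel_mult bounded_borel_indicator bounded_borel_phase) auto
  qed (use assms bounded_borel_K in auto)
qed

text \<open>After passing to the adjoint the symbol is conj v / z on \<open>omega \<delta>\<close>,
  and multiplication by z leaves conj v. Rows therefore come from conj v applied to nu s, columns
  from v z / conj z applied to nu t.\<close>

lemma K_row_AE:
  assumes "\<delta> > 0" "bounded_borel v"
  shows "AE t in half_leb. rep_l2 (F (\<lambda>z. cnj (v z) * indicator (omega \<delta>) z) (nu s)) t = cnj (K v \<delta> s t)"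
proof -
  let ?w = "\<lambda>z. cnj (v z) * v_fun (omega \<delta>) z"
  have w: "bounded_borel ?w"
    using assms by (intro bounded_borel_intros bounded_borel_v_omega)
  have eq: "(\<lambda>z. z * ?w z) = (\<lambda>z. cnj (v z) * indicator (omega \<delta>) z)"
    using assms(1) by (auto simp: v_fun_def indicator_def omega_def)
  have "cnj (K v \<delta> s t) = cinner (F ?w (nu s)) (nu t)" for t
    using F_adjoint[OF bounded_borel_K[OF assms], of "nu t" "nu s"] cinner_commute[of "F ?w (nu s)" "nu t"]
    by (simp add: K_def)
  moreover have "AE t in half_leb. rep_l2 (F (\<lambda>z. z * ?w z) (nu s)) t = cinner (F ?w (nu s)) (nu t)"
    using assms w by (intro F_range_AE) (auto simp: eq intro!: bounded_borel_intros)
  ultimately show ?thesis by (simp only: eq)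
qed

lemma F_row_tendsto:
  assumes "\<epsilon> \<longlonglongrightarrow> 0" "\<And>k. 0 < \<epsilon> k" "bounded_borel v" "s \<ge> 0"
  shows "(\<lambda>k. F (\<lambda>z. cnj (v z) * indicator (omega (\<epsilon> k)) z) (nu s)) \<longlonglongrightarrow> F (\<lambda>z. cnj (v z)) (nu s)"
proof -
  obtain L where L: "v \<in> borel_measurable borel" "\<And>z. norm (v z) \<le> L" "L \<ge> 0"
    using assms(3) by (rule bounded_borelE) (rule that)
  note [measurable] = L(1)
  have "(\<lambda>k. F (\<lambda>z. cnj (v z) * indicator (omega (\<epsilon> k)) z) (nu s)) \<longlonglongrightarrow>
      F (\<lambda>z. cnj (v z) * indicator (- {0}) z) (nu s)"
  proof (rule F_strong_lim[where K = L])
    show "norm (cnj (v z) * indicator (omega (\<epsilon> k)) z) \<le> L" for k z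
      using L(2)[of z] L(3) by (auto simp: indicator_def)
    show "(\<lambda>k. cnj (v z) * indicator (omega (\<epsilon> k)) z) \<longlonglongrightarrow> cnj (v z) * indicator (- {0}) z" for z
      by (intro tendsto_mult tendsto_const tendsto_indicator_omega assms)
  qed measurable
  also have "F (\<lambda>z. cnj (v z) * indicator (- {0}) z) (nu s) = F (\<lambda>z. cnj (v z)) (nu s)"
  proof (rule F_cong_AE)
    \<comment> \<open>The two symbols can differ only at 0, a null set for the spectral measure of
      nu s.\<close>
    show "AE z in mu (nu s). cnj (v z) * indicator (- {0}) z = cnj (v z)"
      by (rule AE_muI[of "{0}"]) (auto simp: E_zero_nu assms)
  qed (use assms in \<open>auto intro!: bounded_borel_intros\<close>)
  finally show ?thesis .
qed

text \<open>The phase is 0 at z = 0, so the cut-off symbols converge to the full symbol everywhere,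
  the origin included; x can then be arbitrary.\<close>

lemma F_column_tendsto:
  assumes "\<epsilon> \<longlonglongrightarrow> 0" "\<And>k. 0 < \<epsilon> k" "bounded_borel v"
  shows "(\<lambda>k. F (\<lambda>z. indicator (omega (\<epsilon> k)) z * (v z * (z / cnj z))) x) \<longlonglongrightarrow> F (\<lambda>z. v z * (z / cnj z)) x"
proof -
  have "bounded_borel (\<lambda>z. v z * (z / cnj z))"
    by (intro bounded_borel_mult assms bounded_borel_phase)
  then obtain L where L: "(\<lambda>z. v z * (z / cnj z)) \<in> borel_measurable borel"
      "\<And>z. norm (v z * (z / cnj z)) \<le> L" "L \<ge> 0"
    by (rule bounded_borelE) (rule that)
  show ?thesis
  proof (rule F_strong_lim[where K = L])
    show "norm (indicator (omega (\<epsilon> k)) z * (v z * (z / cnj z))) \<le> L" for k z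
      using L(2)[of z] L(3) by (auto simp: indicator_def)
    show "(\<lambda>k. indicator (omega (\<epsilon> k)) z * (v z * (z / cnj z))) \<longlonglongrightarrow> v z * (z / cnj z)" for z
      using tendsto_mult[OF tendsto_indicator_omega[OF assms(1,2), of z] tendsto_const[of "v z * (z / cnj z)"]]
      by (cases "z = 0") auto
  qed (use L(1) in measurable)
qed

section \<open>Kernels obtained as uniform limits\<close>

text \<open>A uniform limit of the truncated kernels is continuous and vanishes at infinity. Its
  rows and columns are identified through the L_2 limits of \<open>F_row_tendsto\<close> and
  \<open>F_column_tendsto\<close>; its Carleman functions are thus bounded operators applied to
  \<open>nu\<close> and inherit continuity and decay from it.\<close>

lemma limit_kernel:
  assumes \<epsilon>: "\<epsilon> \<longlonglongrightarrow> 0" "\<And>k. 0 < \<epsilon> k" and v: "bounded_borel v"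
    and lim: "uniform_limit (half_line \<times> half_line) (\<lambda>k (s, t). K v (\<epsilon> k) s t) (\<lambda>(s, t). \<Phi> s t) sequentially"
    and \<phi>: "\<And>z. \<phi> z = z * v z"
  shows "K0_kernel (calculus E \<phi>) \<Phi>"
proof -
  have C0: "C0_on (half_line \<times> half_line) (\<lambda>(s, t). \<Phi> s t)"
    by (rule C0_on_uniform_limit[OF lim K_C0[OF \<epsilon>(2) v]])
  then have cont: "continuous_on (half_line \<times> half_line) (\<lambda>(s, t). \<Phi> s t)" by (simp add: C0_on_def)
  have ptw: "(\<lambda>k. K v (\<epsilon> k) s t) \<longlonglongrightarrow> \<Phi> s t" if "s \<ge> 0" "t \<ge> 0" for s t
    using tendsto_uniform_limitI[OF lim, of "(s, t)"] that by simp
  have row: "AE t in half_leb. rep_l2 (F (\<lambda>z. cnj (v z)) (nu s)) t = cnj (\<Phi> s t)" if s: "s \<ge> 0" for s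
  proof (rule l2_tendsto_AE[OF F_row_tendsto[OF \<epsilon> v s]])
    have "AE t in half_leb. \<forall>k. rep_l2 (F (\<lambda>z. cnj (v z) * indicator (omega (\<epsilon> k)) z) (nu s)) t = cnj (K v (\<epsilon> k) s t)"
      unfolding AE_all_countable using K_row_AE[OF \<epsilon>(2) v] by blast
    with AE_half_leb_nonneg
    show "AE t in half_leb. (\<lambda>k. rep_l2 (F (\<lambda>z. cnj (v z) * indicator (omega (\<epsilon> k)) z) (nu s)) t) \<longlonglongrightarrow> cnj (\<Phi> s t)"
      by eventually_elim (simp add: ptw s lim_cnj)
  qed
  have col: "AE s in half_leb. rep_l2 (F (\<lambda>z. v z * (z / cnj z)) (nu t)) s = \<Phi> s t" if t: "t \<ge> 0" for t
  proof (rule l2_tendsto_AE[OF F_column_tendsto[OF \<epsilon> v]])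
    have "AE s in half_leb. \<forall>k. rep_l2 (F (\<lambda>z. indicator (omega (\<epsilon> k)) z * (v z * (z / cnj z))) (nu t)) s = K v (\<epsilon> k) s t"
      unfolding AE_all_countable using K_column_AE[OF \<epsilon>(2) v] by blast
    with AE_half_leb_nonneg
    show "AE s in half_leb. (\<lambda>k. rep_l2 (F (\<lambda>z. indicator (omega (\<epsilon> k)) z * (v z * (z / cnj z))) (nu t)) s) \<longlonglongrightarrow> \<Phi> s t"
      by eventually_elim (simp add: ptw t)
  qed
  have sq_row: "square_integrable (\<lambda>t. cnj (\<Phi> s t))" if s: "s \<ge> 0" for s
    using row[OF s] continuous_half_line_measurable[OF continuous_section(1)[OF cont s]]
    by (intro square_integrable_cong_AE[OF square_integrable_rep]) auto
  have sq_row': "square_integrable (\<lambda>t. \<Phi> s t)" if s: "s \<ge> 0" for s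
    using square_integrable_cnj[OF sq_row[OF s]] by simp
  have sq_col: "square_integrable (\<lambda>s. \<Phi> s t)" if t: "t \<ge> 0" for t
    using col[OF t] continuous_half_line_measurable[OF continuous_section(2)[OF cont t]]
    by (intro square_integrable_cong_AE[OF square_integrable_rep]) auto
  have k: "carleman_fun \<Phi> s = F (\<lambda>z. cnj (v z)) (nu s)" if s: "s \<ge> 0" for s
    unfolding carleman_fun_def[of \<Phi>] using row[OF s] sq_row[OF s] by (intro abs_l2_eqI) auto
  have k': "carleman_fun' \<Phi> t = F (\<lambda>z. v z * (z / cnj z)) (nu t)" if t: "t \<ge> 0" for t
    unfolding carleman_fun'_def using col[OF t] sq_col[OF t] by (intro abs_l2_eqI) auto
  have \<phi>m: "\<phi> \<in> borel_measurable borel"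
    using bounded_borel_measurable[OF v] by (auto simp: \<phi>[abs_def])
  have "induces \<Phi> (calculus E \<phi>)"
    unfolding induces_def
  proof (intro conjI ballI)
    show "(\<lambda>(s, t). \<Phi> s t) \<in> borel_measurable (lebesgue_on (half_line \<times> half_line))"
      by (rule continuous_imp_measurable_on_sets_lebesgue[OF cont])
        (intro sets_completionI_sets, simp add: borel_closed closed_Times)
    fix fg assume "fg \<in> calculus E \<phi>"
    then obtain f g where fg: "fg = (f, g)" "(f, g) \<in> calculus E \<phi>" by (cases fg) auto
    \<comment> \<open>Since \<phi>(N) f = N (v(N) f), the kernel of N applies; moving v(N) to the
      other side then produces the Carleman function of \<Phi>.\<close>
    then have "AE s in half_leb. rep_l2 g s = cinner (F v f) (nu s)"
      using calculus_id_mult_iff[OF v \<phi>] N_AE by blast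
    with AE_half_leb_nonneg
    have "AE s in half_leb. integrable half_leb (\<lambda>t. \<Phi> s t * rep_l2 f t) \<and>
        rep_l2 g s = (\<integral>t. \<Phi> s t * rep_l2 f t \<partial>half_leb)"
    proof eventually_elim
      case (elim s)
      have "integrable half_leb (\<lambda>t. rep_l2 f t * cnj (cnj (\<Phi> s t)))"
        by (intro square_integrable_mult_cnj square_integrable_rep sq_row elim)
      moreover have "rep_l2 g s = cinner f (carleman_fun \<Phi> s)"
        using elim by (simp add: k F_adjoint v)
      ultimately show ?case
        using elim by (simp add: cinner_carleman_fun sq_row' mult.commute)
    qed
    then show "case fg of (f, g) \<Rightarrow> AE s in half_leb. integrable half_leb (\<lambda>t. \<Phi> s t * rep_l2 f t) \<and>
        rep_l2 g s = (\<integral>t. \<Phi> s t * rep_l2 f t \<partial>half_leb)" by (simp add: fg)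
  qed
  then have "bi_Carleman (calculus E \<phi>) \<Phi>"
    using sq_row' sq_col linear_operator_calculus[OF \<phi>m] densely_defined_calculus[OF \<phi>m]
    by (auto simp: bi_Carleman_def integral_operator_def intro!: AE_half_lebI)
  moreover have "C0_on half_line (carleman_fun \<Phi>)"
    by (rule C0_on_cong[OF C0_on_bounded_linear[OF F_bounded_linear[OF bounded_borel_cnj[OF v]] nu_C0]])
      (simp add: k)
  moreover have "C0_on half_line (carleman_fun' \<Phi>)"
    by (rule C0_on_cong[OF C0_on_bounded_linear[OF
          F_bounded_linear[OF bounded_borel_mult[OF v bounded_borel_phase]] nu_C0]])
      (simp add: k')
  ultimately show ?thesis
    using C0 sq_row' sq_col by (simp add: K0_kernel_def)
qed

section \<open>The truncated integrals\<close>

text \<open>The symbol is bounded, so the adjoint is the graph of an everywhere defined bounded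
  operator and the definite description has exactly one solution.\<close>

lemma e_fun_eq:
  assumes "\<omega> \<in> Omega0"
  shows "e_fun E n \<omega> s = F (\<lambda>z. cnj (v_fun \<omega> z)) (nu s)"
proof -
  have b: "bounded_borel (v_fun \<omega>)" by (rule bounded_borel_v_fun[OF assms])
  show ?thesis
    unfolding e_fun_def adjoint_calculus[OF bounded_borel_measurable[OF b]]
      calculus_bounded_iff[OF bounded_borel_cnj[OF b]] by simp
qed

text \<open>For \<sigma> inside \<open>omega \<delta>\<close> the vector e(r; \<sigma>) is the
  projection E \<sigma> of the single vector e(r; omega \<delta>), so the spectral function at (s,
  t) is the complex measure of one fixed pair of vectors. The factors 1 / conj z and 1 / z carried
  by this pair turn z v(z) into v(z) / conj z.\<close>

lemma truncated_integral_eq: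
  assumes \<delta>: "\<delta> > 0" and v: "bounded_borel v" and \<phi>: "\<And>z. \<phi> z = z * v z"
  shows "truncated_integrable E n \<phi> \<delta> s t" "truncated_integral E n \<phi> \<delta> s t = K v \<delta> s t"
proof -
  let ?\<Omega> = "omega \<delta>"
  let ?w = "\<lambda>z. cnj (v_fun ?\<Omega> z)"
  let ?\<psi> = "\<lambda>z. indicator ?\<Omega> z * \<phi> z"
  have \<Omega>: "?\<Omega> \<in> Omega0" "?\<Omega> \<in> sets borel" by (auto intro: subset_omega_Omega0[OF _ _ \<delta>])
  have w: "bounded_borel ?w" by (intro bounded_borel_cnj bounded_borel_v_omega \<delta>)
  have \<phi>m[measurable]: "\<phi> \<in> borel_measurable borel"
    using bounded_borel_measurable[OF v] by (auto simp: \<phi>[abs_def])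
  have \<psi>m: "?\<psi> \<in> borel_measurable borel" by measurable
  have \<phi>w: "(\<lambda>z. \<phi> z * ?w z) = (\<lambda>z. indicator ?\<Omega> z * (v z * (z / cnj z)))"
    and \<psi>w: "(\<lambda>z. ?\<psi> z * ?w z) = (\<lambda>z. indicator ?\<Omega> z * (v z * (z / cnj z)))"
    by (auto simp: \<phi> v_fun_def indicator_def)
  have b: "bounded_borel (\<lambda>z. indicator ?\<Omega> z * (v z * (z / cnj z)))"
    by (intro bounded_borel_mult bounded_borel_indicator bounded_borel_phase v \<Omega>)
  have dom: "F ?w (nu r) \<in> calculus_domain E \<phi>" "F ?w (nu r) \<in> calculus_domain E ?\<psi>" for r
    using calculus_F_range[OF \<phi>m w, of "nu r"] calculus_F_range[OF \<psi>m w, of "nu r"] b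
    unfolding \<phi>w \<psi>w by (auto simp: calculus_def)
  have sf: "spectral_function E n \<sigma> s t = cinner (E \<sigma> (F ?w (nu t))) (F ?w (nu s))"
    if "\<sigma> \<in> sets (restrict_space borel ?\<Omega>)" for \<sigma>
  proof -
    have \<sigma>: "\<sigma> \<subseteq> ?\<Omega>" "\<sigma> \<in> sets borel" using that \<Omega>(2) by (auto simp: sets_restrict_space_iff)
    then have \<sigma>0: "\<sigma> \<in> Omega0" using \<delta> by (intro subset_omega_Omega0)
    have "(\<lambda>z. cnj (v_fun \<sigma> z)) = (\<lambda>z. indicator \<sigma> z * ?w z)"
    proof
      fix z
      show "cnj (v_fun \<sigma> z) = indicator \<sigma> z * ?w z"
        using \<sigma>(1) by (cases "z \<in> \<sigma>") (auto simp: v_fun_def)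
    qed
    then have "e_fun E n \<sigma> r = E \<sigma> (F ?w (nu r))" for r
      using F_indicator_mult(1)[OF \<sigma>(2) w] by (simp add: e_fun_eq[OF \<sigma>0])
    then show ?thesis
      using \<sigma>0 \<sigma>(2) by (simp add: spectral_function_def) (metis E_idem E_self_adjoint)
  qed
  show "truncated_integrable E n \<phi> \<delta> s t"
    unfolding truncated_integrable_def by (rule cm_integral_eq_S(1)[OF \<phi>m dom(1) dom(1) \<Omega>(2) refl sf])
  have "truncated_integral E n \<phi> \<delta> s t = S ?\<psi> (F ?w (nu t)) (F ?w (nu s))"
    unfolding truncated_integral_def by (rule cm_integral_eq_S(2)[OF \<phi>m dom(1) dom(1) \<Omega>(2) refl sf])
  also have "\<dots> = cinner (F (\<lambda>z. ?\<psi> z * ?w z) (nu t)) (F ?w (nu s))"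
    using calculus_F_range[OF \<psi>m w, of "nu t"] b dom(2)[of s] unfolding \<psi>w
    by (simp add: calculus_iff_S[OF \<psi>m])
  also have "\<dots> = cinner (F (\<lambda>z. v_fun ?\<Omega> z * (?\<psi> z * ?w z)) (nu t)) (nu s)"
    unfolding F_mult[OF bounded_borel_v_omega[OF \<delta>] b[folded \<psi>w]] F_adjoint[OF bounded_borel_v_omega[OF \<delta>]] ..
  also have "(\<lambda>z. v_fun ?\<Omega> z * (?\<psi> z * ?w z)) = (\<lambda>z. v z * ?w z)"
    using \<delta> by (auto simp: \<phi> v_fun_def indicator_def omega_def)
  finally show "truncated_integral E n \<phi> \<delta> s t = K v \<delta> s t" by (simp add: K_def)
qed

end

context pvm
begin

lemma E_Compl:
  assumes A: "A \<in> sets borel"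
  shows "E (- A) x = x - E A x"
proof -
  have A': "- A \<in> sets borel" using sets.compl_sets[OF A] by (simp add: Compl_eq_Diff_UNIV)
  have "F (\<lambda>z. indicator A z + indicator (- A) z) x = E A x + E (- A) x"
    using F_add[OF bounded_borel_indicator[OF A] bounded_borel_indicator[OF A'], of x]
    by (simp only: F_indicator[OF A] F_indicator[OF A'])
  moreover have "(\<lambda>z. indicator A z + indicator (- A) z) = (indicator UNIV :: complex \<Rightarrow> complex)"
    by (auto simp: indicator_def)
  moreover have "F (indicator UNIV) x = x"
    by (subst F_indicator) (auto simp: E_UNIV)
  ultimately have "x = E A x + E (- A) x" by (simp only:)
  then show ?thesis by (metis add_diff_cancel_left')
qed

lemma Re_cinner_F:
  assumes "bounded_borel f"
  shows "Re (cinner (F f x) x) = (\<integral>z. Re (f z) \<partial>mu x)"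
  unfolding cinner_F_same[OF assms] by (rule integral_Re[symmetric]) (rule integrable_mu[OF assms])

end

lemma v_fun_Diff: "B \<subseteq> A \<Longrightarrow> v_fun (A - B) z = v_fun A z - v_fun B z"
  by (auto simp: v_fun_def indicator_def)

section \<open>Spectrum in a sector\<close>

text \<open>The sector enters in this linear form: a turns it into the right half-plane, and c > 0
  keeps its edges away from the imaginary axis. The inequality holds almost everywhere because E is
  carried by the spectrum.\<close>

locale sectorial_kernel = normal_kernel E n for E n +
  fixes a :: complex and c :: real
  assumes c_pos: "c > 0"
    and sector_AE: "\<And>x. AE z in mu x. c * norm z \<le> Re (a * z)"
begin

definition H :: "real \<Rightarrow> real \<Rightarrow> real" where
  "H \<delta> s = Re (a * K (\<lambda>_. 1) \<delta> s s)"

definition H0 :: "real \<Rightarrow> real" where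
  "H0 s = Re (a * n s s)"

text \<open>Its square is the integral of 1/|z| over the ring \<delta>' < |z| \<le> \<delta> against
  the spectral measure of nu s. With the absolute value there is no cancellation, so increments of
  \<open>K v\<close> are dominated for every bounded v.\<close>

definition Q :: "real \<Rightarrow> real \<Rightarrow> real \<Rightarrow> real" where
  "Q \<delta>' \<delta> s = norm (F (\<lambda>z. complex_of_real (sqrt (norm (v_fun (omega \<delta>' - omega \<delta>) z)))) (nu s))"

lemma ring_Omega0:
  assumes "0 < \<delta>'"
  shows "omega \<delta>' - omega \<delta> \<in> Omega0"
  by (rule subset_omega_Omega0[OF _ _ assms]) auto

lemma bounded_borel_sqrt:
  assumes f: "bounded_borel f"
  shows "bounded_borel (\<lambda>z. complex_of_real (sqrt (norm (f z))))"
proof -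
  obtain L where L: "f \<in> borel_measurable borel" "\<And>z. norm (f z) \<le> L" "L \<ge> 0"
    using f by (rule bounded_borelE) (rule that)
  note [measurable] = L(1)
  show ?thesis
  proof (rule bounded_borelI[of _ "sqrt L"])
    show "(\<lambda>z. complex_of_real (sqrt (norm (f z)))) \<in> borel_measurable borel" by measurable
    show "norm (complex_of_real (sqrt (norm (f z)))) \<le> sqrt L" for z
      using L(2)[of z] by simp
  qed
qed

lemma K_diff:
  assumes "0 < \<delta>'" "\<delta>' \<le> \<delta>" "bounded_borel v"
  shows "K v \<delta>' s t - K v \<delta> s t =
    cinner (F (\<lambda>z. v z * cnj (v_fun (omega \<delta>' - omega \<delta>) z)) (nu t)) (nu s)"
proof -
  have "omega \<delta> \<subseteq> omega \<delta>'" using assms by (auto simp: omega_def)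
  then have "(\<lambda>z. v z * cnj (v_fun (omega \<delta>' - omega \<delta>) z)) =
      (\<lambda>z. v z * cnj (v_fun (omega \<delta>') z) - v z * cnj (v_fun (omega \<delta>) z))"
    by (auto simp: v_fun_Diff right_diff_distrib)
  then show ?thesis
    using assms by (simp add: K_def F_diff bounded_borel_K cinner.diff_left)
qed

text \<open>Polar form: on the ring the symbol splits as q * p * q, where q is the square root of
  1/|z| and the bounded factor p absorbs v and the phase of 1 / conj z. One q goes to nu t, the
  other to nu s, and Cauchy-Schwarz separates the variables.\<close>

lemma norm_K_diff_le:
  assumes \<delta>: "0 < \<delta>'" "\<delta>' \<le> \<delta>" and v: "bounded_borel v" "\<And>z. norm (v z) \<le> L"
  shows "norm (K v \<delta>' s t - K v \<delta> s t) \<le> L * Q \<delta>' \<delta> t * Q \<delta>' \<delta> s"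
proof -
  let ?u = "v_fun (omega \<delta>' - omega \<delta>)"
  let ?q = "\<lambda>z. complex_of_real (sqrt (norm (?u z)))"
  let ?p = "\<lambda>z. v z * cnj (sgn (?u z))"
  have u: "bounded_borel ?u" by (rule bounded_borel_v_fun[OF ring_Omega0[OF \<delta>(1)]])
  have q: "bounded_borel ?q" by (rule bounded_borel_sqrt[OF u])
  have "L \<ge> 0" using v(2) norm_ge_zero order_trans by blast
  have pL: "norm (?p z) \<le> L" for z
    using v(2)[of z] \<open>L \<ge> 0\<close> by (auto simp: norm_mult norm_sgn)
  have p: "bounded_borel ?p"
  proof (rule bounded_borelI[OF _ pL])
    have "sgn \<in> borel_measurable (borel :: complex measure)"
      unfolding sgn_div_norm[abs_def] by measurable
    then show "?p \<in> borel_measurable borel"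
      using bounded_borel_measurable[OF v(1)] bounded_borel_measurable[OF u]
      by (auto intro!: borel_measurable_times measurable_compose[OF _ borel_measurable_cnj] measurable_compose[of ?u borel borel sgn])
  qed
  have "cnj (?u z) = cnj (sgn (?u z)) * (?q z * ?q z)" for z
  proof -
    have "?q z * ?q z = complex_of_real (norm (?u z))"
      by (simp only: of_real_mult[symmetric] real_sqrt_mult_self abs_norm_cancel)
    then show ?thesis by (cases "?u z = 0") (auto simp: sgn_eq)
  qed
  then have "(\<lambda>z. v z * cnj (?u z)) = (\<lambda>z. ?q z * (?p z * ?q z))"
    by (auto simp: mult.assoc mult.left_commute)
  then have "K v \<delta>' s t - K v \<delta> s t = cinner (F (\<lambda>z. ?q z * (?p z * ?q z)) (nu t)) (nu s)"
    using K_diff[OF \<delta> v(1)] by simp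
  also have "\<dots> = cinner (F ?p (F ?q (nu t))) (F ?q (nu s))"
    unfolding F_mult[OF q bounded_borel_mult[OF p q]] F_mult[OF p q] F_adjoint[OF q] by simp
  finally have "norm (K v \<delta>' s t - K v \<delta> s t) = norm (cinner (F ?p (F ?q (nu t))) (F ?q (nu s)))"
    by (rule arg_cong)
  also have "\<dots> \<le> norm (F ?p (F ?q (nu t))) * norm (F ?q (nu s))"
    by (rule norm_cinner_le)
  also have "\<dots> \<le> L * norm (F ?q (nu t)) * norm (F ?q (nu s))"
    by (intro mult_right_mono norm_F_le p pL) auto
  finally show ?thesis by (simp add: Q_def)
qed

text \<open>1 / conj z = z / |z|^2 is a positive multiple of z, so the half-plane inequality
  survives the passage to the symbol.\<close>

lemma Re_conj_inverse_ge:
  assumes "c * norm z \<le> Re (a * z)"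
  shows "c * norm (v_fun A z) \<le> Re (a * cnj (v_fun A z))"
proof (cases "z \<in> A \<and> z \<noteq> 0")
  case True
  have "cnj (1 / z) = z / complex_of_real ((norm z)\<^sup>2)"
    using True unfolding complex_norm_square by simp
  then have "Re (a * cnj (v_fun A z)) = Re (a * z) / (norm z)\<^sup>2"
    using True by (simp add: v_fun_def Re_divide_of_real del: of_real_power)
  moreover have "c * norm (v_fun A z) = c * norm z / (norm z)\<^sup>2"
    using True by (simp add: v_fun_def norm_divide power2_eq_square)
  ultimately show ?thesis using assms True by (simp add: divide_right_mono)
next
  case False
  then show ?thesis by (auto simp: v_fun_def)
qed

text \<open>The half-plane inequality integrated over the ring: an integral of absolute values on
  the left is paid for by an increment of the diagonal with v = 1 on the right.\<close>

lemma Q_le: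
  assumes \<delta>: "0 < \<delta>'" "\<delta>' \<le> \<delta>"
  shows "c * (Q \<delta>' \<delta> s)\<^sup>2 \<le> H \<delta>' s - H \<delta> s"
proof -
  let ?u = "v_fun (omega \<delta>' - omega \<delta>)"
  have u: "bounded_borel ?u" by (rule bounded_borel_v_fun[OF ring_Omega0[OF \<delta>(1)]])
  have au: "bounded_borel (\<lambda>z. a * cnj (?u z))" by (intro bounded_borel_intros u)
  have "c * (Q \<delta>' \<delta> s)\<^sup>2 = (\<integral>z. c * norm (?u z) \<partial>mu (nu s))"
    unfolding Q_def norm_F[OF bounded_borel_sqrt[OF u]] by simp
  also have "\<dots> \<le> (\<integral>z. Re (a * cnj (?u z)) \<partial>mu (nu s))"
  proof (rule integral_mono_AE)
    show "integrable (mu (nu s)) (\<lambda>z. c * norm (?u z))"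
      using integrable_mu[OF u] by (intro integrable_mult_right integrable_norm)
    show "integrable (mu (nu s)) (\<lambda>z. Re (a * cnj (?u z)))"
      using integrable_mu[OF au] by (rule integrable_Re)
    show "AE z in mu (nu s). c * norm (?u z) \<le> Re (a * cnj (?u z))"
      using sector_AE by eventually_elim (rule Re_conj_inverse_ge)
  qed
  also have "\<dots> = Re (cinner (F (\<lambda>z. a * cnj (?u z)) (nu s)) (nu s))"
    by (rule Re_cinner_F[OF au, symmetric])
  also have "\<dots> = Re (a * (K (\<lambda>_. 1) \<delta>' s s - K (\<lambda>_. 1) \<delta> s s))"
    by (simp add: K_diff[OF \<delta> bounded_borel_const] F_cmult bounded_borel_cnj u cinner_scaleC_left)
  also have "\<dots> = H \<delta>' s - H \<delta> s"
    by (simp add: H_def right_diff_distrib)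
  finally show ?thesis .
qed

lemma H_mono: "0 < \<delta>' \<Longrightarrow> \<delta>' \<le> \<delta> \<Longrightarrow> H \<delta> s \<le> H \<delta>' s"
  using Q_le[of \<delta>' \<delta> s] c_pos by (smt (verit) mult_nonneg_nonneg zero_le_power2)

lemma H_nonneg:
  assumes "\<delta> > 0"
  shows "0 \<le> H \<delta> s"
proof -
  let ?u = "v_fun (omega \<delta>)"
  have u: "bounded_borel ?u" by (rule bounded_borel_v_omega[OF assms])
  have au: "bounded_borel (\<lambda>z. a * cnj (?u z))" by (intro bounded_borel_intros u)
  have "H \<delta> s = Re (cinner (F (\<lambda>z. a * cnj (?u z)) (nu s)) (nu s))"
    by (simp add: H_def K_def F_cmult bounded_borel_cnj u cinner_scaleC_left)
  also have "\<dots> = (\<integral>z. Re (a * cnj (?u z)) \<partial>mu (nu s))"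
    by (rule Re_cinner_F[OF au])
  also have "\<dots> \<ge> 0"
  proof (rule integral_nonneg_AE)
    show "AE z in mu (nu s). 0 \<le> Re (a * cnj (?u z))"
      using sector_AE
    proof eventually_elim
      case (elim z)
      have "0 \<le> c * norm (?u z)" using c_pos by simp
      also have "\<dots> \<le> Re (a * cnj (?u z))" by (rule Re_conj_inverse_ge[OF elim])
      finally show ?case .
    qed
  qed
  finally show ?thesis .
qed

subsection \<open>Comparison on the diagonal\<close>

text \<open>Integrating (N x)(s) = \<langle>x, nu s\<rangle> over the interval gives the inner
  product of x with a vector-valued integral of \<open>nu\<close>, which exhibits the image of the
  indicator under the adjoint.\<close>

lemma interval_adjoint:
  assumes "0 \<le> l"
  shows "(interval_l2 l b, integral {l..b} nu) \<in> adjoint_op (calculus E (\<lambda>z. z))"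
proof -
  have cont: "continuous_on {l..b} nu"
    using nu_cont by (rule continuous_on_subset) (use assms in auto)
  have "cinner y (interval_l2 l b) = cinner x (integral {l..b} nu)" if "(x, y) \<in> calculus E (\<lambda>z. z)" for x y
  proof -
    have "cinner y (interval_l2 l b) = integral {l..b} (\<lambda>s. cinner x (nu s))"
      using assms N_AE[OF that]
      by (intro cinner_interval_eq continuous_half_line_measurable continuous_on_cinner_left cont nu_cont)
    also have "\<dots> = cinner x (integral {l..b} nu)"
      using integral_linear[OF integrable_continuous_interval[OF cont] cinner.bounded_linear_right[of x]]
      by (simp add: o_def)
    finally show ?thesis .
  qed
  then show ?thesis by (auto simp: adjoint_op_def)
qed

text \<open>Quadratic forms of N, rather than of its adjoint, are to be tested on indicators. The
  two operators have the same domain, and applying the phase z / conj z to the adjoint's image gives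
  the image under N.\<close>

lemma interval_domain:
  assumes "0 \<le> l"
  shows "(interval_l2 l b, F (\<lambda>z. z / cnj z) (integral {l..b} nu)) \<in> calculus E (\<lambda>z. z)"
proof (rule calculus_cutI)
  let ?h = "integral {l..b} nu" and ?f = "interval_l2 l b" and ?u = "\<lambda>z. z / cnj z"
  have cm: "cnj \<in> borel_measurable borel" and im: "(\<lambda>z. z) \<in> borel_measurable (borel :: complex measure)"
    by auto
  have lev: "lev cnj k = lev (\<lambda>z. z) k" for k by (simp add: lev_def)
  have adj: "(?f, ?h) \<in> calculus E cnj"
    using interval_adjoint[OF assms] adjoint_calculus[OF im] by simp
  fix k
  let ?L = "lev (\<lambda>z. z) k"
  have L: "?L \<in> sets borel" by (rule lev_sets[OF im])
  have "E ?L (F ?u ?h) = F ?u (E ?L ?h)"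
    using F_indicator_mult[OF L bounded_borel_phase] by metis
  also have "E ?L ?h = F (cut cnj k) ?f"
    using calculus_imp_F[OF cm adj lev_sets[OF cm] bounded_lev, of k] by (simp add: lev)
  also have "F ?u (F (cut cnj k) ?f) = F (\<lambda>z. ?u z * cut cnj k z) ?f"
    by (rule F_mult[OF bounded_borel_phase bounded_borel_cut[OF cm], symmetric])
  also have "(\<lambda>z. ?u z * cut cnj k z) = cut (\<lambda>z. z) k"
    by (auto simp: lev indicator_def)
  finally show "E ?L (F ?u ?h) = F (cut (\<lambda>z. z) k) ?f" .
qed simp

text \<open>E (omega \<delta>) applied to nu s has the truncated kernel as its row, up to
  conjugation, so the complementary projection leaves the row of n - K. Thus E (- omega \<delta>) N
  has a continuous kernel, and its quadratic form on an interval is a double integral.\<close>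

lemma remainder_kernel:
  assumes "0 \<le> l" "(interval_l2 l b, k) \<in> calculus E (\<lambda>z. z)" "\<delta> > 0"
  shows "cinner (E (- omega \<delta>) k) (interval_l2 l b) =
      integral {l..b} (\<lambda>s. integral {l..b} (\<lambda>t. n s t - K (\<lambda>_. 1) \<delta> s t))"
    and "continuous_on {l..b} (\<lambda>s. integral {l..b} (\<lambda>t. n s t - K (\<lambda>_. 1) \<delta> s t))"
proof -
  let ?R = "- omega \<delta>" and ?f = "interval_l2 l b"
  let ?G = "\<lambda>s t. n s t - K (\<lambda>_. 1) \<delta> s t"
  have R: "?R \<in> sets borel" using sets.compl_sets[OF omega_sets] by (simp add: Compl_eq_Diff_UNIV)
  have "(E ?R ?f, E ?R k) \<in> calculus E (\<lambda>z. z)"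
    using calculus_F[OF _ bounded_borel_indicator[OF R] assms(2)] F_indicator[OF R] by simp
  then have AE: "AE s in half_leb. rep_l2 (E ?R k) s = cinner (E ?R ?f) (nu s)"
    by (rule N_AE)
  have cont: "continuous_on half_line (\<lambda>s. cinner (E ?R ?f) (nu s))"
    by (intro continuous_on_cinner_left nu_cont)
  have contG: "continuous_on half_line (?G s)" if "s \<ge> 0" for s
    using n_C0 K_C0[OF assms(3) bounded_borel_const, of 1] that
    by (intro continuous_on_diff continuous_section(1)) (auto simp: C0_on_def)
  have eq: "cinner (E ?R ?f) (nu s) = integral {l..b} (?G s)" if s: "s \<ge> 0" for s
  proof -
    have cs: "continuous_on {l..b} (?G s)"
      using contG[OF s] by (rule continuous_on_subset) (use assms in auto)
    have "AE t in half_leb. rep_l2 (E ?R (nu s)) t = cnj (?G s t)"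
      using rep_nu[OF s] K_row_AE[OF assms(3) bounded_borel_const, of 1 s]
        rep_diff[of "nu s" "E (omega \<delta>) (nu s)"]
      by eventually_elim (simp add: E_Compl F_indicator)
    then have "cinner (E ?R (nu s)) ?f = integral {l..b} (\<lambda>t. cnj (?G s t))"
      using assms contG[OF s] cs
      by (intro cinner_interval_eq continuous_half_line_measurable continuous_on_cnj)
    also have "\<dots> = cnj (integral {l..b} (?G s))"
      using integral_linear[OF integrable_continuous_interval[OF cs] bounded_linear_cnj]
      by (simp add: o_def)
    finally have "cinner ?f (E ?R (nu s)) = integral {l..b} (?G s)"
      using cinner_commute[of ?f "E ?R (nu s)"] by simp
    then show ?thesis by (simp add: E_self_adjoint R)
  qed
  have sub: "{l..b} \<subseteq> half_line" using assms by auto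
  show "continuous_on {l..b} (\<lambda>s. integral {l..b} (?G s))"
    using continuous_on_subset[OF cont sub]
    by (rule continuous_on_eq) (use assms(1) eq in auto)
  have "cinner (E ?R k) ?f = integral {l..b} (\<lambda>s. cinner (E ?R ?f) (nu s))"
    by (intro cinner_interval_eq assms AE continuous_half_line_measurable cont continuous_on_subset[OF cont sub])
  also have "\<dots> = integral {l..b} (\<lambda>s. integral {l..b} (?G s))"
    by (rule Henstock_Kurzweil_Integration.integral_cong) (use assms(1) eq in auto)
  finally show "cinner (E ?R k) ?f = integral {l..b} (\<lambda>s. integral {l..b} (?G s))" .
qed

text \<open>On the disc |z| \<le> \<delta> the symbol z is bounded, so the quadratic form is an
  integral of Re (a z), nonnegative by the sector condition.\<close>

lemma remainder_nonneg:
  assumes "(f, k) \<in> calculus E (\<lambda>z. z)" "\<delta> > 0"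
  shows "0 \<le> Re (a * cinner (E (- omega \<delta>) k) f)"
proof -
  let ?R = "- omega \<delta>"
  let ?g = "\<lambda>z. indicator ?R z * z"
  have R: "?R \<in> sets borel" using sets.compl_sets[OF omega_sets] by (simp add: Compl_eq_Diff_UNIV)
  have bd: "bounded ((\<lambda>z. z) ` ?R)" by (auto simp: bounded_iff omega_def not_less intro!: exI[of _ \<delta>])
  have g: "bounded_borel ?g" by (rule bounded_borel_indicator_mult[OF _ R bd]) simp
  have "Re (a * cinner (E ?R k) f) = Re (cinner (F (\<lambda>z. a * ?g z) f) f)"
    using calculus_imp_F[OF _ assms(1) R bd] by (simp add: F_cmult g cinner_scaleC_left)
  also have "\<dots> = (\<integral>z. Re (a * ?g z) \<partial>mu f)"
    by (rule Re_cinner_F[OF bounded_borel_cmult[OF g]])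
  also have "\<dots> \<ge> 0"
  proof (rule integral_nonneg_AE)
    show "AE z in mu f. 0 \<le> Re (a * ?g z)"
      using sector_AE
    proof eventually_elim
      case (elim z)
      moreover have "0 \<le> c * norm z" using c_pos by simp
      ultimately show ?case by (auto simp: indicator_def)
    qed
  qed
  finally show ?thesis .
qed

text \<open>Testing \<open>E(- \<omega>\<^sub>\<delta>)N\<close> against indicators of short intervals shows that its continuous kernel
  \<open>N(s,t) - N\<^sub>\<delta>(s,t)\<close> has the right sign on the diagonal.\<close>

lemma H_le_H0:
  assumes \<delta>: "\<delta> > 0" and s0: "s0 \<ge> 0"
  shows "H \<delta> s0 \<le> H0 s0"
proof (rule ccontr)
  let ?G = "\<lambda>s t. n s t - K (\<lambda>_. 1) \<delta> s t"
  define P where "P = (\<lambda>(s, t). Re (a * ?G s t))"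
  \<comment> \<open>Half of the supposed deficit at (s0, s0): by continuity P stays at most - \<eta>
    on a small square, which forces a negative double integral.\<close>
  define \<eta> where "\<eta> = - P (s0, s0) / 2"
  assume "\<not> H \<delta> s0 \<le> H0 s0"
  then have \<eta>: "\<eta> > 0" by (simp add: \<eta>_def P_def H_def H0_def right_diff_distrib)
  have contG2: "continuous_on (half_line \<times> half_line) (\<lambda>x. case x of (s, t) \<Rightarrow> ?G s t)"
    using n_C0 K_C0[OF \<delta> bounded_borel_const, of 1]
    unfolding case_prod_unfold C0_on_def by (intro continuous_on_diff) auto
  then have "continuous_on (half_line \<times> half_line) P"
    unfolding P_def case_prod_unfold by (intro continuous_on_Re continuous_on_mult_left)
  then obtain d where d: "d > 0"
    "\<And>x. x \<in> half_line \<times> half_line \<Longrightarrow> dist x (s0, s0) < d \<Longrightarrow> dist (P x) (P (s0, s0)) < \<eta>"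
    using \<eta> s0 unfolding continuous_on_iff by (metis SigmaI atLeast_iff)
  \<comment> \<open>The interval extends to the right of s0 only, so it stays in the half-line even
    for s0 = 0. Points of the square over it are at distance at most 2 r < d from (s0, s0).\<close>
  define r where "r = d / 3"
  have r: "r > 0" using d by (simp add: r_def)
  have P_less: "P (s, t) \<le> - \<eta>" if "s \<in> {s0..s0 + r}" "t \<in> {s0..s0 + r}" for s t
  proof -
    have "dist (s, t) (s0, s0) \<le> \<bar>s - s0\<bar> + \<bar>t - s0\<bar>"
      using sqrt_sum_squares_le_sum_abs[of "s - s0" "t - s0"]
      by (simp add: dist_Pair_Pair dist_real_def)
    also have "\<dots> < d" using that d by (auto simp: r_def)
    finally have "dist (P (s, t)) (P (s0, s0)) < \<eta>" using that s0 by (intro d) auto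
    then show ?thesis by (simp add: \<eta>_def dist_real_def abs_less_iff)
  qed
  let ?I = "{s0..s0 + r}"
  obtain k where k: "(interval_l2 s0 (s0 + r), k) \<in> calculus E (\<lambda>z. z)"
    using interval_domain[OF s0] by blast
  note rem = remainder_kernel[OF s0 k \<delta>]
  have lin: "bounded_linear (\<lambda>w. Re (a * w))"
    by (intro bounded_linear_compose[OF bounded_linear_Re bounded_linear_mult_right])
  have inner: "Re (a * integral ?I (?G s)) \<le> - \<eta> * r" if s: "s \<in> ?I" for s
  proof -
    have c1: "continuous_on ?I (?G s)"
      using continuous_section(1)[OF contG2, of s] s s0 by (auto elim: continuous_on_subset)
    have "Re (a * integral ?I (?G s)) = integral ?I (\<lambda>t. Re (a * ?G s t))"
      using integral_linear[OF integrable_continuous_interval[OF c1] lin] by (simp add: o_def)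
    also have "\<dots> \<le> integral ?I (\<lambda>t. - \<eta>)"
      by (intro integral_le integrable_continuous_interval continuous_intros c1)
        (use P_less[OF s] in \<open>auto simp: P_def\<close>)
    also have "\<dots> = - \<eta> * r" using r by simp
    finally show ?thesis .
  qed
  have "Re (a * cinner (E (- omega \<delta>) k) (interval_l2 s0 (s0 + r))) =
      integral ?I (\<lambda>s. Re (a * integral ?I (?G s)))"
    unfolding rem(1)
    using integral_linear[OF integrable_continuous_interval[OF rem(2)] lin] by (simp add: o_def)
  also have "\<dots> \<le> integral ?I (\<lambda>s. - \<eta> * r)"
    by (intro integral_le integrable_continuous_interval continuous_intros rem(2) inner)
  also have "\<dots> = - (\<eta> * r * r)" using r by simp
  also have "\<dots> < 0" using r \<eta> by simp
  finally show False using remainder_nonneg[OF k \<delta>] by simp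
qed

subsection \<open>Mercer's argument\<close>

definition null_seq :: "nat \<Rightarrow> real" where
  "null_seq k = inverse (real (Suc k))"

lemma null_seq: "null_seq \<longlonglongrightarrow> 0" "0 < null_seq k" "i \<le> j \<Longrightarrow> null_seq j \<le> null_seq i"
  unfolding null_seq_def by (rule LIMSEQ_inverse_real_of_nat, simp, simp add: le_imp_inverse_le)

lemma H0_bound: obtains B where "B > 0" "\<And>s. s \<ge> 0 \<Longrightarrow> H0 s \<le> B"
proof -
  obtain B where B: "B > 0" "\<And>x. x \<in> half_line \<times> half_line \<Longrightarrow> norm (case x of (s, t) \<Rightarrow> n s t) \<le> B"
    using n_C0 by (rule C0_on_bounded) blast
  have "H0 s \<le> (norm a + 1) * B" if "s \<ge> 0" for s
  proof -
    have "H0 s \<le> norm a * norm (n s s)"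
      unfolding H0_def norm_mult[symmetric] by (rule complex_Re_le_cmod)
    also have "\<dots> \<le> (norm a + 1) * B"
      using B(2)[of "(s, s)"] that by (intro mult_mono) auto
    finally show ?thesis .
  qed
  moreover have "(norm a + 1) * B > 0"
    using B(1) by (intro mult_pos_pos add_nonneg_pos) auto
  ultimately show ?thesis using that by blast
qed

text \<open>With s fixed, the increments of H at s tend to 0 because H is monotone and bounded,
  while those at t are bounded uniformly in t; the product of the two makes the row converge
  uniformly in t. The L_2 limit of the rows is nu s, up to conjugation, so the uniform limit is the
  continuous row of n and may be evaluated at t = s.\<close>

lemma H_tendsto:
  assumes s: "s \<ge> 0"
  shows "(\<lambda>k. H (null_seq k) s) \<longlonglongrightarrow> H0 s"
proof -
  let ?M = "\<lambda>k t. K (\<lambda>_. 1) (null_seq k) s t"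
  obtain B where B: "B > 0" "\<And>s. s \<ge> 0 \<Longrightarrow> H0 s \<le> B" by (rule H0_bound) blast
  have "incseq (\<lambda>k. H (null_seq k) s)"
    by (auto simp: incseq_def intro!: H_mono null_seq)
  moreover have "H (null_seq k) s \<le> H0 s" for k by (rule H_le_H0[OF null_seq(2) s])
  ultimately have "convergent (\<lambda>k. H (null_seq k) s)" by (auto intro: incseq_convergent simp: convergent_def)
  then have Cauchy: "Cauchy (\<lambda>k. H (null_seq k) s)" by (rule convergent_Cauchy)
  have "uniformly_Cauchy_on half_line ?M"
  proof (rule uniformly_Cauchy_onI')
    fix e :: real assume e: "e > 0"
    \<comment> \<open>Chosen so that \<eta> B = (c e)^2: the factor below \<eta> will come from s,
      the factor at most B from t.\<close>
    define \<eta> where "\<eta> = e\<^sup>2 * c\<^sup>2 / B"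
    have "\<eta> > 0" using e c_pos B by (simp add: \<eta>_def)
    then obtain k0 where k0: "\<And>i j. i \<ge> k0 \<Longrightarrow> j \<ge> k0 \<Longrightarrow> norm (H (null_seq i) s - H (null_seq j) s) < \<eta>"
      using CauchyD[OF Cauchy] by blast
    show "\<exists>M. \<forall>t\<in>half_line. \<forall>i\<ge>M. \<forall>j>i. dist (?M i t) (?M j t) < e"
    proof (intro exI ballI allI impI)
      fix t i j assume t: "t \<in> half_line" and i: "i \<ge> k0" and j: "j > i"
      note ij = null_seq(2)[of j] null_seq(3)[OF less_imp_le[OF j]]
      have "c * (Q (null_seq j) (null_seq i) s)\<^sup>2 < \<eta>"
        using Q_le[OF ij, of s] k0[of j i] i j by (auto simp: abs_less_iff)
      moreover have "c * (Q (null_seq j) (null_seq i) t)\<^sup>2 \<le> B"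
        using Q_le[OF ij, of t] H_le_H0[OF null_seq(2)[of j], of t] H_nonneg[OF null_seq(2)[of i], of t] B(2)[of t] t by simp
      moreover have "0 \<le> c * (Q (null_seq j) (null_seq i) s)\<^sup>2" using c_pos by simp
      ultimately have "(c * (Q (null_seq j) (null_seq i) s)\<^sup>2) * (c * (Q (null_seq j) (null_seq i) t)\<^sup>2) < \<eta> * B"
        using B(1) by (intro le_less_trans[OF mult_left_mono mult_strict_right_mono])
      then have "(c * (Q (null_seq j) (null_seq i) t * Q (null_seq j) (null_seq i) s))\<^sup>2 < (c * e)\<^sup>2"
        using B(1) by (simp add: \<eta>_def power2_eq_square algebra_simps)
      then have "c * (Q (null_seq j) (null_seq i) t * Q (null_seq j) (null_seq i) s) < c * e"
        by (rule power2_less_imp_less) (use c_pos e in simp)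
      then have "Q (null_seq j) (null_seq i) t * Q (null_seq j) (null_seq i) s < e" using c_pos by simp
      then show "dist (?M i t) (?M j t) < e"
        using norm_K_diff_le[OF ij bounded_borel_const, of 1 1 s t]
        by (simp add: dist_norm norm_minus_commute)
    qed
  qed
  then obtain L where L: "uniform_limit half_line ?M L sequentially"
    using Cauchy_uniformly_convergent unfolding uniformly_convergent_on_def by blast
  have n_cont: "continuous_on (half_line \<times> half_line) (\<lambda>(s, t). n s t)"
    using n_C0 by (simp add: C0_on_def)
  have M_cont: "continuous_on half_line (?M k)" for k
    using K_C0[OF null_seq(2) bounded_borel_const, of 1] by (intro continuous_section(1) s) (simp add: C0_on_def)
  have L_cont: "continuous_on half_line L"
    by (rule uniform_limit_theorem[OF _ L]) (auto intro!: always_eventually M_cont)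
  have ptw: "(\<lambda>k. ?M k t) \<longlonglongrightarrow> L t" if "t \<ge> 0" for t
    using tendsto_uniform_limitI[OF L, of t] that by simp
  have "AE t in half_leb. rep_l2 (F (\<lambda>z. cnj 1) (nu s)) t = cnj (L t)"
  proof (rule l2_tendsto_AE[OF F_row_tendsto[OF null_seq(1,2) bounded_borel_const s]])
    have "AE t in half_leb. \<forall>k. rep_l2 (F (\<lambda>z. cnj 1 * indicator (omega (null_seq k)) z) (nu s)) t = cnj (?M k t)"
      unfolding AE_all_countable using K_row_AE[OF null_seq(2) bounded_borel_const] by blast
    with AE_half_leb_nonneg
    show "AE t in half_leb. (\<lambda>k. rep_l2 (F (\<lambda>z. cnj 1 * indicator (omega (null_seq k)) z) (nu s)) t) \<longlonglongrightarrow> cnj (L t)"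
      by eventually_elim (simp only: ptw lim_cnj)
  qed
  moreover have "F (\<lambda>z. cnj 1) (nu s) = nu s"
    using F_cindicator[of UNIV 1 "nu s"] by (simp add: scaleC_one E_UNIV)
  ultimately have "AE t in half_leb. L t = n s t"
    using rep_nu[OF s] by (auto elim: eventually_elim2)
  then have "L s = n s s"
    using L_cont continuous_section(1)[OF n_cont s] s by (intro continuous_AE_half_line_eqD[where x = s])
  then have "(\<lambda>k. Re (a * ?M k s)) \<longlonglongrightarrow> Re (a * n s s)"
    using ptw[OF s] by (auto intro!: tendsto_intros)
  then show ?thesis by (simp add: H_def H0_def)
qed

text \<open>Dini's theorem for the decreasing differences H0 - H. At infinity they lie below H0, as
  H is nonnegative, and H0 is small there along with n on the diagonal. Monotonicity in \<delta>
  carries the estimate from the sequence to all small \<delta>.\<close>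

lemma H_uniform:
  assumes "\<eta> > 0"
  shows "\<exists>\<delta>0>0. \<forall>\<delta> s. 0 < \<delta> \<longrightarrow> \<delta> \<le> \<delta>0 \<longrightarrow> s \<ge> 0 \<longrightarrow> H0 s - H \<delta> s < \<eta>"
proof -
  have n_cont: "continuous_on (half_line \<times> half_line) (\<lambda>(s, t). n s t)"
    using n_C0 by (simp add: C0_on_def)
  have "\<exists>m. \<forall>k\<ge>m. \<forall>s\<ge>0. H0 s - H (null_seq k) s < \<eta>"
  proof (rule Dini_half_line[OF _ _ _ _ assms])
    show "continuous_on half_line (\<lambda>s. H0 s - H (null_seq k) s)" for k
      using K_C0[OF null_seq(2) bounded_borel_const, of 1 k] n_cont unfolding H0_def H_def
      by (intro continuous_intros continuous_section(3)) (auto simp: C0_on_def)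
    show "\<exists>C. compact C \<and> C \<subseteq> half_line \<and> (\<forall>s\<in>half_line - C. H0 s - H (null_seq 0) s < \<epsilon>)" if "\<epsilon> > 0" for \<epsilon>
    proof -
      have pos: "\<epsilon> / (norm a + 1) > 0"
        using that by (intro divide_pos_pos add_nonneg_pos) auto
      obtain C where C: "compact C" "C \<subseteq> half_line \<times> half_line"
        "\<And>x. x \<in> half_line \<times> half_line \<Longrightarrow> x \<notin> C \<Longrightarrow> norm (case x of (s, t) \<Rightarrow> n s t) < \<epsilon> / (norm a + 1)"
        using C0_onE[OF n_C0 pos] by metis
      show ?thesis
      proof (intro exI conjI ballI)
        show "compact (fst ` C)" by (intro compact_continuous_image C continuous_intros)
        show "fst ` C \<subseteq> half_line" using C(2) by auto
        fix s assume s: "s \<in> half_line - fst ` C"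
        then have "(s, s) \<notin> C" by (auto simp: image_iff)
        then have "norm (n s s) < \<epsilon> / (norm a + 1)" using C(3)[of "(s, s)"] s by simp
        then have "(norm a + 1) * norm (n s s) < \<epsilon>"
          using pos_less_divide_eq[of "norm a + 1"] norm_ge_zero[of a] by (simp add: mult.commute)
        moreover have "H0 s \<le> norm a * norm (n s s)"
          unfolding H0_def norm_mult[symmetric] by (rule complex_Re_le_cmod)
        ultimately show "H0 s - H (null_seq 0) s < \<epsilon>"
          using H_nonneg[OF null_seq(2), of 0 s] norm_ge_zero[of "n s s"]
          unfolding distrib_right mult_1_left by linarith
      qed
    qed
    show "H0 s - H (null_seq j) s \<le> H0 s - H (null_seq i) s" if "i \<le> j" for i j s
      using H_mono[OF null_seq(2) null_seq(3)[OF that]] by simp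
    show "(\<lambda>k. H0 s - H (null_seq k) s) \<longlonglongrightarrow> 0" if "s \<ge> 0" for s
      using tendsto_diff[OF tendsto_const H_tendsto[OF that], of "H0 s"] by simp
  qed
  then obtain m where m: "\<And>s. s \<ge> 0 \<Longrightarrow> H0 s - H (null_seq m) s < \<eta>" by blast
  have "H0 s - H \<delta> s < \<eta>" if "0 < \<delta>" "\<delta> \<le> null_seq m" "s \<ge> 0" for \<delta> s
    using m[OF that(3)] H_mono[OF that(1,2), of s] by simp
  then show ?thesis using null_seq(2) by blast
qed

text \<open>Since H \<delta>' \<le> H0, both factors Q are controlled by the uniformly small
  difference H0 - H \<delta>, for every \<delta>' below \<delta> at once.\<close>

lemma K_uniform_Cauchy:
  assumes v: "bounded_borel v" and e: "e > 0"
  shows "\<exists>\<delta>0>0. \<forall>\<delta>' \<delta> s t. 0 < \<delta>' \<longrightarrow> \<delta>' \<le> \<delta> \<longrightarrow> \<delta> \<le> \<delta>0 \<longrightarrow> s \<ge> 0 \<longrightarrow> t \<ge> 0 \<longrightarrow>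
    norm (K v \<delta>' s t - K v \<delta> s t) \<le> e"
proof -
  obtain L where L: "v \<in> borel_measurable borel" "\<And>z. norm (v z) \<le> L" "L \<ge> 0"
    using v by (rule bounded_borelE) (rule that)
  \<comment> \<open>With this choice L \<eta> / c = L / (L + 1) * e \<le> e; the summand 1 keeps the
    divisor positive when L = 0.\<close>
  define \<eta> where "\<eta> = e * c / (L + 1)"
  have \<eta>: "\<eta> > 0" using L e c_pos by (simp add: \<eta>_def)
  obtain \<delta>0 where \<delta>0: "\<delta>0 > 0" "\<And>\<delta> s. 0 < \<delta> \<Longrightarrow> \<delta> \<le> \<delta>0 \<Longrightarrow> s \<ge> 0 \<Longrightarrow> H0 s - H \<delta> s < \<eta>"
    using H_uniform[OF \<eta>] by blast
  have "norm (K v \<delta>' s t - K v \<delta> s t) \<le> e"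
    if \<delta>: "0 < \<delta>'" "\<delta>' \<le> \<delta>" "\<delta> \<le> \<delta>0" and st: "s \<ge> 0" "t \<ge> 0" for \<delta>' \<delta> s t
  proof -
    have Q2: "(Q \<delta>' \<delta> r)\<^sup>2 \<le> \<eta> / c" if "r \<ge> 0" for r
      using Q_le[OF \<delta>(1,2), of r] H_le_H0[OF \<delta>(1) that] \<delta>0(2)[of \<delta> r] \<delta> that c_pos
      by (simp add: pos_le_divide_eq mult.commute)
    have Q0: "Q \<delta>' \<delta> r \<ge> 0" for r by (simp add: Q_def)
    have "Q \<delta>' \<delta> t * Q \<delta>' \<delta> s \<le> sqrt (\<eta> / c) * sqrt (\<eta> / c)"
      using Q2 st Q0 \<eta> c_pos by (intro mult_mono real_le_rsqrt) auto
    then have "Q \<delta>' \<delta> t * Q \<delta>' \<delta> s \<le> \<eta> / c" using \<eta> c_pos by simp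
    then have "L * (Q \<delta>' \<delta> t * Q \<delta>' \<delta> s) \<le> L * (\<eta> / c)" using L(3) by (rule mult_left_mono)
    also have "\<dots> = L / (L + 1) * e" using c_pos by (simp add: \<eta>_def)
    also have "\<dots> \<le> e" using L(3) e by (simp add: pos_divide_le_eq field_simps)
    finally show ?thesis
      using norm_K_diff_le[OF \<delta>(1,2) v L(2), of s t] by (simp add: mult.assoc)
  qed
  with \<delta>0(1) show ?thesis by blast
qed

text \<open>The limit is defined along \<open>null_seq\<close>, but closeness is shown for every
  \<delta> below \<delta>0. This yields a limit along the filter at_right 0, from which arbitrary
  null sequences of positive numbers are served by composition.\<close>

lemma K_uniform_limit:
  assumes v: "bounded_borel v"
  shows "\<exists>\<Phi>. uniform_limit (half_line \<times> half_line) (\<lambda>\<delta> (s, t). K v \<delta> s t) (\<lambda>(s, t). \<Phi> s t) (at_right 0)"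
proof -
  define \<Phi> where "\<Phi> s t = lim (\<lambda>k. K v (null_seq k) s t)" for s t
  have small: "\<forall>\<^sub>F k in sequentially. null_seq k < \<delta>" if "\<delta> > 0" for \<delta>
    using null_seq(1) that by (rule order_tendstoD)
  have lim: "(\<lambda>k. K v (null_seq k) s t) \<longlonglongrightarrow> \<Phi> s t" if st: "s \<ge> 0" "t \<ge> 0" for s t
  proof -
    have "Cauchy (\<lambda>k. K v (null_seq k) s t)"
    proof (rule CauchyI')
      fix e :: real assume "e > 0"
      then have "e / 2 > 0" by simp
      then obtain \<delta>0 where \<delta>0: "\<delta>0 > 0" "\<And>\<delta>' \<delta>. 0 < \<delta>' \<Longrightarrow> \<delta>' \<le> \<delta> \<Longrightarrow> \<delta> \<le> \<delta>0 \<Longrightarrow>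
          norm (K v \<delta>' s t - K v \<delta> s t) \<le> e / 2"
        using K_uniform_Cauchy[OF v] st by meson
      obtain m where m: "null_seq m < \<delta>0" using small[OF \<delta>0(1)] eventually_happens'[OF sequentially_bot] by blast
      show "\<exists>M. \<forall>i\<ge>M. \<forall>j>i. dist (K v (null_seq i) s t) (K v (null_seq j) s t) < e"
      proof (intro exI allI impI)
        fix i j assume ij: "i \<ge> m" "j > i"
        have "norm (K v (null_seq j) s t - K v (null_seq i) s t) \<le> e / 2"
          using ij m null_seq(3)[of i j] null_seq(3)[of m i] by (intro \<delta>0 null_seq) auto
        then show "dist (K v (null_seq i) s t) (K v (null_seq j) s t) < e"
          using \<open>e > 0\<close> by (simp add: dist_norm norm_minus_commute)
      qed
    qed
    then show ?thesis
      unfolding \<Phi>_def by (simp add: Cauchy_convergent_iff convergent_LIMSEQ_iff)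
  qed
  have "uniform_limit (half_line \<times> half_line) (\<lambda>\<delta> (s, t). K v \<delta> s t) (\<lambda>(s, t). \<Phi> s t) (at_right 0)"
  proof (rule uniform_limitI)
    fix e :: real assume "e > 0"
    then have "e / 2 > 0" by simp
    then obtain \<delta>0 where \<delta>0: "\<delta>0 > 0" "\<And>\<delta>' \<delta> s t. 0 < \<delta>' \<Longrightarrow> \<delta>' \<le> \<delta> \<Longrightarrow> \<delta> \<le> \<delta>0 \<Longrightarrow> s \<ge> 0 \<Longrightarrow> t \<ge> 0 \<Longrightarrow>
        norm (K v \<delta>' s t - K v \<delta> s t) \<le> e / 2"
      using K_uniform_Cauchy[OF v] by meson
    have close: "dist (K v \<delta> s t) (\<Phi> s t) < e" if \<delta>: "0 < \<delta>" "\<delta> < \<delta>0" and st: "s \<ge> 0" "t \<ge> 0" for \<delta> s t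
    proof -
      have "norm (\<Phi> s t - K v \<delta> s t) \<le> e / 2"
      proof (rule tendsto_upperbound)
        show "(\<lambda>k. norm (K v (null_seq k) s t - K v \<delta> s t)) \<longlonglongrightarrow> norm (\<Phi> s t - K v \<delta> s t)"
          by (intro tendsto_intros lim st)
        show "\<forall>\<^sub>F k in sequentially. norm (K v (null_seq k) s t - K v \<delta> s t) \<le> e / 2"
          using small[OF \<delta>(1)]
          by eventually_elim (intro \<delta>0 null_seq st, use \<delta> in auto)
      qed simp
      then show ?thesis using \<open>e > 0\<close> by (simp add: dist_norm norm_minus_commute)
    qed
    have "\<forall>\<^sub>F \<delta> in at_right 0. \<delta> \<in> {0<..<\<delta>0}"
      by (rule eventually_at_right_real[OF \<delta>0(1)])
    then show "\<forall>\<^sub>F \<delta> in at_right 0. \<forall>x\<in>half_line \<times> half_line.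
        dist (case x of (s, t) \<Rightarrow> K v \<delta> s t) (case x of (s, t) \<Rightarrow> \<Phi> s t) < e"
      by eventually_elim (auto intro: close)
  qed
  then show ?thesis by (rule exI[of _ \<Phi>])
qed

end

text \<open>Rotation by the bisector \<alpha> places the sector symmetrically about the positive
  axis with half-opening \<beta> < pi / 2; there the real part is at least cos \<beta> times the
  modulus.\<close>

lemma sector_half_plane:
  assumes "\<theta>2 - \<theta>1 < pi"
  shows "\<exists>a c. c > 0 \<and> (\<forall>z\<in>sector \<theta>1 \<theta>2. c * norm z \<le> Re (a * z))"
proof (cases "\<theta>1 \<le> \<theta>2")
  case False
  then have "sector \<theta>1 \<theta>2 = {}" by (auto simp: sector_def)
  \<comment> \<open>The sector is empty, so any positive c will do.\<close>
  then show ?thesis by (intro exI[of _ 0] exI[of _ 1]) simp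
next
  case True
  define \<alpha> \<beta> where "\<alpha> = (\<theta>1 + \<theta>2) / 2" and "\<beta> = (\<theta>2 - \<theta>1) / 2"
  have \<beta>: "0 \<le> \<beta>" "\<beta> < pi / 2" using True assms by (auto simp: \<beta>_def)
  have "cos \<beta> * norm z \<le> Re (cis (- \<alpha>) * z)" if z: "z \<in> sector \<theta>1 \<theta>2" for z
  proof -
    obtain r \<theta> where r: "z = complex_of_real r * exp (\<i> * complex_of_real \<theta>)" "r \<ge> 0" "\<theta>1 \<le> \<theta>" "\<theta> \<le> \<theta>2"
      using z by (auto simp: sector_def)
    have z_eq: "z = complex_of_real r * cis \<theta>" by (simp add: r cis_conv_exp)
    have "\<bar>\<theta> - \<alpha>\<bar> \<le> \<beta>" using r by (auto simp: \<alpha>_def \<beta>_def abs_le_iff field_simps)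
    then have "cos \<beta> \<le> cos \<bar>\<theta> - \<alpha>\<bar>" using \<beta> by (intro cos_monotone_0_pi_le) auto
    then have "cos \<beta> \<le> cos (\<theta> - \<alpha>)" by simp
    then have "cos \<beta> * r \<le> cos (\<theta> - \<alpha>) * r" using r(2) by (rule mult_right_mono)
    moreover have "cis (- \<alpha>) * z = complex_of_real r * (cis \<theta> * cis (- \<alpha>))"
      unfolding z_eq by (simp only: ac_simps)
    then have "Re (cis (- \<alpha>) * z) = cos (\<theta> - \<alpha>) * r"
      unfolding cis_mult by simp
    moreover have "norm z = r" using r(2) by (simp add: z_eq norm_mult)
    ultimately show ?thesis by simp
  qed
  moreover have "cos \<beta> > 0" using \<beta> by (intro cos_gt_zero_pi) auto
  ultimately show ?thesis by blast
qed

text \<open>The analysis is carried out for the limit \<Psi> of the truncated kernels. As K0-kernels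
  of one operator coincide on the closed quadrant, its properties pass to any kernel \<Phi> of
  \<phi>(N); outside the quadrant \<Phi> is arbitrary, hence the restrictions to s \<ge> 0 and t
  \<ge> 0.\<close>

theorem theorem1:
  fixes N :: operator
    and n :: "real \<Rightarrow> real \<Rightarrow> complex"
    and E :: "complex set \<Rightarrow> l2 \<Rightarrow> l2"
    and \<theta>1 \<theta>2 :: real
    and v \<phi> :: "complex \<Rightarrow> complex"
  assumes "normal_operator N"
    and "K0_kernel N n"
    and "resolution_of_identity N E"
    and "\<theta>2 - \<theta>1 < pi"
    and "spectrum N \<subseteq> sector \<theta>1 \<theta>2"
    and "v \<in> borel_measurable borel"
    and "bounded (range v)"
    and "\<And>z. \<phi> z = z * v z"
  shows "(\<exists>\<Phi>. K0_kernel (calculus E \<phi>) \<Phi>) \<and>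
    (\<forall>\<Phi>. K0_kernel (calculus E \<phi>) \<Phi> \<longrightarrow>
      (\<forall>\<epsilon>>0. \<forall>s\<ge>0. \<forall>t\<ge>0. truncated_integrable E n \<phi> \<epsilon> s t) \<and>
      (\<forall>s\<ge>0. \<forall>t\<ge>0. ((\<lambda>\<epsilon>. truncated_integral E n \<phi> \<epsilon> s t) \<longlongrightarrow> \<Phi> s t) (at_right 0)) \<and>
      (\<forall>\<epsilon>>0. C0_on (half_line \<times> half_line) (\<lambda>(s, t). truncated_integral E n \<phi> \<epsilon> s t)) \<and>
      (\<forall>\<epsilon> :: nat \<Rightarrow> real. (\<forall>k. 0 < \<epsilon> k) \<longrightarrow> decseq \<epsilon> \<longrightarrow> \<epsilon> \<longlonglongrightarrow> 0 \<longrightarrow>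
         uniform_limit (half_line \<times> half_line)
           (\<lambda>k (s, t). truncated_integral E n \<phi> (\<epsilon> k) s t) (\<lambda>(s, t). \<Phi> s t) sequentially))"
proof -
  have N: "N = calculus E (\<lambda>z. z)" and pvm: "projection_valued_measure E"
    using assms(3) by (auto simp: resolution_of_identity_def)
  interpret pvm E by unfold_locales (rule pvm)
  obtain a c where ac: "c > 0" "\<And>z. z \<in> sector \<theta>1 \<theta>2 \<Longrightarrow> c * norm z \<le> Re (a * z)"
    using sector_half_plane[OF assms(4)] by blast
  interpret sectorial_kernel E n a c
  proof
    show "K0_kernel (calculus E (\<lambda>z. z)) n" using assms(2) by (simp add: N)
    show "c > 0" by (rule ac)
    show "AE z in mu x. c * norm z \<le> Re (a * z)" for x
      using assms(5) by (intro AE_spectrum ac(2)) (auto simp: N)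
  qed
  have v: "bounded_borel v" using assms(6,7) by (simp add: bounded_borel_def)
  note T = truncated_integral_eq[OF _ v assms(8)]
  obtain \<Psi> where \<Psi>: "uniform_limit (half_line \<times> half_line) (\<lambda>\<delta> (s, t). K v \<delta> s t) (\<lambda>(s, t). \<Psi> s t) (at_right 0)"
    using K_uniform_limit[OF v] by blast
  have seq: "uniform_limit (half_line \<times> half_line) (\<lambda>k (s, t). K v (\<epsilon> k) s t) (\<lambda>(s, t). \<Psi> s t) sequentially"
    if "\<And>k. 0 < \<epsilon> k" "\<epsilon> \<longlonglongrightarrow> 0" for \<epsilon> :: "nat \<Rightarrow> real"
  proof -
    have "filterlim \<epsilon> (at_right 0) sequentially"
      using that by (intro tendsto_imp_filterlim_at_right) auto
    from filterlim_compose[OF \<Psi> this] show ?thesis .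
  qed
  have K0\<Psi>: "K0_kernel (calculus E \<phi>) \<Psi>"
    by (rule limit_kernel[OF null_seq(1,2) v seq[OF null_seq(2,1)] assms(8)])
  show ?thesis
  proof (intro conjI allI impI)
    show "\<exists>\<Phi>. K0_kernel (calculus E \<phi>) \<Phi>" using K0\<Psi> by blast
    fix \<Phi> assume "K0_kernel (calculus E \<phi>) \<Phi>"
    then have \<Phi>: "\<Phi> s t = \<Psi> s t" if "s \<ge> 0" "t \<ge> 0" for s t
      using K0_kernel_unique[OF _ K0\<Psi>] that by blast
    show "truncated_integrable E n \<phi> \<epsilon> s t" if "\<epsilon> > 0" for \<epsilon> s t
      using that by (rule T)
    show "((\<lambda>\<epsilon>. truncated_integral E n \<phi> \<epsilon> s t) \<longlongrightarrow> \<Phi> s t) (at_right 0)" if st: "s \<ge> 0" "t \<ge> 0" for s t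
    proof -
      have "((\<lambda>\<epsilon>. K v \<epsilon> s t) \<longlongrightarrow> \<Psi> s t) (at_right 0)"
        using tendsto_uniform_limitI[OF \<Psi>, of "(s, t)"] st by simp
      moreover have "\<forall>\<^sub>F \<epsilon> in at_right 0. K v \<epsilon> s t = truncated_integral E n \<phi> \<epsilon> s t"
        using eventually_at_right_less[of "0::real"] by eventually_elim (simp add: T)
      ultimately show ?thesis using \<Phi>[OF st] by (simp add: Lim_transform_eventually)
    qed
    show "C0_on (half_line \<times> half_line) (\<lambda>(s, t). truncated_integral E n \<phi> \<epsilon> s t)" if "\<epsilon> > 0" for \<epsilon>
      using K_C0[OF that v] by (simp add: T that)
    show "uniform_limit (half_line \<times> half_line)
        (\<lambda>k (s, t). truncated_integral E n \<phi> (\<epsilon> k) s t) (\<lambda>(s, t). \<Phi> s t) sequentially"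
      if "\<forall>k. 0 < \<epsilon> k" "decseq \<epsilon>" "\<epsilon> \<longlonglongrightarrow> 0" for \<epsilon> :: "nat \<Rightarrow> real"
    proof -
      have "uniform_limit (half_line \<times> half_line) (\<lambda>k (s, t). K v (\<epsilon> k) s t) (\<lambda>(s, t). \<Psi> s t) sequentially"
        using that by (intro seq) auto
      then show ?thesis
        using that(1) \<Phi> by (subst uniform_limit_cong'[where g = "\<lambda>k (s, t). K v (\<epsilon> k) s t" and i = "\<lambda>(s, t). \<Psi> s t"])
          (auto simp: T)
    qed
  qed
qed

end
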